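(* Let $k$ be a field, $B$ a bialgebra over $k$, $\alpha:B\to B$ and $\beta:B\to B^{op,cop}$ morphisms of bialgebras, and $C$ a $B$-bimodule coalgebra with a grouplike element $\mathbb{I}$, given by a coalgebra morphism $\mathbb{I}:k\to C$. The category of $(\alpha,\beta)$-equivariant $C$-comodules is equivalent to the category of left $B$-modules admitting a flat connection with respect to the differential calculus $\mathcal{K}_{(\alpha,\beta)}^*(C,B)$.
   Context: Sweedler notation is used. $B^{op,cop}$ is $B$ with opposite multiplication and opposite comultiplication. A $B$-bimodule coalgebra $C$ is a coalgebra which is a $B$-bimodule such that $\Delta_C$ is a $B$-bimodule map for the diagonal actions: $(bcb')_{(1)}\otimes(bcb')_{(2)}=b_{(1)}c_{(1)}b'_{(1)}\otimes b_{(2)}c_{(2)}b'_{(2)}$. The symbol $\mathbb{I}$ also denotes the image of $1\in k$ in $C$, so $\Delta_C(\mathbb{I})=\mathbb{I}\otimes\mathbb{I}$; no condition is imposed on $\varepsilon(\mathbb{I})$. An $(\alpha,\beta)$-equivariant $C$-comodule is a $k$-vector space $X$ that is a left $C$-comodule, with coaction $\rho_X(x)=x_{(-1)}\otimes x_{(0)}\in C\otimes X$, and a left $B$-module, with $\rho_X(bx)=\alpha(b_{(1)})x_{(-1)}\beta(b_{(3)})\otimes b_{(2)}x_{(0)}$ for all $b\in B$, $x\in X$. Morphisms are $k$-linear maps compatible with action and coaction. The calculus: $\mathcal{K}_{(\alpha,\beta)}^n(C,B)=C^{\otimes n}\otimes B$ for $n\ge 0$, with product $$(c^1\otimes\cdots\otimes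 c^n\otimes b)(c^{n+1}\otimes\cdots\otimes c^{n+m}\otimes b')=c^1\otimes\cdots\otimes c^n\otimes\alpha(b_{(1)})c^{n+1}\beta(b_{(2m+1)})\otimes\cdots\otimes\alpha(b_{(m)})c^{n+m}\beta(b_{(m+2)})\otimes b_{(m+1)}b'$$ and differential $$d(c^1\otimes\cdots\otimes c^n\otimes b)=-(\mathbb{I}\otimes c^1\otimes\cdots\otimes c^n\otimes b)+\sum_{j=1}^n(-1)^{j-1}c^1\otimes\cdots\otimes c^j_{(1)}\otimes c^j_{(2)}\otimes\cdots\otimes c^n\otimes b+(-1)^n c^1\otimes\cdots\otimes c^n\otimes\alpha(b_{(1)})\mathbb{I}\beta(b_{(3)})\otimes b_{(2)}.$$ It is a differential graded $k$-algebra with degree-zero part $B$. Connections: let $(\Omega^*,d)$ be a differential graded $k$-algebra with $\Omega^0=A$, and $M$ a left $A$-module. A connection on $M$ is a $k$-linear map $\nabla:M\to\Omega^1\otimes_A M$ with $\nabla(am)=a\nabla(m)+d(a)\otimes_A m$. It extends to $\widehat\nabla$ on $\Omega^*\otimes_A M$ by $\widehat\nabla(\omega\otimes m)=d(\omega)\otimes_A m+(-1)^{|\omega|}\omega\nabla(m)$. It is flat if $\widehat\nabla^2=0$. Objects of the category of $B$-modules admitting a flat connection are pairs $(M,\nabla)$ with $M$ a left $B$-module and $\nabla$ a flat connection with respect to $\mathcal{K}_{(\alpha,\beta)}^*(C,B)$; morphisms $(M,\nabla)\to(M',\nabla')$ are $B$-linear maps $f$ with $\nabla' f=(\mathrm{id}\otimes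 f)\nabla$.
   Formalization: C-comodules are only required to be coassociative, not counital: with the counit axiom the claim fails (for B = C = k the comodules form Vect, while flat connections are vector spaces with an idempotent). *)

theory Defs
  imports "HOL-Algebra.Module" "HOL-Algebra.AbelCoset"
begin

section \<open>Tensor products as quotients of free modules\<close>

text \<open>
  Elements of the free module on \<open>G\<close> are finitely supported coefficient functions; a module
  given by generators \<open>G\<close> and relations \<open>R\<close> is the set of cosets of the submodule spanned by \<open>R\<close>.
  The \<open>mult\<close> and \<open>one\<close> fields of the module records built here are junk.
\<close>

definition free_module :: "('k, 'z) ring_scheme \<Rightarrow> 'g set \<Rightarrow> ('k, 'g \<Rightarrow> 'k) module" where
  "free_module K G =
    \<lparr> carrier = {p. (\<forall>g. p g \<in> carrier K) \<and> (\<forall>g. g \<notin> G \<longrightarrow> p g = \<zero>\<^bsub>K\<^esub>) \<and> finite {g. p g \<noteq> \<zero>\<^bsub>K\<^esub>}},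
      mult = undefined, one = undefined,
      zero = (\<lambda>g. \<zero>\<^bsub>K\<^esub>), add = (\<lambda>p q g. p g \<oplus>\<^bsub>K\<^esub> q g),
      smult = (\<lambda>a p g. a \<otimes>\<^bsub>K\<^esub> p g) \<rparr>"

definition free_gen :: "('k, 'z) ring_scheme \<Rightarrow> 'g \<Rightarrow> ('g \<Rightarrow> 'k)" where
  "free_gen K g = (\<lambda>h. if h = g then \<one>\<^bsub>K\<^esub> else \<zero>\<^bsub>K\<^esub>)"

definition rel_span :: "('k, 'z) ring_scheme \<Rightarrow> 'g set \<Rightarrow> ('g \<Rightarrow> 'k) set \<Rightarrow> ('g \<Rightarrow> 'k) set" where
  "rel_span K G R = \<Inter> {N. submodule N K (free_module K G) \<and> R \<subseteq> N}"

definition rel_class ::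
  "('k, 'z) ring_scheme \<Rightarrow> 'g set \<Rightarrow> ('g \<Rightarrow> 'k) set \<Rightarrow> ('g \<Rightarrow> 'k) \<Rightarrow> ('g \<Rightarrow> 'k) set" where
  "rel_class K G R p = rel_span K G R +>\<^bsub>free_module K G\<^esub> p"

definition presented_module ::
  "('k, 'z) ring_scheme \<Rightarrow> 'g set \<Rightarrow> ('g \<Rightarrow> 'k) set \<Rightarrow> ('k, ('g \<Rightarrow> 'k) set) module" where
  "presented_module K G R =
    \<lparr> carrier = a_rcosets\<^bsub>free_module K G\<^esub> (rel_span K G R),
      mult = undefined, one = undefined,
      zero = rel_span K G R,
      add = set_add (free_module K G),
      smult = (\<lambda>a t. \<Union>p\<in>t. rel_class K G R (a \<odot>\<^bsub>free_module K G\<^esub> p)) \<rparr>"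

text \<open>
  \<open>lin_ext K W f\<close> is the linear map into \<open>W\<close> that sends the class of each generator \<open>g\<close> to \<open>f g\<close>.
  It is evaluated on a chosen representative, which is irrelevant as soon as \<open>f\<close> respects the
  relations; it is used below only for such \<open>f\<close> (that is, for multilinear, resp. balanced, ones).
\<close>

definition lin_ext ::
  "('k, 'z) ring_scheme \<Rightarrow> ('k, 'w, 'y) module_scheme \<Rightarrow> ('g \<Rightarrow> 'w) \<Rightarrow> ('g \<Rightarrow> 'k) set \<Rightarrow> 'w" where
  "lin_ext K W f t =
    (let p = (SOME p. p \<in> t)
     in \<Oplus>\<^bsub>W\<^esub>g \<in> {g. p g \<noteq> \<zero>\<^bsub>K\<^esub>}. p g \<odot>\<^bsub>W\<^esub> f g)"

text \<open>
  \<open>tens K V n M\<close> is \<open>V \<otimes> \<dots> \<otimes> V \<otimes> M\<close> over \<open>K\<close> with \<open>n\<close> factors \<open>V\<close>; its generators are pairs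
  \<open>([v\<^sub>1, \<dots>, v\<^sub>n], m)\<close>. All tensor products over the ground field are of this form, in particular
  \<open>V \<otimes> M = tens K V 1 M\<close>.
\<close>

definition tens_gens ::
  "('k, 'v, 'y) module_scheme \<Rightarrow> nat \<Rightarrow> ('k, 'm, 'x) module_scheme \<Rightarrow> ('v list \<times> 'm) set" where
  "tens_gens V n M = {(vs, m). length vs = n \<and> set vs \<subseteq> carrier V \<and> m \<in> carrier M}"

definition tens_rels ::
  "('k, 'z) ring_scheme \<Rightarrow> ('k, 'v, 'y) module_scheme \<Rightarrow> nat \<Rightarrow> ('k, 'm, 'x) module_scheme
    \<Rightarrow> ('v list \<times> 'm \<Rightarrow> 'k) set" where
  "tens_rels K V n M =
    (let G = tens_gens V n M; F = free_module K G; \<delta> = free_gen K in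
      {\<delta> (us @ (v \<oplus>\<^bsub>V\<^esub> w) # ws, m) \<ominus>\<^bsub>F\<^esub> \<delta> (us @ v # ws, m) \<ominus>\<^bsub>F\<^esub> \<delta> (us @ w # ws, m) | us v w ws m.
         (us @ v # ws, m) \<in> G \<and> (us @ w # ws, m) \<in> G} \<union>
      {\<delta> (us @ (a \<odot>\<^bsub>V\<^esub> v) # ws, m) \<ominus>\<^bsub>F\<^esub> a \<odot>\<^bsub>F\<^esub> \<delta> (us @ v # ws, m) | a us v ws m.
         a \<in> carrier K \<and> (us @ v # ws, m) \<in> G} \<union>
      {\<delta> (vs, m \<oplus>\<^bsub>M\<^esub> m') \<ominus>\<^bsub>F\<^esub> \<delta> (vs, m) \<ominus>\<^bsub>F\<^esub> \<delta> (vs, m') | vs m m'.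
         (vs, m) \<in> G \<and> (vs, m') \<in> G} \<union>
      {\<delta> (vs, a \<odot>\<^bsub>M\<^esub> m) \<ominus>\<^bsub>F\<^esub> a \<odot>\<^bsub>F\<^esub> \<delta> (vs, m) | a vs m.
         a \<in> carrier K \<and> (vs, m) \<in> G})"

definition tens ::
  "('k, 'z) ring_scheme \<Rightarrow> ('k, 'v, 'y) module_scheme \<Rightarrow> nat \<Rightarrow> ('k, 'm, 'x) module_scheme
    \<Rightarrow> ('k, ('v list \<times> 'm \<Rightarrow> 'k) set) module" where
  "tens K V n M = presented_module K (tens_gens V n M) (tens_rels K V n M)"

text \<open>The pure tensor \<open>v\<^sub>1 \<otimes> \<dots> \<otimes> v\<^sub>n \<otimes> m\<close> is \<open>pt K V M [v\<^sub>1, \<dots>, v\<^sub>n] m\<close>.\<close>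

definition pt ::
  "('k, 'z) ring_scheme \<Rightarrow> ('k, 'v, 'y) module_scheme \<Rightarrow> ('k, 'm, 'x) module_scheme
    \<Rightarrow> 'v list \<Rightarrow> 'm \<Rightarrow> ('v list \<times> 'm \<Rightarrow> 'k) set" where
  "pt K V M vs m =
    rel_class K (tens_gens V (length vs) M) (tens_rels K V (length vs) M) (free_gen K (vs, m))"

text \<open>
  Sweedler notation: \<open>sw2 K W t (\<lambda>x y. f x y)\<close> is \<open>f t\<^sub>1 t\<^sub>2 \<in> W\<close> summed over \<open>t = t\<^sub>1 \<otimes> t\<^sub>2\<close>, and
  similarly for \<open>sw3\<close> and \<open>t = t\<^sub>1 \<otimes> t\<^sub>2 \<otimes> t\<^sub>3\<close>.
\<close>

definition sw2 ::
  "('k, 'z) ring_scheme \<Rightarrow> ('k, 'w, 'y) module_scheme \<Rightarrow> ('v list \<times> 'm \<Rightarrow> 'k) set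
    \<Rightarrow> ('v \<Rightarrow> 'm \<Rightarrow> 'w) \<Rightarrow> 'w" where
  "sw2 K W t f = lin_ext K W (\<lambda>(vs, m). f (vs ! 0) m) t"

definition sw3 ::
  "('k, 'z) ring_scheme \<Rightarrow> ('k, 'w, 'y) module_scheme \<Rightarrow> ('v list \<times> 'm \<Rightarrow> 'k) set
    \<Rightarrow> ('v \<Rightarrow> 'v \<Rightarrow> 'm \<Rightarrow> 'w) \<Rightarrow> 'w" where
  "sw3 K W t f = lin_ext K W (\<lambda>(vs, m). f (vs ! 0) (vs ! 1) m) t"

text \<open>
  The tensor product \<open>V \<otimes>\<^sub>A M\<close> over a (noncommutative) \<open>K\<close>-algebra \<open>A\<close>, where \<open>ra\<close> is the right
  action of \<open>A\<close> on \<open>V\<close> and \<open>la\<close> the left action of \<open>A\<close> on \<open>M\<close>.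
\<close>

definition bal_rels ::
  "('k, 'z) ring_scheme \<Rightarrow> ('k, 'a, 'u) module_scheme
    \<Rightarrow> ('k, 'v, 'y) module_scheme \<Rightarrow> ('v \<Rightarrow> 'a \<Rightarrow> 'v)
    \<Rightarrow> ('k, 'm, 'x) module_scheme \<Rightarrow> ('a \<Rightarrow> 'm \<Rightarrow> 'm) \<Rightarrow> ('v \<times> 'm \<Rightarrow> 'k) set" where
  "bal_rels K A V ra M la =
    (let F = free_module K (carrier V \<times> carrier M); \<delta> = free_gen K in
      {\<delta> (v \<oplus>\<^bsub>V\<^esub> w, m) \<ominus>\<^bsub>F\<^esub> \<delta> (v, m) \<ominus>\<^bsub>F\<^esub> \<delta> (w, m) | v w m.
         v \<in> carrier V \<and> w \<in> carrier V \<and> m \<in> carrier M} \<union>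
      {\<delta> (v, m \<oplus>\<^bsub>M\<^esub> m') \<ominus>\<^bsub>F\<^esub> \<delta> (v, m) \<ominus>\<^bsub>F\<^esub> \<delta> (v, m') | v m m'.
         v \<in> carrier V \<and> m \<in> carrier M \<and> m' \<in> carrier M} \<union>
      {\<delta> (c \<odot>\<^bsub>V\<^esub> v, m) \<ominus>\<^bsub>F\<^esub> c \<odot>\<^bsub>F\<^esub> \<delta> (v, m) | c v m.
         c \<in> carrier K \<and> v \<in> carrier V \<and> m \<in> carrier M} \<union>
      {\<delta> (v, c \<odot>\<^bsub>M\<^esub> m) \<ominus>\<^bsub>F\<^esub> c \<odot>\<^bsub>F\<^esub> \<delta> (v, m) | c v m.
         c \<in> carrier K \<and> v \<in> carrier V \<and> m \<in> carrier M} \<union>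
      {\<delta> (ra v a, m) \<ominus>\<^bsub>F\<^esub> \<delta> (v, la a m) | v a m.
         v \<in> carrier V \<and> a \<in> carrier A \<and> m \<in> carrier M})"

definition bal_tens ::
  "('k, 'z) ring_scheme \<Rightarrow> ('k, 'a, 'u) module_scheme
    \<Rightarrow> ('k, 'v, 'y) module_scheme \<Rightarrow> ('v \<Rightarrow> 'a \<Rightarrow> 'v)
    \<Rightarrow> ('k, 'm, 'x) module_scheme \<Rightarrow> ('a \<Rightarrow> 'm \<Rightarrow> 'm) \<Rightarrow> ('k, ('v \<times> 'm \<Rightarrow> 'k) set) module" where
  "bal_tens K A V ra M la =
    presented_module K (carrier V \<times> carrier M) (bal_rels K A V ra M la)"

definition bal_pt ::
  "('k, 'z) ring_scheme \<Rightarrow> ('k, 'a, 'u) module_scheme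
    \<Rightarrow> ('k, 'v, 'y) module_scheme \<Rightarrow> ('v \<Rightarrow> 'a \<Rightarrow> 'v)
    \<Rightarrow> ('k, 'm, 'x) module_scheme \<Rightarrow> ('a \<Rightarrow> 'm \<Rightarrow> 'm) \<Rightarrow> 'v \<Rightarrow> 'm \<Rightarrow> ('v \<times> 'm \<Rightarrow> 'k) set" where
  "bal_pt K A V ra M la v m =
    rel_class K (carrier V \<times> carrier M) (bal_rels K A V ra M la) (free_gen K (v, m))"


section \<open>Coalgebras, bialgebras, bimodule coalgebras\<close>

definition linear_map ::
  "('k, 'z) ring_scheme \<Rightarrow> ('k, 'v, 'y) module_scheme \<Rightarrow> ('k, 'w, 'x) module_scheme
    \<Rightarrow> ('v \<Rightarrow> 'w) \<Rightarrow> bool" where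
  "linear_map K V W f \<longleftrightarrow>
    f \<in> carrier V \<rightarrow> carrier W \<and>
    (\<forall>x\<in>carrier V. \<forall>y\<in>carrier V. f (x \<oplus>\<^bsub>V\<^esub> y) = f x \<oplus>\<^bsub>W\<^esub> f y) \<and>
    (\<forall>a\<in>carrier K. \<forall>x\<in>carrier V. f (a \<odot>\<^bsub>V\<^esub> x) = a \<odot>\<^bsub>W\<^esub> f x)"

text \<open>The \<open>mult\<close> and \<open>one\<close> fields are meaningful for bialgebras only.\<close>

record ('k, 'v) coalg = "('k, 'v) module" +
  comult :: "'v \<Rightarrow> ('v list \<times> 'v \<Rightarrow> 'k) set"
  counit :: "'v \<Rightarrow> 'k"

locale coalgebra =
  fixes K :: "'k ring" and C :: "('k, 'c) coalg"
  assumes space: "module K C"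
    and comult_linear: "linear_map K C (tens K C 1 C) (comult C)"
    and counit_closed: "c \<in> carrier C \<Longrightarrow> counit C c \<in> carrier K"
    and counit_add: "\<lbrakk>c \<in> carrier C; c' \<in> carrier C\<rbrakk> \<Longrightarrow>
          counit C (c \<oplus>\<^bsub>C\<^esub> c') = counit C c \<oplus>\<^bsub>K\<^esub> counit C c'"
    and counit_smult: "\<lbrakk>a \<in> carrier K; c \<in> carrier C\<rbrakk> \<Longrightarrow>
          counit C (a \<odot>\<^bsub>C\<^esub> c) = a \<otimes>\<^bsub>K\<^esub> counit C c"
    and coassoc: "c \<in> carrier C \<Longrightarrow>
          sw2 K (tens K C 2 C) (comult C c)
            (\<lambda>x y. sw2 K (tens K C 2 C) (comult C x) (\<lambda>x1 x2. pt K C C [x1, x2] y)) =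
          sw2 K (tens K C 2 C) (comult C c)
            (\<lambda>x y. sw2 K (tens K C 2 C) (comult C y) (\<lambda>y1 y2. pt K C C [x, y1] y2))"
    and counit_left: "c \<in> carrier C \<Longrightarrow>
          sw2 K C (comult C c) (\<lambda>x y. counit C x \<odot>\<^bsub>C\<^esub> y) = c"
    and counit_right: "c \<in> carrier C \<Longrightarrow>
          sw2 K C (comult C c) (\<lambda>x y. counit C y \<odot>\<^bsub>C\<^esub> x) = c"

locale bialgebra = coalgebra K B for K :: "'k ring" and B :: "('k, 'b) coalg" +
  assumes ring: "ring B"
    and smult_mult_left: "\<lbrakk>a \<in> carrier K; x \<in> carrier B; y \<in> carrier B\<rbrakk> \<Longrightarrow>
          (a \<odot>\<^bsub>B\<^esub> x) \<otimes>\<^bsub>B\<^esub> y = a \<odot>\<^bsub>B\<^esub> (x \<otimes>\<^bsub>B\<^esub> y)"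
    and smult_mult_right: "\<lbrakk>a \<in> carrier K; x \<in> carrier B; y \<in> carrier B\<rbrakk> \<Longrightarrow>
          x \<otimes>\<^bsub>B\<^esub> (a \<odot>\<^bsub>B\<^esub> y) = a \<odot>\<^bsub>B\<^esub> (x \<otimes>\<^bsub>B\<^esub> y)"
    and comult_mult: "\<lbrakk>x \<in> carrier B; y \<in> carrier B\<rbrakk> \<Longrightarrow>
          comult B (x \<otimes>\<^bsub>B\<^esub> y) =
          sw2 K (tens K B 1 B) (comult B x) (\<lambda>x1 x2.
            sw2 K (tens K B 1 B) (comult B y) (\<lambda>y1 y2. pt K B B [x1 \<otimes>\<^bsub>B\<^esub> y1] (x2 \<otimes>\<^bsub>B\<^esub> y2)))"
    and comult_one: "comult B \<one>\<^bsub>B\<^esub> = pt K B B [\<one>\<^bsub>B\<^esub>] \<one>\<^bsub>B\<^esub>"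
    and counit_mult: "\<lbrakk>x \<in> carrier B; y \<in> carrier B\<rbrakk> \<Longrightarrow>
          counit B (x \<otimes>\<^bsub>B\<^esub> y) = counit B x \<otimes>\<^bsub>K\<^esub> counit B y"
    and counit_one: "counit B \<one>\<^bsub>B\<^esub> = \<one>\<^bsub>K\<^esub>"

definition bialgebra_hom ::
  "'k ring \<Rightarrow> ('k, 'b) coalg \<Rightarrow> ('k, 'b') coalg \<Rightarrow> ('b \<Rightarrow> 'b') \<Rightarrow> bool" where
  "bialgebra_hom K B B' f \<longleftrightarrow>
    linear_map K B B' f \<and>
    (\<forall>x\<in>carrier B. \<forall>y\<in>carrier B. f (x \<otimes>\<^bsub>B\<^esub> y) = f x \<otimes>\<^bsub>B'\<^esub> f y) \<and>
    f \<one>\<^bsub>B\<^esub> = \<one>\<^bsub>B'\<^esub> \<and>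
    (\<forall>x\<in>carrier B. comult B' (f x) =
       sw2 K (tens K B' 1 B') (comult B x) (\<lambda>x1 x2. pt K B' B' [f x1] (f x2))) \<and>
    (\<forall>x\<in>carrier B. counit B' (f x) = counit B x)"

definition op_cop :: "'k ring \<Rightarrow> ('k, 'b) coalg \<Rightarrow> ('k, 'b) coalg" where
  "op_cop K B = B
    \<lparr> mult := (\<lambda>x y. y \<otimes>\<^bsub>B\<^esub> x),
      comult := (\<lambda>x. sw2 K (tens K B 1 B) (comult B x) (\<lambda>x1 x2. pt K B B [x2] x1)) \<rparr>"

text \<open>
  \<open>iter_comult K B n b = b\<^sub>(\<^sub>1\<^sub>) \<otimes> \<dots> \<otimes> b\<^sub>(\<^sub>n\<^sub>+\<^sub>1\<^sub>)\<close>, an element of \<open>tens K B n B\<close>.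
\<close>

primrec iter_comult ::
  "'k ring \<Rightarrow> ('k, 'b) coalg \<Rightarrow> nat \<Rightarrow> 'b \<Rightarrow> ('b list \<times> 'b \<Rightarrow> 'k) set" where
  "iter_comult K B 0 b = pt K B B [] b"
| "iter_comult K B (Suc n) b =
    lin_ext K (tens K B (Suc n) B)
      (\<lambda>(bs, b'). sw2 K (tens K B (Suc n) B) (comult B b') (\<lambda>x y. pt K B B (bs @ [x]) y))
      (iter_comult K B n b)"

locale bimodule_coalgebra = B?: bialgebra K B + C?: coalgebra K C
  for K :: "'k ring" and B :: "('k, 'b) coalg" and C :: "('k, 'c) coalg" +
  fixes la :: "'b \<Rightarrow> 'c \<Rightarrow> 'c" and ra :: "'c \<Rightarrow> 'b \<Rightarrow> 'c"
  assumes la_linear1: "c \<in> carrier C \<Longrightarrow> linear_map K B C (\<lambda>b. la b c)"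
    and la_linear2: "b \<in> carrier B \<Longrightarrow> linear_map K C C (la b)"
    and la_one: "c \<in> carrier C \<Longrightarrow> la \<one>\<^bsub>B\<^esub> c = c"
    and la_mult: "\<lbrakk>b \<in> carrier B; b' \<in> carrier B; c \<in> carrier C\<rbrakk> \<Longrightarrow>
          la (b \<otimes>\<^bsub>B\<^esub> b') c = la b (la b' c)"
    and ra_linear1: "b \<in> carrier B \<Longrightarrow> linear_map K C C (\<lambda>c. ra c b)"
    and ra_linear2: "c \<in> carrier C \<Longrightarrow> linear_map K B C (ra c)"
    and ra_one: "c \<in> carrier C \<Longrightarrow> ra c \<one>\<^bsub>B\<^esub> = c"
    and ra_mult: "\<lbrakk>b \<in> carrier B; b' \<in> carrier B; c \<in> carrier C\<rbrakk> \<Longrightarrow>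
          ra c (b \<otimes>\<^bsub>B\<^esub> b') = ra (ra c b) b'"
    and la_ra: "\<lbrakk>b \<in> carrier B; b' \<in> carrier B; c \<in> carrier C\<rbrakk> \<Longrightarrow>
          ra (la b c) b' = la b (ra c b')"
    and comult_bimodule: "\<lbrakk>b \<in> carrier B; c \<in> carrier C; b' \<in> carrier B\<rbrakk> \<Longrightarrow>
          comult C (ra (la b c) b') =
          sw2 K (tens K C 1 C) (comult B b) (\<lambda>b1 b2.
            sw2 K (tens K C 1 C) (comult C c) (\<lambda>c1 c2.
              sw2 K (tens K C 1 C) (comult B b') (\<lambda>b1' b2'.
                pt K C C [ra (la b1 c1) b1'] (ra (la b2 c2) b2'))))"

definition grouplike :: "'k ring \<Rightarrow> ('k, 'c) coalg \<Rightarrow> 'c \<Rightarrow> bool" where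
  "grouplike K C g \<longleftrightarrow> g \<in> carrier C \<and> comult C g = pt K C C [g] g"


section \<open>Categories and equivalences\<close>

record ('o, 'm) category_data =
  Obj :: "'o set"
  Hom :: "'o \<Rightarrow> 'o \<Rightarrow> 'm set"
  Ident :: "'o \<Rightarrow> 'm"
  Comp :: "'o \<Rightarrow> 'o \<Rightarrow> 'o \<Rightarrow> 'm \<Rightarrow> 'm \<Rightarrow> 'm"
    \<comment> \<open>\<open>Comp X Y Z g f\<close> is the composite of \<open>f : X \<rightarrow> Y\<close> and \<open>g : Y \<rightarrow> Z\<close>\<close>

locale category =
  fixes \<C> :: "('o, 'm) category_data"
  assumes ident_hom: "X \<in> Obj \<C> \<Longrightarrow> Ident \<C> X \<in> Hom \<C> X X"
    and comp_hom: "\<lbrakk>X \<in> Obj \<C>; Y \<in> Obj \<C>; Z \<in> Obj \<C>; f \<in> Hom \<C> X Y; g \<in> Hom \<C> Y Z\<rbrakk> \<Longrightarrow>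
          Comp \<C> X Y Z g f \<in> Hom \<C> X Z"
    and ident_left: "\<lbrakk>X \<in> Obj \<C>; Y \<in> Obj \<C>; f \<in> Hom \<C> X Y\<rbrakk> \<Longrightarrow> Comp \<C> X Y Y (Ident \<C> Y) f = f"
    and ident_right: "\<lbrakk>X \<in> Obj \<C>; Y \<in> Obj \<C>; f \<in> Hom \<C> X Y\<rbrakk> \<Longrightarrow> Comp \<C> X X Y f (Ident \<C> X) = f"
    and comp_assoc: "\<lbrakk>X \<in> Obj \<C>; Y \<in> Obj \<C>; Z \<in> Obj \<C>; W \<in> Obj \<C>;
          f \<in> Hom \<C> X Y; g \<in> Hom \<C> Y Z; h \<in> Hom \<C> Z W\<rbrakk> \<Longrightarrow>
          Comp \<C> X Z W h (Comp \<C> X Y Z g f) = Comp \<C> X Y W (Comp \<C> Y Z W h g) f"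

locale cat_functor = S?: category \<C> + T?: category \<D>
  for \<C> :: "('o, 'm) category_data" and \<D> :: "('p, 'n) category_data" +
  fixes Fo :: "'o \<Rightarrow> 'p" and Fm :: "'o \<Rightarrow> 'o \<Rightarrow> 'm \<Rightarrow> 'n"
  assumes obj: "X \<in> Obj \<C> \<Longrightarrow> Fo X \<in> Obj \<D>"
    and hom: "\<lbrakk>X \<in> Obj \<C>; Y \<in> Obj \<C>; f \<in> Hom \<C> X Y\<rbrakk> \<Longrightarrow> Fm X Y f \<in> Hom \<D> (Fo X) (Fo Y)"
    and ident: "X \<in> Obj \<C> \<Longrightarrow> Fm X X (Ident \<C> X) = Ident \<D> (Fo X)"
    and comp: "\<lbrakk>X \<in> Obj \<C>; Y \<in> Obj \<C>; Z \<in> Obj \<C>; f \<in> Hom \<C> X Y; g \<in> Hom \<C> Y Z\<rbrakk> \<Longrightarrow>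
          Fm X Z (Comp \<C> X Y Z g f) = Comp \<D> (Fo X) (Fo Y) (Fo Z) (Fm Y Z g) (Fm X Y f)"

definition cat_iso :: "('o, 'm) category_data \<Rightarrow> 'o \<Rightarrow> 'o \<Rightarrow> 'm \<Rightarrow> bool" where
  "cat_iso \<C> X Y f \<longleftrightarrow> f \<in> Hom \<C> X Y \<and>
    (\<exists>g\<in>Hom \<C> Y X. Comp \<C> X Y X g f = Ident \<C> X \<and> Comp \<C> Y X Y f g = Ident \<C> Y)"

definition natural_iso ::
  "('o, 'm) category_data \<Rightarrow> ('p, 'n) category_data
    \<Rightarrow> ('o \<Rightarrow> 'p) \<Rightarrow> ('o \<Rightarrow> 'o \<Rightarrow> 'm \<Rightarrow> 'n) \<Rightarrow> ('o \<Rightarrow> 'p) \<Rightarrow> ('o \<Rightarrow> 'o \<Rightarrow> 'm \<Rightarrow> 'n)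
    \<Rightarrow> ('o \<Rightarrow> 'n) \<Rightarrow> bool" where
  "natural_iso \<C> \<D> Fo Fm Go Gm \<tau> \<longleftrightarrow>
    (\<forall>X\<in>Obj \<C>. cat_iso \<D> (Fo X) (Go X) (\<tau> X)) \<and>
    (\<forall>X\<in>Obj \<C>. \<forall>Y\<in>Obj \<C>. \<forall>f\<in>Hom \<C> X Y.
       Comp \<D> (Fo X) (Fo Y) (Go Y) (\<tau> Y) (Fm X Y f) =
       Comp \<D> (Fo X) (Go X) (Go Y) (Gm X Y f) (\<tau> X))"

definition equivalent_categories ::
  "('o, 'm) category_data \<Rightarrow> ('p, 'n) category_data \<Rightarrow> bool" where
  "equivalent_categories \<C> \<D> \<longleftrightarrow>
    (\<exists>Fo Fm Go Gm \<eta> \<theta>.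
       cat_functor \<C> \<D> Fo Fm \<and> cat_functor \<D> \<C> Go Gm \<and>
       natural_iso \<C> \<C> (\<lambda>X. X) (\<lambda>X Y f. f)
         (\<lambda>X. Go (Fo X)) (\<lambda>X Y f. Gm (Fo X) (Fo Y) (Fm X Y f)) \<eta> \<and>
       natural_iso \<D> \<D> (\<lambda>Y. Fo (Go Y)) (\<lambda>X Y f. Fm (Go X) (Go Y) (Gm X Y f))
         (\<lambda>Y. Y) (\<lambda>X Y f. f) \<theta>)"


section \<open>Equivariant comodules\<close>

record ('k, 'b, 'x) left_mod = "('k, 'x) module" +
  act :: "'b \<Rightarrow> 'x \<Rightarrow> 'x"

definition left_module ::
  "'k ring \<Rightarrow> ('k, 'b, 'y) module_scheme \<Rightarrow> ('k, 'b, 'x) left_mod \<Rightarrow> bool" where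
  "left_module K A M \<longleftrightarrow>
    module K M \<and>
    (\<forall>x\<in>carrier M. linear_map K A M (\<lambda>a. act M a x)) \<and>
    (\<forall>a\<in>carrier A. linear_map K M M (act M a)) \<and>
    (\<forall>x\<in>carrier M. act M \<one>\<^bsub>A\<^esub> x = x) \<and>
    (\<forall>a\<in>carrier A. \<forall>a'\<in>carrier A. \<forall>x\<in>carrier M. act M (a \<otimes>\<^bsub>A\<^esub> a') x = act M a (act M a' x))"

text \<open>
  Comodules are coassociative but not required to be counital. A counit condition on the coaction
  has no counterpart for flat connections: on every \<open>B\<close>-module \<open>M\<close>, \<open>\<nabla>(x) = - \<II> \<otimes> x\<close> is a flat
  connection, and it corresponds to the zero coaction.
\<close>

definition left_comodule ::
  "'k ring \<Rightarrow> ('k, 'c) coalg \<Rightarrow> ('k, 'x, 'y) module_scheme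
    \<Rightarrow> ('x \<Rightarrow> ('c list \<times> 'x \<Rightarrow> 'k) set) \<Rightarrow> bool" where
  "left_comodule K C X \<rho> \<longleftrightarrow>
    module K X \<and> linear_map K X (tens K C 1 X) \<rho> \<and>
    (\<forall>x\<in>carrier X.
       sw2 K (tens K C 2 X) (\<rho> x)
         (\<lambda>c y. sw2 K (tens K C 2 X) (comult C c) (\<lambda>c1 c2. pt K C X [c1, c2] y)) =
       sw2 K (tens K C 2 X) (\<rho> x)
         (\<lambda>c y. sw2 K (tens K C 2 X) (\<rho> y) (\<lambda>c' z. pt K C X [c, c'] z)))"

definition equivariant_comodule ::
  "'k ring \<Rightarrow> ('k, 'b) coalg \<Rightarrow> ('k, 'c) coalg \<Rightarrow> ('b \<Rightarrow> 'c \<Rightarrow> 'c) \<Rightarrow> ('c \<Rightarrow> 'b \<Rightarrow> 'c)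
    \<Rightarrow> ('b \<Rightarrow> 'b) \<Rightarrow> ('b \<Rightarrow> 'b) \<Rightarrow> ('k, 'b, 'x) left_mod
    \<Rightarrow> ('x \<Rightarrow> ('c list \<times> 'x \<Rightarrow> 'k) set) \<Rightarrow> bool" where
  "equivariant_comodule K B C la ra \<alpha> \<beta> X \<rho> \<longleftrightarrow>
    left_module K B X \<and> left_comodule K C X \<rho> \<and>
    (\<forall>b\<in>carrier B. \<forall>x\<in>carrier X.
       \<rho> (act X b x) =
       sw3 K (tens K C 1 X) (iter_comult K B 2 b) (\<lambda>b1 b2 b3.
         sw2 K (tens K C 1 X) (\<rho> x) (\<lambda>c y.
           pt K C X [ra (la (\<alpha> b1) c) (\<beta> b3)] (act X b2 y))))"

text \<open>
  The objects are all structures whose underlying set is a subset of the type \<open>'x\<close>. Morphisms are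
  made extensional, so that equality of morphisms is equality on the carrier.
\<close>

definition equivariant_comodule_cat ::
  "'k ring \<Rightarrow> ('k, 'b) coalg \<Rightarrow> ('k, 'c) coalg \<Rightarrow> ('b \<Rightarrow> 'c \<Rightarrow> 'c) \<Rightarrow> ('c \<Rightarrow> 'b \<Rightarrow> 'c)
    \<Rightarrow> ('b \<Rightarrow> 'b) \<Rightarrow> ('b \<Rightarrow> 'b)
    \<Rightarrow> (('k, 'b, 'x) left_mod \<times> ('x \<Rightarrow> ('c list \<times> 'x \<Rightarrow> 'k) set), 'x \<Rightarrow> 'x) category_data" where
  "equivariant_comodule_cat K B C la ra \<alpha> \<beta> =
    \<lparr> Obj = {(X, \<rho>). equivariant_comodule K B C la ra \<alpha> \<beta> X \<rho>},
      Hom = (\<lambda>(X, \<rho>) (Y, \<sigma>).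
        {f \<in> extensional (carrier X).
           linear_map K X Y f \<and>
           (\<forall>b\<in>carrier B. \<forall>x\<in>carrier X. f (act X b x) = act Y b (f x)) \<and>
           (\<forall>x\<in>carrier X. \<sigma> (f x) = sw2 K (tens K C 1 Y) (\<rho> x) (\<lambda>c y. pt K C Y [c] (f y)))}),
      Ident = (\<lambda>(X, \<rho>). (\<lambda>x\<in>carrier X. x)),
      Comp = (\<lambda>(X, \<rho>) _ _ g f. compose (carrier X) g f) \<rparr>"


section \<open>Connections\<close>

text \<open>
  A differential graded algebra with homogeneous components \<open>comps n\<close>, products
  \<open>gmult n m : \<Omega>\<^sup>n \<times> \<Omega>\<^sup>m \<rightarrow> \<Omega>\<^sup>n\<^sup>+\<^sup>m\<close>, differentials \<open>gdiff n : \<Omega>\<^sup>n \<rightarrow> \<Omega>\<^sup>n\<^sup>+\<^sup>1\<close>, and an identification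
  \<open>incl\<close> of the algebra \<open>A\<close> with \<open>\<Omega>\<^sup>0\<close>.
\<close>

record ('k, 'a, 'w) dga =
  comps :: "nat \<Rightarrow> ('k, 'w) module"
  gmult :: "nat \<Rightarrow> nat \<Rightarrow> 'w \<Rightarrow> 'w \<Rightarrow> 'w"
  gdiff :: "nat \<Rightarrow> 'w \<Rightarrow> 'w"
  incl :: "'a \<Rightarrow> 'w"

text \<open>\<open>\<Omega>\<^sup>n \<otimes>\<^sub>A M\<close> and its pure tensors\<close>

definition form_tens ::
  "'k ring \<Rightarrow> ('k, 'a, 'y) module_scheme \<Rightarrow> ('k, 'a, 'w) dga \<Rightarrow> nat \<Rightarrow> ('k, 'a, 'x) left_mod
    \<Rightarrow> ('k, ('w \<times> 'x \<Rightarrow> 'k) set) module" where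
  "form_tens K A \<Omega> n M =
    bal_tens K A (comps \<Omega> n) (\<lambda>\<omega> a. gmult \<Omega> n 0 \<omega> (incl \<Omega> a)) M (act M)"

definition form_pt ::
  "'k ring \<Rightarrow> ('k, 'a, 'y) module_scheme \<Rightarrow> ('k, 'a, 'w) dga \<Rightarrow> nat \<Rightarrow> ('k, 'a, 'x) left_mod
    \<Rightarrow> 'w \<Rightarrow> 'x \<Rightarrow> ('w \<times> 'x \<Rightarrow> 'k) set" where
  "form_pt K A \<Omega> n M =
    bal_pt K A (comps \<Omega> n) (\<lambda>\<omega> a. gmult \<Omega> n 0 \<omega> (incl \<Omega> a)) M (act M)"

text \<open>\<open>form_mult K A \<Omega> n m M \<omega> t\<close> is \<open>\<omega> t \<in> \<Omega>\<^sup>n\<^sup>+\<^sup>m \<otimes>\<^sub>A M\<close> for \<open>\<omega> \<in> \<Omega>\<^sup>n\<close> and \<open>t \<in> \<Omega>\<^sup>m \<otimes>\<^sub>A M\<close>.\<close>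

definition form_mult ::
  "'k ring \<Rightarrow> ('k, 'a, 'y) module_scheme \<Rightarrow> ('k, 'a, 'w) dga \<Rightarrow> nat \<Rightarrow> nat
    \<Rightarrow> ('k, 'a, 'x) left_mod \<Rightarrow> 'w \<Rightarrow> ('w \<times> 'x \<Rightarrow> 'k) set \<Rightarrow> ('w \<times> 'x \<Rightarrow> 'k) set" where
  "form_mult K A \<Omega> n m M \<omega> t =
    lin_ext K (form_tens K A \<Omega> (n + m) M)
      (\<lambda>(\<eta>, x). form_pt K A \<Omega> (n + m) M (gmult \<Omega> n m \<omega> \<eta>) x) t"

definition connection ::
  "'k ring \<Rightarrow> ('k, 'a, 'y) module_scheme \<Rightarrow> ('k, 'a, 'w) dga \<Rightarrow> ('k, 'a, 'x) left_mod
    \<Rightarrow> ('x \<Rightarrow> ('w \<times> 'x \<Rightarrow> 'k) set) \<Rightarrow> bool" where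
  "connection K A \<Omega> M D \<longleftrightarrow>
    linear_map K M (form_tens K A \<Omega> 1 M) D \<and>
    (\<forall>a\<in>carrier A. \<forall>x\<in>carrier M.
       D (act M a x) =
       form_mult K A \<Omega> 0 1 M (incl \<Omega> a) (D x) \<oplus>\<^bsub>form_tens K A \<Omega> 1 M\<^esub>
       form_pt K A \<Omega> 1 M (gdiff \<Omega> 0 (incl \<Omega> a)) x)"

text \<open>The extension of a connection \<open>D\<close> to \<open>\<Omega>\<^sup>n \<otimes>\<^sub>A M \<rightarrow> \<Omega>\<^sup>n\<^sup>+\<^sup>1 \<otimes>\<^sub>A M\<close>\<close>

definition conn_ext ::
  "'k ring \<Rightarrow> ('k, 'a, 'y) module_scheme \<Rightarrow> ('k, 'a, 'w) dga \<Rightarrow> ('k, 'a, 'x) left_mod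
    \<Rightarrow> ('x \<Rightarrow> ('w \<times> 'x \<Rightarrow> 'k) set) \<Rightarrow> nat \<Rightarrow> ('w \<times> 'x \<Rightarrow> 'k) set \<Rightarrow> ('w \<times> 'x \<Rightarrow> 'k) set" where
  "conn_ext K A \<Omega> M D n t =
    (let W = form_tens K A \<Omega> (n + 1) M in
      lin_ext K W
        (\<lambda>(\<omega>, x). form_pt K A \<Omega> (n + 1) M (gdiff \<Omega> n \<omega>) x \<oplus>\<^bsub>W\<^esub>
          ((\<ominus>\<^bsub>K\<^esub> \<one>\<^bsub>K\<^esub>) [^]\<^bsub>K\<^esub> n) \<odot>\<^bsub>W\<^esub> form_mult K A \<Omega> n 1 M \<omega> (D x)) t)"

definition flat ::
  "'k ring \<Rightarrow> ('k, 'a, 'y) module_scheme \<Rightarrow> ('k, 'a, 'w) dga \<Rightarrow> ('k, 'a, 'x) left_mod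
    \<Rightarrow> ('x \<Rightarrow> ('w \<times> 'x \<Rightarrow> 'k) set) \<Rightarrow> bool" where
  "flat K A \<Omega> M D \<longleftrightarrow>
    (\<forall>n. \<forall>t\<in>carrier (form_tens K A \<Omega> n M).
       conn_ext K A \<Omega> M D (n + 1) (conn_ext K A \<Omega> M D n t) = \<zero>\<^bsub>form_tens K A \<Omega> (n + 2) M\<^esub>)"

definition flat_connection_cat ::
  "'k ring \<Rightarrow> ('k, 'a, 'y) module_scheme \<Rightarrow> ('k, 'a, 'w) dga
    \<Rightarrow> (('k, 'a, 'x) left_mod \<times> ('x \<Rightarrow> ('w \<times> 'x \<Rightarrow> 'k) set), 'x \<Rightarrow> 'x) category_data" where
  "flat_connection_cat K A \<Omega> =
    \<lparr> Obj = {(M, D). left_module K A M \<and> connection K A \<Omega> M D \<and> flat K A \<Omega> M D},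
      Hom = (\<lambda>(M, D) (M', D').
        {f \<in> extensional (carrier M).
           linear_map K M M' f \<and>
           (\<forall>a\<in>carrier A. \<forall>x\<in>carrier M. f (act M a x) = act M' a (f x)) \<and>
           (\<forall>x\<in>carrier M. D' (f x) =
              lin_ext K (form_tens K A \<Omega> 1 M') (\<lambda>(\<omega>, y). form_pt K A \<Omega> 1 M' \<omega> (f y)) (D x))}),
      Ident = (\<lambda>(M, D). (\<lambda>x\<in>carrier M. x)),
      Comp = (\<lambda>(M, D) _ _ g f. compose (carrier M) g f) \<rparr>"


section \<open>The differential calculus of a bimodule coalgebra\<close>

text \<open>
  In the product, \<open>bs\<close> is the list \<open>[b\<^sub>(\<^sub>1\<^sub>), \<dots>, b\<^sub>(\<^sub>2\<^sub>m\<^sub>+\<^sub>1\<^sub>)]\<close>, indexed from \<open>0\<close>; likewise the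
  summation index of the differential is shifted to start at \<open>0\<close>.
\<close>

definition calculus_mult ::
  "'k ring \<Rightarrow> ('k, 'b) coalg \<Rightarrow> ('k, 'c) coalg \<Rightarrow> ('b \<Rightarrow> 'c \<Rightarrow> 'c) \<Rightarrow> ('c \<Rightarrow> 'b \<Rightarrow> 'c)
    \<Rightarrow> ('b \<Rightarrow> 'b) \<Rightarrow> ('b \<Rightarrow> 'b) \<Rightarrow> nat \<Rightarrow> nat
    \<Rightarrow> ('c list \<times> 'b \<Rightarrow> 'k) set \<Rightarrow> ('c list \<times> 'b \<Rightarrow> 'k) set \<Rightarrow> ('c list \<times> 'b \<Rightarrow> 'k) set" where
  "calculus_mult K B C la ra \<alpha> \<beta> n m s t =
    (let W = tens K C (n + m) B in
      lin_ext K W (\<lambda>(cs, b).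
        lin_ext K W (\<lambda>(cs', b').
          lin_ext K W (\<lambda>(bs', bl).
            let bs = bs' @ [bl] in
            pt K C B
              (cs @ map (\<lambda>j. ra (la (\<alpha> (bs ! j)) (cs' ! j)) (\<beta> (bs ! (2 * m - j)))) [0..<m])
              (bs ! m \<otimes>\<^bsub>B\<^esub> b'))
          (iter_comult K B (2 * m) b)) t) s)"

definition calculus_diff ::
  "'k ring \<Rightarrow> ('k, 'b) coalg \<Rightarrow> ('k, 'c) coalg \<Rightarrow> ('b \<Rightarrow> 'c \<Rightarrow> 'c) \<Rightarrow> ('c \<Rightarrow> 'b \<Rightarrow> 'c)
    \<Rightarrow> ('b \<Rightarrow> 'b) \<Rightarrow> ('b \<Rightarrow> 'b) \<Rightarrow> 'c \<Rightarrow> nat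
    \<Rightarrow> ('c list \<times> 'b \<Rightarrow> 'k) set \<Rightarrow> ('c list \<times> 'b \<Rightarrow> 'k) set" where
  "calculus_diff K B C la ra \<alpha> \<beta> \<II> n t =
    (let W = tens K C (n + 1) B; sgn = (\<lambda>j::nat. (\<ominus>\<^bsub>K\<^esub> \<one>\<^bsub>K\<^esub>) [^]\<^bsub>K\<^esub> j) in
      lin_ext K W (\<lambda>(cs, b).
        \<ominus>\<^bsub>W\<^esub> pt K C B (\<II> # cs) b \<oplus>\<^bsub>W\<^esub>
        (\<Oplus>\<^bsub>W\<^esub>j\<in>{..<n}. sgn j \<odot>\<^bsub>W\<^esub>
           sw2 K W (comult C (cs ! j)) (\<lambda>x y. pt K C B (take j cs @ [x, y] @ drop (j + 1) cs) b)) \<oplus>\<^bsub>W\<^esub>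
        sgn n \<odot>\<^bsub>W\<^esub>
           sw3 K W (iter_comult K B 2 b) (\<lambda>b1 b2 b3.
             pt K C B (cs @ [ra (la (\<alpha> b1) \<II>) (\<beta> b3)]) b2)) t)"

definition calculus ::
  "'k ring \<Rightarrow> ('k, 'b) coalg \<Rightarrow> ('k, 'c) coalg \<Rightarrow> ('b \<Rightarrow> 'c \<Rightarrow> 'c) \<Rightarrow> ('c \<Rightarrow> 'b \<Rightarrow> 'c)
    \<Rightarrow> ('b \<Rightarrow> 'b) \<Rightarrow> ('b \<Rightarrow> 'b) \<Rightarrow> 'c \<Rightarrow> ('k, 'b, ('c list \<times> 'b \<Rightarrow> 'k) set) dga" where
  "calculus K B C la ra \<alpha> \<beta> \<II> =
    \<lparr> comps = (\<lambda>n. tens K C n B),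
      gmult = calculus_mult K B C la ra \<alpha> \<beta>,
      gdiff = calculus_diff K B C la ra \<alpha> \<beta> \<II>,
      incl = pt K C B [] \<rparr>"

end

theory Submission
  imports Defs
begin

text \<open>
  The map \<open>(c\<^sub>1 \<otimes> \<dots> \<otimes> c\<^sub>n \<otimes> b) \<otimes> x \<mapsto> c\<^sub>1 \<otimes> \<dots> \<otimes> c\<^sub>n \<otimes> b x\<close> identifies \<open>\<Omega>\<^sup>n \<otimes>\<^sub>B M\<close> with
  \<open>C \<otimes> \<dots> \<otimes> C \<otimes> M\<close>. Through this identification a coaction \<open>\<rho>\<close> corresponds to the connection
  \<open>\<nabla> x = \<rho> x - \<II> \<otimes> x\<close>: the Leibniz rule for \<open>\<nabla>\<close> is the equivariance of \<open>\<rho>\<close>, and the extension of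
  \<open>\<nabla>\<close> to \<open>\<Omega>\<^sup>* \<otimes>\<^sub>B M\<close> is the cobar differential of \<open>\<rho>\<close> minus left multiplication by \<open>\<II>\<close>. As \<open>\<II>\<close>
  is grouplike, the square of this map is the square of the cobar differential, which vanishes if
  and only if \<open>\<rho>\<close> is coassociative. Morphisms correspond to themselves.
\<close>

text \<open>Since \<open>lin_ext\<close> evaluates on a chosen representative, two principles carry
  the computations. Whatever f is, \<open>lin_ext\<close> commutes with linear maps out of its
  target; and if f agrees on generators with a map already known to be linear,
  \<open>lin_ext\<close> is that map. So a few maps are built from the universal properties, and the
  nested formulas of the calculus are compared with them on generators.

  Only products \<omega> \<eta> with \<eta> of degree 0 or 1 enter connections and their extensions.
  Degree 0 is right multiplication on the factor B; degree 1 is governed by the diagonal action b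
  \<cdot> (c \<otimes> y) = \<alpha>(b1) c \<beta>(b3) \<otimes> b2 y. The same action on C
  \<otimes> M expresses equivariance, and on \<II> \<otimes> 1 it gives the last term of the
  differential. Hence the term d b \<otimes> x of the Leibniz rule becomes b \<cdot> (\<II>
  \<otimes> x) - \<II> \<otimes> b x, which is the failure of x \<mapsto> \<II> \<otimes> x to be
  equivariant.

  Structure maps are total functions, and the passage to connections and back recovers them on the
  carrier only. The units of the equivalence are identity functions between objects that may differ
  in this way.\<close>

section \<open>Linear maps between modules\<close>

lemma linear_mapI:
  assumes "\<And>x. x \<in> carrier V \<Longrightarrow> f x \<in> carrier W"
    and "\<And>x y. \<lbrakk>x \<in> carrier V; y \<in> carrier V\<rbrakk> \<Longrightarrow> f (x \<oplus>\<^bsub>V\<^esub> y) = f x \<oplus>\<^bsub>W\<^esub> f y"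
    and "\<And>a x. \<lbrakk>a \<in> carrier K; x \<in> carrier V\<rbrakk> \<Longrightarrow> f (a \<odot>\<^bsub>V\<^esub> x) = a \<odot>\<^bsub>W\<^esub> f x"
  shows "linear_map K V W f"
  using assms by (auto simp: linear_map_def)

lemma linear_map_closed: "linear_map K V W f \<Longrightarrow> x \<in> carrier V \<Longrightarrow> f x \<in> carrier W"
  and linear_map_add: "linear_map K V W f \<Longrightarrow> x \<in> carrier V \<Longrightarrow> y \<in> carrier V \<Longrightarrow>
    f (x \<oplus>\<^bsub>V\<^esub> y) = f x \<oplus>\<^bsub>W\<^esub> f y"
  and linear_map_smult: "linear_map K V W f \<Longrightarrow> a \<in> carrier K \<Longrightarrow> x \<in> carrier V \<Longrightarrow>
    f (a \<odot>\<^bsub>V\<^esub> x) = a \<odot>\<^bsub>W\<^esub> f x"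
  by (auto simp: linear_map_def)

lemma linear_map_comp:
  "linear_map K U V g \<Longrightarrow> linear_map K V W f \<Longrightarrow> linear_map K U W (\<lambda>x. f (g x))"
  by (auto simp: linear_map_def Pi_def)

lemma linear_map_id: "linear_map K V V (\<lambda>x. x)"
  by (auto simp: linear_map_def)

text \<open>The equations of \<open>linear_map\<close> also evaluate the map at sums and scalar
  multiples; V being a module keeps these in the carrier, where f and g agree.\<close>

lemma linear_map_cong:
  assumes "module K V" "\<And>x. x \<in> carrier V \<Longrightarrow> f x = g x"
  shows "linear_map K V W f \<longleftrightarrow> linear_map K V W g"
proof -
  interpret V: module K V by fact
  show ?thesis using assms(2) by (auto simp: linear_map_def Pi_def)
qed

lemma linear_map_zero:
  assumes "module K V" "module K W" "linear_map K V W f"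
  shows "f \<zero>\<^bsub>V\<^esub> = \<zero>\<^bsub>W\<^esub>"
proof -
  interpret V: module K V by fact
  interpret W: module K W by fact
  have "f (\<zero>\<^bsub>K\<^esub> \<odot>\<^bsub>V\<^esub> \<zero>\<^bsub>V\<^esub>) = \<zero>\<^bsub>K\<^esub> \<odot>\<^bsub>W\<^esub> f \<zero>\<^bsub>V\<^esub>"
    by (rule linear_map_smult[OF assms(3)]) auto
  then show ?thesis using linear_map_closed[OF assms(3), of "\<zero>\<^bsub>V\<^esub>"] by simp
qed

text \<open>Makes negation an instance of scalar multiplication, so that homogeneity settles how
  linear maps treat signs.\<close>

lemma (in module) neg_conv: "x \<in> carrier M \<Longrightarrow> \<ominus>\<^bsub>M\<^esub> x = (\<ominus> \<one>) \<odot>\<^bsub>M\<^esub> x"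
  by (simp add: smult_l_minus)

lemma linear_map_neg:
  assumes "module K V" "module K W" "linear_map K V W f" "x \<in> carrier V"
  shows "f (\<ominus>\<^bsub>V\<^esub> x) = \<ominus>\<^bsub>W\<^esub> f x"
proof -
  interpret V: module K V by fact
  interpret W: module K W by fact
  show ?thesis using assms linear_map_closed[OF assms(3,4)]
    by (simp add: V.neg_conv W.neg_conv linear_map_smult[OF assms(3)])
qed

lemma linear_map_diff:
  assumes "module K V" "module K W" "linear_map K V W f" "x \<in> carrier V" "y \<in> carrier V"
  shows "f (x \<ominus>\<^bsub>V\<^esub> y) = f x \<ominus>\<^bsub>W\<^esub> f y"
proof -
  interpret V: module K V by fact
  interpret W: module K W by fact
  show ?thesis using assms
    by (simp add: a_minus_def linear_map_add[OF assms(3)] linear_map_neg[OF assms(1,2,3)])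
qed

lemma linear_map_finsum:
  assumes "module K V" "module K W" "linear_map K V W f" "finite S" "g \<in> S \<rightarrow> carrier V"
  shows "f (\<Oplus>\<^bsub>V\<^esub>i\<in>S. g i) = (\<Oplus>\<^bsub>W\<^esub>i\<in>S. f (g i))"
proof -
  interpret V: module K V by fact
  interpret W: module K W by fact
  from assms(4,5) show ?thesis
  proof (induction S)
    case empty
    then show ?case by (simp add: linear_map_zero[OF assms(1-3)])
  next
    case (insert x F)
    then have "g \<in> F \<rightarrow> carrier V" "g x \<in> carrier V" by auto
    moreover from this have "(\<lambda>i. f (g i)) \<in> F \<rightarrow> carrier W" "f (g x) \<in> carrier W"
      using linear_map_closed[OF assms(3)] by auto
    ultimately show ?case using insert
      by (simp add: linear_map_add[OF assms(3)])
  qed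
qed

lemma linear_map_plus:
  assumes "module K W" "linear_map K V W f" "linear_map K V W g"
  shows "linear_map K V W (\<lambda>x. f x \<oplus>\<^bsub>W\<^esub> g x)"
proof -
  interpret W: module K W by fact
  note c = linear_map_closed[OF assms(2)] linear_map_closed[OF assms(3)]
  show ?thesis
    by (rule linear_mapI)
      (simp_all add: c linear_map_add[OF assms(2)] linear_map_add[OF assms(3)] W.M.a_ac
        linear_map_smult[OF assms(2)] linear_map_smult[OF assms(3)] W.smult_r_distr)
qed

lemma linear_map_scale:
  assumes "module K W" "linear_map K V W f" "a \<in> carrier K"
  shows "linear_map K V W (\<lambda>x. a \<odot>\<^bsub>W\<^esub> f x)"
proof -
  interpret W: module K W by fact
  note c = linear_map_closed[OF assms(2)]
  show ?thesis
    by (rule linear_mapI)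
      (simp_all add: assms(3) c linear_map_add[OF assms(2)]
        linear_map_smult[OF assms(2)] W.smult_r_distr W.smult_assoc1[symmetric] W.R.m_comm)
qed

lemma linear_map_const_zero:
  assumes "module K W" shows "linear_map K V W (\<lambda>x. \<zero>\<^bsub>W\<^esub>)"
proof -
  interpret W: module K W by fact
  show ?thesis by (rule linear_mapI) simp_all
qed

lemma linear_map_uminus:
  assumes "module K V" "module K W" "linear_map K V W f"
  shows "linear_map K V W (\<lambda>x. \<ominus>\<^bsub>W\<^esub> f x)"
proof -
  interpret W: module K W by fact
  have "linear_map K V W (\<lambda>x. (\<ominus>\<^bsub>K\<^esub> \<one>\<^bsub>K\<^esub>) \<odot>\<^bsub>W\<^esub> f x)"
    by (rule linear_map_scale[OF assms(2,3)]) simp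
  then show ?thesis
    by (subst linear_map_cong[OF assms(1)])
      (simp_all add: W.neg_conv linear_map_closed[OF assms(3)])
qed

lemma linear_map_minus:
  assumes "module K V" "module K W" "linear_map K V W f" "linear_map K V W g"
  shows "linear_map K V W (\<lambda>x. f x \<ominus>\<^bsub>W\<^esub> g x)"
  unfolding a_minus_def by (intro linear_map_plus linear_map_uminus assms)

lemma linear_map_sum:
  assumes "module K W" "module K V" "finite S" "\<And>i. i \<in> S \<Longrightarrow> linear_map K V W (f i)"
  shows "linear_map K V W (\<lambda>x. \<Oplus>\<^bsub>W\<^esub>i\<in>S. f i x)"
proof -
  interpret W: module K W by fact
  have 1: "linear_map K V W (f i)" if "i \<in> S" for i using assms(4) that .
  show ?thesis
    using assms(3) 1
  proof (induction S)
    case empty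
    then show ?case by (simp add: linear_map_const_zero[OF assms(1)])
  next
    case (insert i F)
    have "linear_map K V W (\<lambda>x. f i x \<oplus>\<^bsub>W\<^esub> (\<Oplus>\<^bsub>W\<^esub>j\<in>F. f j x))"
      by (intro linear_map_plus assms(1) insert.IH insert.prems) auto
    moreover have "(\<Oplus>\<^bsub>W\<^esub>j\<in>insert i F. f j x) = f i x \<oplus>\<^bsub>W\<^esub> (\<Oplus>\<^bsub>W\<^esub>j\<in>F. f j x)"
      if "x \<in> carrier V" for x
      using insert.hyps that linear_map_closed[OF insert.prems]
      by (intro W.M.finsum_insert) auto
    ultimately show ?case by (subst linear_map_cong[OF assms(2)]) simp_all
  qed
qed

lemma abelian_group_minus_eq_zero_iff:
  assumes "abelian_group W" "x \<in> carrier W" "y \<in> carrier W"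
  shows "x \<ominus>\<^bsub>W\<^esub> y = \<zero>\<^bsub>W\<^esub> \<longleftrightarrow> x = y"
proof -
  interpret abelian_group W by fact
  show ?thesis using assms(2,3) by (metis a_minus_def minus_equality minus_minus a_inv_closed r_neg)
qed

section \<open>Modules given by generators and relations\<close>

text \<open>Pointwise form of the operations. Proofs that argue by the module axioms remove these
  rules from the simplifier, since the axioms speak of the operations of the record.\<close>

lemma free_module_simps [simp]:
  "p \<oplus>\<^bsub>free_module K G\<^esub> q = (\<lambda>g. p g \<oplus>\<^bsub>K\<^esub> q g)"
  "\<zero>\<^bsub>free_module K G\<^esub> = (\<lambda>g. \<zero>\<^bsub>K\<^esub>)"
  "a \<odot>\<^bsub>free_module K G\<^esub> p = (\<lambda>g. a \<otimes>\<^bsub>K\<^esub> p g)"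
  by (simp_all add: free_module_def)

lemma free_module_carrier:
  "p \<in> carrier (free_module K G) \<longleftrightarrow>
    (\<forall>g. p g \<in> carrier K) \<and> (\<forall>g. g \<notin> G \<longrightarrow> p g = \<zero>\<^bsub>K\<^esub>) \<and> finite {g. p g \<noteq> \<zero>\<^bsub>K\<^esub>}"
  by (simp add: free_module_def)

lemma module_free_module:
  assumes "cring K" shows "module K (free_module K G)"
proof -
  interpret K: cring K by fact
  have fin: "finite {g. p g \<oplus>\<^bsub>K\<^esub> q g \<noteq> \<zero>\<^bsub>K\<^esub>}"
    if "finite {g. p g \<noteq> \<zero>\<^bsub>K\<^esub>}" "finite {g. q g \<noteq> \<zero>\<^bsub>K\<^esub>}" for p q
  proof -
    have "{g. p g \<oplus>\<^bsub>K\<^esub> q g \<noteq> \<zero>\<^bsub>K\<^esub>} \<subseteq> {g. p g \<noteq> \<zero>\<^bsub>K\<^esub>} \<union> {g. q g \<noteq> \<zero>\<^bsub>K\<^esub>}" by auto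
    with that show ?thesis by (meson finite_UnI finite_subset)
  qed
  have fin2: "finite {g. a \<otimes>\<^bsub>K\<^esub> p g \<noteq> \<zero>\<^bsub>K\<^esub>}"
    if "finite {g. p g \<noteq> \<zero>\<^bsub>K\<^esub>}" "a \<in> carrier K" for p a
  proof -
    have "{g. a \<otimes>\<^bsub>K\<^esub> p g \<noteq> \<zero>\<^bsub>K\<^esub>} \<subseteq> {g. p g \<noteq> \<zero>\<^bsub>K\<^esub>}" using that by auto
    with that show ?thesis by (meson finite_subset)
  qed
  show ?thesis
  proof (rule moduleI[OF assms abelian_groupI])
    fix p assume p: "p \<in> carrier (free_module K G)"
    show "\<exists>q\<in>carrier (free_module K G). q \<oplus>\<^bsub>free_module K G\<^esub> p = \<zero>\<^bsub>free_module K G\<^esub>"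
    proof (rule bexI[of _ "\<lambda>g. \<ominus>\<^bsub>K\<^esub> p g"])
      have "{g. \<ominus>\<^bsub>K\<^esub> p g \<noteq> \<zero>\<^bsub>K\<^esub>} \<subseteq> {g. p g \<noteq> \<zero>\<^bsub>K\<^esub>}" by auto
      then show "(\<lambda>g. \<ominus>\<^bsub>K\<^esub> p g) \<in> carrier (free_module K G)"
        using p finite_subset by (auto simp: free_module_carrier)
    qed (use p in \<open>auto simp: free_module_carrier K.l_neg\<close>)
  qed (auto simp: free_module_carrier fin fin2 K.a_ac K.m_assoc K.l_distr K.r_distr)
qed

lemma free_gen_carrier:
  assumes "cring K" "g \<in> G"
  shows "free_gen K g \<in> carrier (free_module K G)"
proof -
  interpret K: cring K by fact
  have "{h. free_gen K g h \<noteq> \<zero>\<^bsub>K\<^esub>} \<subseteq> {g}" by (auto simp: free_gen_def)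
  then show ?thesis using assms(2) finite_subset
    by (fastforce simp: free_module_carrier free_gen_def)
qed

text \<open>The sum inside \<open>lin_ext\<close>, separated from the choice of a representative:
  linearity in the coefficients can then be proved before independence of the
  representative.\<close>

definition lin_comb ::
  "('k, 'z) ring_scheme \<Rightarrow> ('k, 'w, 'y) module_scheme \<Rightarrow> ('g \<Rightarrow> 'w) \<Rightarrow> ('g \<Rightarrow> 'k) \<Rightarrow> 'w" where
  "lin_comb K W f p = (\<Oplus>\<^bsub>W\<^esub>g \<in> {g. p g \<noteq> \<zero>\<^bsub>K\<^esub>}. p g \<odot>\<^bsub>W\<^esub> f g)"

lemma lin_ext_eq: "lin_ext K W f t = lin_comb K W f (SOME p. p \<in> t)"
  by (simp add: lin_ext_def lin_comb_def Let_def)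

text \<open>The sum in \<open>lin_comb\<close> runs over the support of its argument, which changes
  under addition and scaling. A common finite index set makes such sums comparable.\<close>

lemma lin_comb_superset:
  assumes "module K W" "p \<in> carrier (free_module K G)" "f \<in> G \<rightarrow> carrier W"
    "finite S" "S \<subseteq> G" "{g. p g \<noteq> \<zero>\<^bsub>K\<^esub>} \<subseteq> S"
  shows "lin_comb K W f p = (\<Oplus>\<^bsub>W\<^esub>g \<in> S. p g \<odot>\<^bsub>W\<^esub> f g)"
proof -
  interpret W: module K W by fact
  have "f g \<in> carrier W" if "g \<in> S" for g using assms(3,5) that by auto
  moreover have "p g \<in> carrier K" for g using assms(2) by (auto simp: free_module_carrier)
  ultimately show ?thesis
    unfolding lin_comb_def
    by (intro W.M.add.finprod_mono_neutral_cong_left) (use assms(4,6) in auto)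
qed

lemma lin_comb_closed:
  assumes "module K W" "p \<in> carrier (free_module K G)" "f \<in> G \<rightarrow> carrier W"
  shows "lin_comb K W f p \<in> carrier W"
proof -
  interpret W: module K W by fact
  show ?thesis
    unfolding lin_comb_def using assms
    by (intro W.M.finsum_closed) (auto simp: free_module_carrier)
qed

lemma lin_comb_linear:
  assumes "module K W" "f \<in> G \<rightarrow> carrier W"
  shows "linear_map K (free_module K G) W (lin_comb K W f)"
proof (rule linear_mapI)
  let ?F = "free_module K G"
  interpret W: module K W by fact
  fix p assume p: "p \<in> carrier (?F)"
  show "lin_comb K W f p \<in> carrier W" by (rule lin_comb_closed[OF assms(1) p assms(2)])
  { fix q assume q: "q \<in> carrier (?F)"
    interpret F: module K ?F by (rule module_free_module) (rule W.R.is_cring)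
    define S where "S = {g. p g \<noteq> \<zero>\<^bsub>K\<^esub>} \<union> {g. q g \<noteq> \<zero>\<^bsub>K\<^esub>}"
    have S: "finite S" "S \<subseteq> G" using p q by (auto simp: S_def free_module_carrier)
    have pq: "p \<oplus>\<^bsub>?F\<^esub> q \<in> carrier (?F)" using p q by (rule F.M.a_closed)
    have fS: "f g \<in> carrier W" if "g \<in> S" for g using assms(2) S that by auto
    have "lin_comb K W f (p \<oplus>\<^bsub>?F\<^esub> q) = (\<Oplus>\<^bsub>W\<^esub>g \<in> S. (p g \<oplus>\<^bsub>K\<^esub> q g) \<odot>\<^bsub>W\<^esub> f g)"
      by (subst lin_comb_superset[OF assms(1) pq assms(2) S]) (auto simp: S_def)
    also have "\<dots> = (\<Oplus>\<^bsub>W\<^esub>g \<in> S. p g \<odot>\<^bsub>W\<^esub> f g \<oplus>\<^bsub>W\<^esub> q g \<odot>\<^bsub>W\<^esub> f g)"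
      by (rule W.M.finsum_cong')
        (use p q fS in \<open>auto simp: free_module_carrier W.smult_l_distr\<close>)
    also have "\<dots> = (\<Oplus>\<^bsub>W\<^esub>g \<in> S. p g \<odot>\<^bsub>W\<^esub> f g) \<oplus>\<^bsub>W\<^esub> (\<Oplus>\<^bsub>W\<^esub>g \<in> S. q g \<odot>\<^bsub>W\<^esub> f g)"
      by (rule W.M.finsum_addf) (use p q fS in \<open>auto simp: free_module_carrier\<close>)
    also have "\<dots> = lin_comb K W f p \<oplus>\<^bsub>W\<^esub> lin_comb K W f q"
      using lin_comb_superset[OF assms(1) p assms(2) S] lin_comb_superset[OF assms(1) q assms(2) S]
      by (auto simp: S_def)
    finally show "lin_comb K W f (p \<oplus>\<^bsub>?F\<^esub> q) = \<dots>" . }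
  { fix a assume a: "a \<in> carrier K"
    interpret F: module K ?F by (rule module_free_module) (rule W.R.is_cring)
    define S where "S = {g. p g \<noteq> \<zero>\<^bsub>K\<^esub>}"
    have S: "finite S" "S \<subseteq> G" using p by (auto simp: S_def free_module_carrier)
    have ap: "a \<odot>\<^bsub>?F\<^esub> p \<in> carrier (?F)" using a p by (rule F.smult_closed)
    have fS: "f g \<in> carrier W" if "g \<in> S" for g using assms(2) S that by auto
    have "lin_comb K W f (a \<odot>\<^bsub>?F\<^esub> p) = (\<Oplus>\<^bsub>W\<^esub>g \<in> S. (a \<otimes>\<^bsub>K\<^esub> p g) \<odot>\<^bsub>W\<^esub> f g)"
      using a by (subst lin_comb_superset[OF assms(1) ap assms(2) S]) (auto simp: S_def)
    also have "\<dots> = (\<Oplus>\<^bsub>W\<^esub>g \<in> S. a \<odot>\<^bsub>W\<^esub> (p g \<odot>\<^bsub>W\<^esub> f g))"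
      by (rule W.M.finsum_cong')
        (use a p fS in \<open>auto simp: free_module_carrier W.smult_assoc1\<close>)
    also have "\<dots> = a \<odot>\<^bsub>W\<^esub> lin_comb K W f p"
      unfolding lin_comb_def S_def[symmetric]
      by (rule W.finsum_smult_ldistr[symmetric]) (use a p S fS in \<open>auto simp: free_module_carrier\<close>)
    finally show "lin_comb K W f (a \<odot>\<^bsub>?F\<^esub> p) = \<dots>" . }
qed

lemma lin_comb_gen:
  assumes "module K W" "f \<in> G \<rightarrow> carrier W" "g \<in> G"
  shows "lin_comb K W f (free_gen K g) = f g"
proof -
  interpret W: module K W by fact
  have "lin_comb K W f (free_gen K g) = (\<Oplus>\<^bsub>W\<^esub>h \<in> {g}. free_gen K g h \<odot>\<^bsub>W\<^esub> f h)"
    by (rule lin_comb_superset[OF assms(1) free_gen_carrier assms(2)])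
      (use assms in \<open>auto simp: free_gen_def W.R.is_cring\<close>)
  also have "\<dots> = f g" using assms by (auto simp: free_gen_def Pi_def)
  finally show ?thesis .
qed

lemma linear_map_lin_comb:
  assumes "module K V" "module K W" "linear_map K V W h"
    "p \<in> carrier (free_module K G)" "f \<in> G \<rightarrow> carrier V"
  shows "h (lin_comb K V f p) = lin_comb K W (\<lambda>g. h (f g)) p"
proof -
  interpret V: module K V by fact
  interpret W: module K W by fact
  have *: "{g. p g \<noteq> \<zero>\<^bsub>K\<^esub>} \<subseteq> G" "finite {g. p g \<noteq> \<zero>\<^bsub>K\<^esub>}" "\<And>g. p g \<in> carrier K"
    using assms by (auto simp: free_module_carrier)
  have f: "f g \<in> carrier V" if "p g \<noteq> \<zero>\<^bsub>K\<^esub>" for g using assms that * by auto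
  show ?thesis
    unfolding lin_comb_def
    by (subst linear_map_finsum[OF assms(1-3)])
      (auto intro!: W.M.finsum_cong' simp: * f linear_map_smult[OF assms(3)] linear_map_closed[OF
          assms(3)])
qed

lemma lin_comb_free_gen:
  assumes "cring K" "p \<in> carrier (free_module K G)"
  shows "lin_comb K (free_module K G) (free_gen K) p = p"
proof
  let ?F = "free_module K G"
  fix h
  interpret K: cring K by fact
  interpret F: module K ?F by (rule module_free_module) fact
  have p: "\<And>g. p g \<in> carrier K" "{g. p g \<noteq> \<zero>\<^bsub>K\<^esub>} \<subseteq> G" "finite {g. p g \<noteq> \<zero>\<^bsub>K\<^esub>}"
    using assms by (auto simp: free_module_carrier)
  \<comment> \<open>The sum lives in a module of functions; its value at h is computed by induction
    as a sum in K.\<close>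
  have ev: "(\<Oplus>\<^bsub>?F\<^esub>g\<in>S. p g \<odot>\<^bsub>?F\<^esub> free_gen K g) h =
      (\<Oplus>\<^bsub>K\<^esub>g\<in>S. p g \<otimes>\<^bsub>K\<^esub> free_gen K g h)" if "finite S" "S \<subseteq> G" for S
    using that
  proof (induction S)
    case (insert x S)
    have fg: "free_gen K g \<in> carrier ?F" if "g \<in> insert x S" for g
      using insert(4) that by (intro free_gen_carrier[OF assms(1)]) auto
    have e: "(\<Oplus>\<^bsub>?F\<^esub>g\<in>insert x S. p g \<odot>\<^bsub>?F\<^esub> free_gen K g) =
      p x \<odot>\<^bsub>?F\<^esub> free_gen K x \<oplus>\<^bsub>?F\<^esub>
      (\<Oplus>\<^bsub>?F\<^esub>g\<in>S. p g \<odot>\<^bsub>?F\<^esub> free_gen K g)"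
      using insert(1,2) p(1) fg
      by (intro F.M.finsum_insert) (auto intro!: F.smult_closed simp del: free_module_simps)
    have "(\<Oplus>\<^bsub>?F\<^esub>g\<in>insert x S. p g \<odot>\<^bsub>?F\<^esub> free_gen K g) h = p x \<otimes>\<^bsub>K\<^esub> free_gen K x h
        \<oplus>\<^bsub>K\<^esub> (\<Oplus>\<^bsub>K\<^esub>g\<in>S. p g \<otimes>\<^bsub>K\<^esub> free_gen K g h)"
      using insert by (subst e) simp
    also have "\<dots> = (\<Oplus>\<^bsub>K\<^esub>g\<in>insert x S. p g \<otimes>\<^bsub>K\<^esub> free_gen K g h)"
      using insert p by (intro K.finsum_insert[symmetric]) (auto simp: free_gen_def)
    finally show ?case .
  qed simp
  have "lin_comb K ?F (free_gen K) p h =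
      (\<Oplus>\<^bsub>K\<^esub>g\<in>{g. p g \<noteq> \<zero>\<^bsub>K\<^esub>}. p g \<otimes>\<^bsub>K\<^esub> free_gen K g h)"
    unfolding lin_comb_def by (rule ev) (use p in auto)
  also have "\<dots> = (\<Oplus>\<^bsub>K\<^esub>g\<in>{g. p g \<noteq> \<zero>\<^bsub>K\<^esub>}. if h = g then p g else \<zero>\<^bsub>K\<^esub>)"
    by (rule K.finsum_cong') (auto simp: free_gen_def p)
  also have "\<dots> = p h"
  proof (cases "p h = \<zero>\<^bsub>K\<^esub>")
    case True
    then have "(\<Oplus>\<^bsub>K\<^esub>g\<in>{g. p g \<noteq> \<zero>\<^bsub>K\<^esub>}. if h = g then p g else \<zero>\<^bsub>K\<^esub>) = (\<Oplus>\<^bsub>K\<^esub>g\<in>{g. p g \<noteq> \<zero>\<^bsub>K\<^esub>}. \<zero>\<^bsub>K\<^esub>)"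
      by (intro K.finsum_cong') auto
    then show ?thesis using True by simp
  next
    case False
    then show ?thesis using p by (intro K.finsum_singleton) auto
  qed
  finally show "lin_comb K ?F (free_gen K) p h = p h" .
qed

text \<open>Common ground of the tensor products over K and over B, so that well-definedness is
  argued once for both.\<close>

locale presentation = cring K for K :: "('k, 'z) ring_scheme" and G :: "'g set" and R ::
    "('g \<Rightarrow> 'k) set" +
  assumes rels: "R \<subseteq> carrier (free_module K G)"
begin

abbreviation "F \<equiv> free_module K G"
abbreviation "N \<equiv> rel_span K G R"
abbreviation "P \<equiv> presented_module K G R"
abbreviation "cls \<equiv> rel_class K G R"

sublocale F: module K F by (rule module_free_module) (rule is_cring)

lemma rel_span_submodule: "submodule N K F"
proof (rule F.submoduleI)
  have *: "N \<subseteq> H" if "submodule H K F" "R \<subseteq> H" for H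
    using that by (auto simp: rel_span_def)
  show "N \<subseteq> carrier F" by (rule *[OF F.carrier_is_submodule rels])
  show "\<zero>\<^bsub>F\<^esub> \<in> N" unfolding rel_span_def
    by (auto dest!: submodule.axioms(1) subgroup.one_closed simp del: free_module_simps)
qed (auto simp: rel_span_def F.submoduleE simp del: free_module_simps)

lemma rel_span_least: "submodule H K F \<Longrightarrow> R \<subseteq> H \<Longrightarrow> N \<subseteq> H"
  by (auto simp: rel_span_def)

lemma rels_subset: "R \<subseteq> N" by (auto simp: rel_span_def)

sublocale N: abelian_subgroup N F
  by (rule abelian_subgroupI3)
    (auto intro: additive_subgroupI submodule.axioms(1)[OF rel_span_submodule]
        F.M.abelian_group_axioms)

lemma carrier_P: "carrier P = cls ` carrier F"
  by (auto simp: presented_module_def A_RCOSETS_def' rel_class_def)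

lemma cls_closed: "p \<in> carrier F \<Longrightarrow> cls p \<in> carrier P"
  by (simp add: carrier_P)

lemma carrier_PE:
  assumes "t \<in> carrier P" obtains p where "p \<in> carrier F" "t = cls p"
  using assms by (auto simp: carrier_P)

lemma cls_self: "p \<in> carrier F \<Longrightarrow> p \<in> cls p"
  unfolding rel_class_def by (rule N.a_rcos_self)

lemma cls_subset: "p \<in> carrier F \<Longrightarrow> cls p \<subseteq> carrier F"
  unfolding rel_class_def by (rule F.M.a_r_coset_subset_G) (auto simp: N.a_subset)

lemma cls_eqI: "q \<in> cls p \<Longrightarrow> p \<in> carrier F \<Longrightarrow> cls q = cls p"
  unfolding rel_class_def using N.a_repr_independence'[of q p] by simp

lemma cls_eq_iff:
  assumes "p \<in> carrier F" "q \<in> carrier F"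
  shows "cls p = cls q \<longleftrightarrow> p \<ominus>\<^bsub>F\<^esub> q \<in> N"
proof -
  have "p \<ominus>\<^bsub>F\<^esub> q \<in> N \<longleftrightarrow> p \<in> cls q"
    using N.a_rcos_module[of q p] assms by (simp add: rel_class_def a_minus_def)
  then show ?thesis using cls_eqI[of p q] cls_self[of p] assms by auto
qed

lemma cls_add:
  assumes "p \<in> carrier F" "q \<in> carrier F"
  shows "cls p \<oplus>\<^bsub>P\<^esub> cls q = cls (p \<oplus>\<^bsub>F\<^esub> q)"
  using N.a_rcos_sum[OF assms] by (simp add: rel_class_def presented_module_def)

text \<open>Scalar multiplication of cosets is a union over all representatives. The span is closed
  under scalars, so the cosets united are all equal.\<close>

lemma cls_smult:
  assumes "a \<in> carrier K" "p \<in> carrier F"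
  shows "a \<odot>\<^bsub>P\<^esub> cls p = cls (a \<odot>\<^bsub>F\<^esub> p)"
proof -
  have "cls (a \<odot>\<^bsub>F\<^esub> q) = cls (a \<odot>\<^bsub>F\<^esub> p)" if "q \<in> cls p" for q
  proof -
    have q: "q \<in> carrier F" using that cls_subset[OF assms(2)] by auto
    have "q \<ominus>\<^bsub>F\<^esub> p \<in> N" by (rule iffD1[OF cls_eq_iff[OF q assms(2)] cls_eqI[OF that assms(2)]])
    then have *: "a \<odot>\<^bsub>F\<^esub> (q \<ominus>\<^bsub>F\<^esub> p) \<in> N"
      by (rule F.submoduleE(4)[OF rel_span_submodule assms(1)])
    have "a \<odot>\<^bsub>F\<^esub> (q \<oplus>\<^bsub>F\<^esub> \<ominus>\<^bsub>F\<^esub> p) = a \<odot>\<^bsub>F\<^esub> q \<oplus>\<^bsub>F\<^esub> \<ominus>\<^bsub>F\<^esub> (a \<odot>\<^bsub>F\<^esub> p)"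
      unfolding F.smult_r_distr[OF assms(1) q F.M.a_inv_closed[OF assms(2)]]
        F.smult_r_minus[OF assms] ..
    then have "a \<odot>\<^bsub>F\<^esub> q \<ominus>\<^bsub>F\<^esub> a \<odot>\<^bsub>F\<^esub> p \<in> N"
      using * unfolding a_minus_def by argo
    then show ?thesis
      by (rule iffD2[OF cls_eq_iff[OF F.smult_closed[OF assms(1) q] F.smult_closed[OF assms]]])
  qed
  then have "(\<Union>q\<in>cls p. cls (a \<odot>\<^bsub>F\<^esub> q)) = cls (a \<odot>\<^bsub>F\<^esub> p)" using cls_self[OF assms(2)] by blast
  then show ?thesis by (simp add: presented_module_def)
qed

lemma zero_P: "\<zero>\<^bsub>P\<^esub> = cls \<zero>\<^bsub>F\<^esub>"
  using F.M.a_coset_add_zero[OF N.a_subset] by (simp only: rel_class_def)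
      (simp add: presented_module_def)

lemma module_P: "module K P"
proof (rule moduleI[OF is_cring abelian_groupI])
  fix s t u assume "s \<in> carrier P" "t \<in> carrier P" "u \<in> carrier P"
  then obtain p q r where *: "p \<in> carrier F" "q \<in> carrier F" "r \<in> carrier F"
    "s = cls p" "t = cls q" "u = cls r" by (metis carrier_PE)
  show "s \<oplus>\<^bsub>P\<^esub> t \<oplus>\<^bsub>P\<^esub> u = s \<oplus>\<^bsub>P\<^esub> (t \<oplus>\<^bsub>P\<^esub> u)"
    using * by (simp only: cls_add F.M.a_closed F.M.a_assoc)
next
  fix s t assume "s \<in> carrier P" "t \<in> carrier P"
  then obtain p q where *: "p \<in> carrier F" "q \<in> carrier F" "s = cls p" "t = cls q"
    by (metis carrier_PE)
  show "s \<oplus>\<^bsub>P\<^esub> t \<in> carrier P" using * by (simp only: cls_add cls_closed F.M.a_closed)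
  show "s \<oplus>\<^bsub>P\<^esub> t = t \<oplus>\<^bsub>P\<^esub> s" using * by (simp only: cls_add F.M.a_comm)
  fix a assume a: "a \<in> carrier K"
  show "a \<odot>\<^bsub>P\<^esub> (s \<oplus>\<^bsub>P\<^esub> t) = a \<odot>\<^bsub>P\<^esub> s \<oplus>\<^bsub>P\<^esub> a \<odot>\<^bsub>P\<^esub> t"
    using * a by (simp only: cls_add cls_smult F.M.a_closed F.smult_closed F.smult_r_distr)
next
  fix s assume "s \<in> carrier P"
  then obtain p where *: "p \<in> carrier F" "s = cls p" by (metis carrier_PE)
  show "\<zero>\<^bsub>P\<^esub> \<oplus>\<^bsub>P\<^esub> s = s" using * by (simp only: zero_P cls_add F.M.zero_closed F.M.l_zero)
  show "\<exists>t\<in>carrier P. t \<oplus>\<^bsub>P\<^esub> s = \<zero>\<^bsub>P\<^esub>"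
    by (rule bexI[of _ "cls (\<ominus>\<^bsub>F\<^esub> p)"])
      (use * in \<open>simp_all only: zero_P cls_add cls_closed F.M.a_inv_closed F.M.l_neg\<close>)
  show "\<one>\<^bsub>K\<^esub> \<odot>\<^bsub>P\<^esub> s = s" using * by (simp only: cls_smult one_closed F.smult_one)
  fix a assume a: "a \<in> carrier K"
  show "a \<odot>\<^bsub>P\<^esub> s \<in> carrier P" using * a by (simp only: cls_smult cls_closed F.smult_closed)
  fix b assume b: "b \<in> carrier K"
  show "(a \<oplus>\<^bsub>K\<^esub> b) \<odot>\<^bsub>P\<^esub> s = a \<odot>\<^bsub>P\<^esub> s \<oplus>\<^bsub>P\<^esub> b \<odot>\<^bsub>P\<^esub> s"
    using * a b by (simp only: cls_smult cls_add a_closed F.smult_closed F.smult_l_distr)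
  show "(a \<otimes>\<^bsub>K\<^esub> b) \<odot>\<^bsub>P\<^esub> s = a \<odot>\<^bsub>P\<^esub> (b \<odot>\<^bsub>P\<^esub> s)"
    using * a b by (simp only: cls_smult m_closed F.smult_closed F.smult_assoc1)
qed (simp only: zero_P cls_closed F.M.zero_closed)

lemma cls_linear: "linear_map K F P cls"
  by (rule linear_mapI) (simp_all only: cls_closed cls_add cls_smult)

text \<open>Justifies the \<open>SOME\<close> in \<open>lin_ext\<close>: what is chosen is a
  finitely supported function from the class itself.\<close>

lemma representative:
  assumes "t \<in> carrier P"
  shows "(SOME p. p \<in> t) \<in> carrier F" "cls (SOME p. p \<in> t) = t"
proof -
  from assms obtain p where p: "p \<in> carrier F" "t = cls p" by (rule carrier_PE)
  then have "(SOME p. p \<in> t) \<in> t" using cls_self by (metis someI)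
  then show "(SOME p. p \<in> t) \<in> carrier F" "cls (SOME p. p \<in> t) = t"
    using p cls_subset cls_eqI by auto
qed

text \<open>From here to \<open>lin_ext_add\<close> the map f need not respect the relations: both
  sides are always evaluated on the same representative of t.\<close>

lemma lin_ext_closed:
  "module K W \<Longrightarrow> f \<in> G \<rightarrow> carrier W \<Longrightarrow> t \<in> carrier P \<Longrightarrow> lin_ext K W f t \<in> carrier W"
  unfolding lin_ext_eq by (rule lin_comb_closed[OF _ representative(1)])

lemma lin_ext_cong:
  assumes "module K W" "f \<in> G \<rightarrow> carrier W" "\<And>g. g \<in> G \<Longrightarrow> f g = h g" "t \<in> carrier P"
  shows "lin_ext K W f t = lin_ext K W h t"
proof -
  interpret W: module K W by fact
  have *: "(SOME p. p \<in> t) g \<in> carrier K" "(SOME p. p \<in> t) g \<noteq> \<zero>\<^bsub>K\<^esub> \<Longrightarrow> g \<in> G" for g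
    using representative(1)[OF assms(4)] by (auto simp: free_module_carrier)
  show ?thesis
    unfolding lin_ext_eq lin_comb_def
    by (rule W.M.finsum_cong') (use assms * in \<open>auto simp: Pi_def\<close>)
qed

lemma linear_map_lin_ext:
  "module K V \<Longrightarrow> module K W \<Longrightarrow> linear_map K V W h \<Longrightarrow> f \<in> G \<rightarrow> carrier V \<Longrightarrow> t \<in> carrier P
    \<Longrightarrow> h (lin_ext K V f t) = lin_ext K W (\<lambda>g. h (f g)) t"
  unfolding lin_ext_eq by (rule linear_map_lin_comb[OF _ _ _ representative(1)])

lemma lin_ext_param_linear:
  assumes "module K U" "module K W" "\<And>g. g \<in> G \<Longrightarrow> linear_map K U W (\<lambda>u. f u g)" "t \<in> carrier P"
  shows "linear_map K U W (\<lambda>u. lin_ext K W (f u) t)"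
  unfolding lin_ext_eq lin_comb_def
  by (intro linear_map_sum linear_map_scale assms)
    (use representative(1)[OF assms(4)] in \<open>auto simp: free_module_carrier\<close>)

lemma lin_ext_add:
  assumes "module K W" "f \<in> G \<rightarrow> carrier W" "h \<in> G \<rightarrow> carrier W" "t \<in> carrier P"
  shows "lin_ext K W (\<lambda>g. f g \<oplus>\<^bsub>W\<^esub> h g) t = lin_ext K W f t \<oplus>\<^bsub>W\<^esub> lin_ext K W h t"
proof -
  interpret W: module K W by fact
  define p where "p = (SOME p. p \<in> t)"
  have p: "p g \<in> carrier K" "p g \<noteq> \<zero>\<^bsub>K\<^esub> \<Longrightarrow> g \<in> G" for g
    using representative(1)[OF assms(4)] by (auto simp: free_module_carrier p_def)
  have *: "p g \<noteq> \<zero>\<^bsub>K\<^esub> \<Longrightarrow> f g \<in> carrier W" "p g \<noteq> \<zero>\<^bsub>K\<^esub> \<Longrightarrow> h g \<in> carrier W" for g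
    using p assms by auto
  have "(\<Oplus>\<^bsub>W\<^esub>g \<in> {g. p g \<noteq> \<zero>\<^bsub>K\<^esub>}. p g \<odot>\<^bsub>W\<^esub> (f g \<oplus>\<^bsub>W\<^esub> h g)) =
    (\<Oplus>\<^bsub>W\<^esub>g \<in> {g. p g \<noteq> \<zero>\<^bsub>K\<^esub>}. p g \<odot>\<^bsub>W\<^esub> f g \<oplus>\<^bsub>W\<^esub> p g \<odot>\<^bsub>W\<^esub> h g)"
    by (rule W.M.finsum_cong') (auto simp: p * W.smult_r_distr)
  then show ?thesis
    unfolding lin_ext_eq lin_comb_def p_def[symmetric]
    by (simp add: W.M.finsum_addf Pi_def p *)
qed

lemma gen_closed: "g \<in> G \<Longrightarrow> free_gen K g \<in> carrier F"
  by (rule free_gen_carrier[OF is_cring])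

text \<open>The class of a function is the combination of the classes of generators with its values
  as coefficients. Hence a linear map on \<open>P\<close> is determined by generators.\<close>

lemma lin_ext_gens:
  assumes "t \<in> carrier P" shows "lin_ext K P (\<lambda>g. cls (free_gen K g)) t = t"
proof -
  have "t = cls (lin_comb K F (free_gen K) (SOME p. p \<in> t))"
    using lin_comb_free_gen[OF is_cring representative(1)] representative(2) assms by simp
  also have "\<dots> = lin_ext K P (\<lambda>g. cls (free_gen K g)) t"
    unfolding lin_ext_eq
    by (rule linear_map_lin_comb[OF F.module_axioms module_P cls_linear])
      (use representative(1)[OF assms] gen_closed in auto)
  finally show ?thesis by simp
qed

text \<open>A map on generators that comes from a linear map on the quotient respects the relations
  automatically, which saves checking them for complicated f.\<close>

lemma lin_ext_eqI:
  assumes "module K W" "linear_map K P W h" "\<And>g. g \<in> G \<Longrightarrow> f g = h (cls (free_gen K g))"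
    "t \<in> carrier P"
  shows "lin_ext K W f t = h t"
proof -
  have "h t = h (lin_ext K P (\<lambda>g. cls (free_gen K g)) t)" using assms(4) by (simp add: lin_ext_gens)
  also have "\<dots> = lin_ext K W (\<lambda>g. h (cls (free_gen K g))) t"
    by (rule linear_map_lin_ext[OF module_P assms(1,2)])
        (use assms(4) gen_closed cls_closed in auto)
  also have "\<dots> = lin_ext K W f t"
    by (rule lin_ext_cong)
      (use assms gen_closed cls_closed linear_map_closed[OF assms(2)] in auto)
  finally show ?thesis by simp
qed

lemma linear_map_eqI:
  assumes "module K W" "linear_map K P W h" "linear_map K P W h'"
    "\<And>g. g \<in> G \<Longrightarrow> h (cls (free_gen K g)) = h' (cls (free_gen K g))" "t \<in> carrier P"
  shows "h t = h' t"
  using lin_ext_eqI[OF assms(1,2) refl assms(5)]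
    lin_ext_eqI[OF assms(1,3), of "\<lambda>g. h (cls (free_gen K g))", OF assms(4,5)] by simp

text \<open>The universal property. The kernel of \<open>lin_comb\<close> is a submodule containing
  the relations, hence their span, so two representatives of a class have the same value.\<close>

lemma
  assumes "module K W" "f \<in> G \<rightarrow> carrier W" "\<And>r. r \<in> R \<Longrightarrow> lin_comb K W f r = \<zero>\<^bsub>W\<^esub>"
  shows lin_ext_gen: "g \<in> G \<Longrightarrow> lin_ext K W f (cls (free_gen K g)) = f g"
    and lin_ext_linear: "linear_map K P W (lin_ext K W f)"
proof -
  interpret W: module K W by fact
  note l = lin_comb_linear[OF assms(1,2)]
  have "submodule {p \<in> carrier F. lin_comb K W f p = \<zero>\<^bsub>W\<^esub>} K F"
    using linear_map_add[OF l] linear_map_smult[OF l] linear_map_neg[OF F.module_axioms assms(1) l]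
      linear_map_zero[OF F.module_axioms assms(1) l]
    by (intro F.submoduleI)
      (auto simp del: free_module_simps intro: F.M.a_inv_closed)
  then have N: "lin_comb K W f p = \<zero>\<^bsub>W\<^esub>" if "p \<in> N" for p
    using that rel_span_least rels assms(3) by blast
  { fix p assume p: "p \<in> carrier F"
    let ?q = "SOME q. q \<in> cls p"
    have q: "?q \<in> carrier F" "cls ?q = cls p" using representative[OF cls_closed[OF p]] by auto
    then have "?q \<ominus>\<^bsub>F\<^esub> p \<in> N" using cls_eq_iff p by simp
    then have "lin_comb K W f ?q \<ominus>\<^bsub>W\<^esub> lin_comb K W f p = \<zero>\<^bsub>W\<^esub>"
      using linear_map_diff[OF F.module_axioms assms(1) l q(1) p] N by simp
    then have "lin_ext K W f (cls p) = lin_comb K W f p"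
      unfolding lin_ext_eq using q p linear_map_closed[OF l] by
          (simp add: abelian_group_minus_eq_zero_iff[OF W.M.abelian_group_axioms]) }
  note * = this
  show "lin_ext K W f (cls (free_gen K g)) = f g" if "g \<in> G"
    using *[OF gen_closed[OF that]] lin_comb_gen[OF assms(1,2) that] by simp
  show "linear_map K P W (lin_ext K W f)"
  proof (rule linear_mapI)
    fix s t a assume "s \<in> carrier P" "t \<in> carrier P"
    then obtain p q where pq: "p \<in> carrier F" "q \<in> carrier F" "s = cls p" "t = cls q"
      by (metis carrier_PE)
    show "lin_ext K W f (s \<oplus>\<^bsub>P\<^esub> t) = lin_ext K W f s \<oplus>\<^bsub>W\<^esub> lin_ext K W f t"
      using pq * linear_map_add[OF l] by (simp only: cls_add F.M.a_closed)
  next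
    fix s a assume "s \<in> carrier P" "a \<in> carrier K"
    then obtain p where pq: "p \<in> carrier F" "s = cls p" "a \<in> carrier K" by (metis carrier_PE)
    show "lin_ext K W f (a \<odot>\<^bsub>P\<^esub> s) = a \<odot>\<^bsub>W\<^esub> lin_ext K W f s"
      using pq * linear_map_smult[OF l] by (simp only: cls_smult F.smult_closed)
  qed (rule lin_ext_closed[OF assms(1,2)])
qed

text \<open>Relations of tensor products come in three shapes: homogeneity here, balancing and
  additivity in the next two lemmas.\<close>

lemma cls_rel_smult:
  assumes "a \<in> carrier K" "g \<in> G" "h \<in> G"
    "free_gen K g \<ominus>\<^bsub>F\<^esub> a \<odot>\<^bsub>F\<^esub> free_gen K h \<in> R"
  shows "cls (free_gen K g) = a \<odot>\<^bsub>P\<^esub> cls (free_gen K h)"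
  unfolding cls_smult[OF assms(1) gen_closed[OF assms(3)]]
  using cls_eq_iff[OF gen_closed F.smult_closed[OF _ gen_closed]] assms rels_subset by blast

lemma cls_rel_eq:
  assumes "g \<in> G" "h \<in> G" "free_gen K g \<ominus>\<^bsub>F\<^esub> free_gen K h \<in> R"
  shows "cls (free_gen K g) = cls (free_gen K h)"
  using cls_eq_iff[OF gen_closed gen_closed] assms rels_subset by blast

lemma cls_rel_add:
  assumes "g \<in> G" "h \<in> G" "h' \<in> G"
    "free_gen K g \<ominus>\<^bsub>F\<^esub> free_gen K h \<ominus>\<^bsub>F\<^esub> free_gen K h' \<in> R"
  shows "cls (free_gen K g) = cls (free_gen K h) \<oplus>\<^bsub>P\<^esub> cls (free_gen K h')"
proof -
  interpret P: module K P by (rule module_P)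
  note g = assms(1-3)[THEN gen_closed]
  note c = g[THEN cls_closed]
  have "cls (free_gen K g \<ominus>\<^bsub>F\<^esub> free_gen K h) = cls (free_gen K h')"
    using cls_eq_iff[OF F.M.minus_closed[OF g(1,2)] g(3)] assms(4) rels_subset by blast
  moreover have "cls (free_gen K g \<ominus>\<^bsub>F\<^esub> free_gen K h) = cls (free_gen K g) \<ominus>\<^bsub>P\<^esub> cls (free_gen K h)"
    by (rule linear_map_diff[OF F.module_axioms module_P cls_linear g(1,2)])
  ultimately have "cls (free_gen K h') = cls (free_gen K g) \<ominus>\<^bsub>P\<^esub> cls (free_gen K h)" by simp
  then show ?thesis using c by (simp add: a_minus_def P.M.a_ac P.M.r_neg)
qed

end

section \<open>Tensor products\<close>

text \<open>Keeps the index \<open>1\<close> of the definitions from being rewritten to \<open>Suc 0\<close>.\<close>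

declare One_nat_def [simp del]

text \<open>A slot is written \<open>us @ v # ws\<close>, the shape in which it occurs in
  \<open>tens_rels\<close>.\<close>

definition multilinear ::
  "('k, 'z) ring_scheme \<Rightarrow> ('k, 'v, 'y) module_scheme \<Rightarrow> nat \<Rightarrow> ('k, 'm, 'x) module_scheme
    \<Rightarrow> ('k, 'w, 'u) module_scheme \<Rightarrow> ('v list \<Rightarrow> 'm \<Rightarrow> 'w) \<Rightarrow> bool" where
  "multilinear K V n M W f \<longleftrightarrow>
    (\<forall>us ws. \<forall>m\<in>carrier M. set us \<subseteq> carrier V \<longrightarrow> set ws \<subseteq> carrier V \<longrightarrow>
      Suc (length us + length ws) = n \<longrightarrow> linear_map K V W (\<lambda>v. f (us @ v # ws) m)) \<and>
    (\<forall>vs. length vs = n \<longrightarrow> set vs \<subseteq> carrier V \<longrightarrow> linear_map K M W (f vs))"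

lemma multilinearI:
  assumes "\<And>us ws m. \<lbrakk>m \<in> carrier M; set us \<subseteq> carrier V; set ws \<subseteq> carrier V;
      Suc (length us + length ws) = n\<rbrakk> \<Longrightarrow> linear_map K V W (\<lambda>v. f (us @ v # ws) m)"
    and "\<And>vs. \<lbrakk>length vs = n; set vs \<subseteq> carrier V\<rbrakk> \<Longrightarrow> linear_map K M W (f vs)"
  shows "multilinear K V n M W f"
  using assms by (auto simp: multilinear_def)

lemma multilinear_slot:
  "\<lbrakk>multilinear K V n M W f; m \<in> carrier M; set us \<subseteq> carrier V; set ws \<subseteq> carrier V;
    Suc (length us + length ws) = n\<rbrakk> \<Longrightarrow> linear_map K V W (\<lambda>v. f (us @ v # ws) m)"
  and multilinear_last:
  "\<lbrakk>multilinear K V n M W f; length vs = n; set vs \<subseteq> carrier V\<rbrakk> \<Longrightarrow> linear_map K M W (f vs)"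
  by (auto simp: multilinear_def)

lemma multilinear_closed:
  "\<lbrakk>multilinear K V n M W f; length vs = n; set vs \<subseteq> carrier V; m \<in> carrier M\<rbrakk> \<Longrightarrow> f vs m \<in> carrier W"
  using linear_map_closed[OF multilinear_last] .

lemma multilinear_cong:
  assumes "module K V" "module K M"
    "\<And>vs m. \<lbrakk>length vs = n; set vs \<subseteq> carrier V; m \<in> carrier M\<rbrakk> \<Longrightarrow> f vs m = g vs m"
  shows "multilinear K V n M W f \<longleftrightarrow> multilinear K V n M W g"
proof -
  have *: "multilinear K V n M W g" if 1: "multilinear K V n M W f"
    "\<And>vs m. \<lbrakk>length vs = n; set vs \<subseteq> carrier V; m \<in> carrier M\<rbrakk> \<Longrightarrow> f vs m = g vs m" for f g
  proof (rule multilinearI)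
    fix us ws m assume 2: "m \<in> carrier M" "set us \<subseteq> carrier V" "set ws \<subseteq> carrier V"
      "Suc (length us + length ws) = n"
    show "linear_map K V W (\<lambda>v. g (us @ v # ws) m)"
      using multilinear_slot[OF 1(1) 2]
      by (rule iffD1[OF linear_map_cong[OF assms(1)], rotated]) (use 2 in \<open>simp add: 1(2)\<close>)
  next
    fix vs assume 2: "length vs = n" "set vs \<subseteq> carrier V"
    show "linear_map K M W (g vs)"
      using multilinear_last[OF 1(1) 2]
      by (rule iffD1[OF linear_map_cong[OF assms(2)], rotated]) (use 2 in \<open>simp add: 1(2)\<close>)
  qed
  show ?thesis using *[of f g] *[of g f] assms(3) by metis
qed

lemma multilinear_comp:
  assumes "multilinear K V n M U f" "linear_map K U W h"
  shows "multilinear K V n M W (\<lambda>vs m. h (f vs m))"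
  using assms(1) by (auto simp: multilinear_def intro: linear_map_comp[OF _ assms(2)])

lemma multilinear_minus:
  assumes "module K V" "module K M" "module K W" "multilinear K V n M W f" "multilinear K V n M W g"
  shows "multilinear K V n M W (\<lambda>vs m. f vs m \<ominus>\<^bsub>W\<^esub> g vs m)"
  using assms(4,5)
  by (auto simp: multilinear_def intro: linear_map_minus[OF assms(1,3)] linear_map_minus[OF
      assms(2,3)])

lemma multilinear_0I:
  assumes "linear_map K M W (f [])"
  shows "multilinear K V 0 M W f"
  using assms by (auto simp: multilinear_def)

text \<open>Splits off the first slot, as required by maps that are defined by recursion on the list
  of vectors, such as \<open>cob\<close>.\<close>

lemma multilinear_SucI:
  assumes "\<And>cs m. \<lbrakk>length cs = n; set cs \<subseteq> carrier V; m \<in> carrier M\<rbrakk> \<Longrightarrow>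
      linear_map K V W (\<lambda>c. f (c # cs) m)"
    and "\<And>c. c \<in> carrier V \<Longrightarrow> multilinear K V n M W (\<lambda>cs. f (c # cs))"
  shows "multilinear K V (Suc n) M W f"
proof (rule multilinearI)
  fix us ws m assume 2: "m \<in> carrier M" "set us \<subseteq> carrier V" "set ws \<subseteq> carrier V"
    "Suc (length us + length ws) = Suc n"
  show "linear_map K V W (\<lambda>v. f (us @ v # ws) m)"
  proof (cases us)
    case Nil
    then show ?thesis using 2 assms(1) by simp
  next
    case (Cons c us')
    then show ?thesis using 2 multilinear_slot[OF assms(2)[of c], of m us' ws] by simp
  qed
next
  fix vs assume "length vs = Suc n" "set vs \<subseteq> carrier V"
  then obtain c cs where "vs = c # cs" "c \<in> carrier V" "set cs \<subseteq> carrier V" "length cs = n"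
    by (cases vs) auto
  then show "linear_map K M W (f vs)" using multilinear_last[OF assms(2)[of c]] by simp
qed

text \<open>The slot is read off by \<open>!\<close>, as in \<open>sw2\<close>;
  \<open>multilinear_2I\<close> does the same for \<open>sw3\<close>.\<close>

lemma multilinear_1I:
  assumes "\<And>m. m \<in> carrier M \<Longrightarrow> linear_map K V W (\<lambda>v. f v m)"
    and "\<And>v. v \<in> carrier V \<Longrightarrow> linear_map K M W (f v)"
  shows "multilinear K V 1 M W (\<lambda>vs. f (vs ! 0))"
  unfolding One_nat_def by (intro multilinear_SucI multilinear_0I) (simp_all add: assms)

lemma multilinear_2I:
  assumes "\<And>u m. u \<in> carrier V \<Longrightarrow> m \<in> carrier M \<Longrightarrow> linear_map K V W (\<lambda>v. f v u m)"
    and "\<And>u m. u \<in> carrier V \<Longrightarrow> m \<in> carrier M \<Longrightarrow> linear_map K V W (\<lambda>v. f u v m)"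
    and "\<And>u v. u \<in> carrier V \<Longrightarrow> v \<in> carrier V \<Longrightarrow> linear_map K M W (f u v)"
  shows "multilinear K V 2 M W (\<lambda>vs. f (vs ! 0) (vs ! 1))"
  unfolding numeral_2_eq_2 One_nat_def
  by (intro multilinear_SucI multilinear_0I) (auto simp: assms length_Suc_conv)

lemma presentation_tens:
  assumes "module K V" "module K M"
  shows "presentation K (tens_gens V n M) (tens_rels K V n M)"
proof -
  interpret V: module K V by fact
  interpret M: module K M by fact
  interpret F: module K "free_module K (tens_gens V n M)"
    by (rule module_free_module) (rule V.R.is_cring)
  note g = free_gen_carrier[OF V.R.is_cring]
  show ?thesis
  proof (intro presentation.intro presentation_axioms.intro V.R.is_cring subsetI)
    fix r assume "r \<in> tens_rels K V n M"
    then show "r \<in> carrier (free_module K (tens_gens V n M))"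
      unfolding tens_rels_def Let_def
      by (auto simp del: free_module_simps intro!: F.M.minus_closed F.smult_closed g)
        (auto simp: tens_gens_def)
  qed
qed

lemma lin_comb_tens_rels:
  assumes "module K V" "module K M" "module K W" "multilinear K V n M W f" "r \<in> tens_rels K V n M"
  shows "lin_comb K W (\<lambda>(vs, m). f vs m) r = \<zero>\<^bsub>W\<^esub>"
proof -
  interpret V: module K V by fact
  interpret M: module K M by fact
  interpret W: module K W by fact
  let ?G = "tens_gens V n M"
  let ?F = "free_module K ?G"
  let ?f = "\<lambda>(vs, m). f vs m"
  interpret F: module K ?F by (rule module_free_module) (rule V.R.is_cring)
  note g = free_gen_carrier[OF V.R.is_cring, of _ ?G]
  have fG: "?f \<in> ?G \<rightarrow> carrier W"
    using multilinear_closed[OF assms(4)] by (auto simp: tens_gens_def)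
  note lin = lin_comb_linear[OF assms(3) fG]
  note ev = linear_map_diff[OF F.module_axioms assms(3) lin] linear_map_smult[OF lin]
    lin_comb_gen[OF assms(3) fG]
  \<comment> \<open>The values of an additivity and of a homogeneity relation once f is evaluated on
    their generators.\<close>
  have a: "x \<oplus>\<^bsub>W\<^esub> y \<ominus>\<^bsub>W\<^esub> x \<ominus>\<^bsub>W\<^esub> y = \<zero>\<^bsub>W\<^esub>" if "x \<in> carrier W" "y \<in> carrier W" for x y
    using that by (simp add: a_minus_def W.M.a_assoc W.M.a_comm[of x y] W.M.r_neg W.M.r_neg1)
  have b: "x \<ominus>\<^bsub>W\<^esub> x = \<zero>\<^bsub>W\<^esub>" if "x \<in> carrier W" for x
    using that by (simp add: a_minus_def W.M.r_neg)
  note slot = multilinear_slot[OF assms(4)] and last = multilinear_last[OF assms(4)]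
  note lin = linear_map_add[OF slot] linear_map_add[OF last] linear_map_smult[OF slot]
    linear_map_smult[OF last]
  have gen: "(vs, m) \<in> ?G \<longleftrightarrow> length vs = n \<and> set vs \<subseteq> carrier V \<and> m \<in> carrier M" for vs m
    by (simp add: tens_gens_def)
  show ?thesis
    using assms(5) unfolding tens_rels_def Let_def
    by (elim UnE CollectE exE conjE)
      (simp_all add: gen ev g lin a b multilinear_closed[OF assms(4)] del: free_module_simps)
qed

section \<open>The universal property of V \<otimes> ... \<otimes> V \<otimes> M\<close>

locale tensor = module K V for K :: "'k ring" and V :: "('k, 'v, 'y) module_scheme"
begin

abbreviation "T n M \<equiv> tens K V n M"
abbreviation "sg n \<equiv> (\<ominus>\<^bsub>K\<^esub> \<one>\<^bsub>K\<^esub>) [^]\<^bsub>K\<^esub> (n :: nat)"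
abbreviation "\<tau> M \<equiv> pt K V M"
abbreviation "lift W f \<equiv> lin_ext K W (\<lambda>(vs, m). f vs m)"

lemma presentation_T: "module K M \<Longrightarrow> presentation K (tens_gens V n M) (tens_rels K V n M)"
  by (rule presentation_tens[OF module_axioms])

lemma module_T [simp]: "module K M \<Longrightarrow> module K (T n M)"
  unfolding tens_def by (rule presentation.module_P[OF presentation_T])

lemma tens_gen:
  "(vs, m) \<in> tens_gens V n M \<longleftrightarrow> length vs = n \<and> set vs \<subseteq> carrier V \<and> m \<in> carrier M"
  by (simp add: tens_gens_def)

lemma pt_cls: "length vs = n \<Longrightarrow>
    \<tau> M vs m = rel_class K (tens_gens V n M) (tens_rels K V n M) (free_gen K (vs, m))"
  by (simp add: pt_def)

lemma pt_closed [simp]: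
  "\<lbrakk>module K M; length vs = n; set vs \<subseteq> carrier V; m \<in> carrier M\<rbrakk> \<Longrightarrow> \<tau> M vs m \<in> carrier (T n M)"
  by (auto simp: tens_def pt_cls tens_gen
      intro!: presentation.cls_closed[OF presentation_T presentation.gen_closed[OF presentation_T]])

lemma lift_closed:
  "\<lbrakk>module K M; module K W; \<And>vs m. \<lbrakk>length vs = n; set vs \<subseteq> carrier V; m \<in> carrier M\<rbrakk> \<Longrightarrow> f vs m
      \<in> carrier W;
    t \<in> carrier (T n M)\<rbrakk> \<Longrightarrow> lift W f t \<in> carrier W"
  unfolding tens_def by (rule presentation.lin_ext_closed[OF presentation_T]) (auto simp: tens_gen)

lemma lift_cong:
  assumes "module K M" "module K W"
    "\<And>vs m. \<lbrakk>length vs = n; set vs \<subseteq> carrier V; m \<in> carrier M\<rbrakk> \<Longrightarrow> f vs m \<in> carrier W"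
    "\<And>vs m. \<lbrakk>length vs = n; set vs \<subseteq> carrier V; m \<in> carrier M\<rbrakk> \<Longrightarrow> f vs m = g vs m"
    "t \<in> carrier (T n M)"
  shows "lift W f t = lift W g t"
  using assms(5) unfolding tens_def
  by (rule presentation.lin_ext_cong[OF presentation_T[OF assms(1)] assms(2), rotated 2])
    (use assms(3,4) in \<open>auto simp: tens_gen\<close>)

lemma linear_map_lift:
  assumes "module K M" "module K U" "module K W" "linear_map K U W h"
    "\<And>vs m. \<lbrakk>length vs = n; set vs \<subseteq> carrier V; m \<in> carrier M\<rbrakk> \<Longrightarrow> f vs m \<in> carrier U"
    "t \<in> carrier (T n M)"
  shows "h (lift U f t) = lift W (\<lambda>vs m. h (f vs m)) t"
proof -
  have "h (lift U f t) = lin_ext K W (\<lambda>g. h (case g of (vs, m) \<Rightarrow> f vs m)) t"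
    using assms(6) unfolding tens_def
    by (rule presentation.linear_map_lin_ext[OF presentation_T[OF assms(1)] assms(2-4), rotated])
      (use assms(5) in \<open>auto simp: tens_gen\<close>)
  then show ?thesis by (simp add: prod.case_distrib[of h] case_prod_unfold)
qed

lemma lift_param_linear:
  assumes "module K M" "module K U" "module K W"
    "\<And>vs m. \<lbrakk>length vs = n; set vs \<subseteq> carrier V; m \<in> carrier M\<rbrakk> \<Longrightarrow> linear_map K U W (\<lambda>u. f u vs m)"
    "t \<in> carrier (T n M)"
  shows "linear_map K U W (\<lambda>u. lift W (f u) t)"
  using assms(5) unfolding tens_def
  by (rule presentation.lin_ext_param_linear[OF presentation_T[OF assms(1)] assms(2,3), rotated])
    (use assms(4) in \<open>auto simp: tens_gen\<close>)

lemma lift_linear: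
  assumes "module K M" "module K W" "multilinear K V n M W f"
  shows "linear_map K (T n M) W (lift W f)"
  unfolding tens_def
  by (rule presentation.lin_ext_linear[OF presentation_T[OF assms(1)] assms(2)])
    (use multilinear_closed[OF assms(3)] lin_comb_tens_rels[OF module_axioms assms] in \<open>auto
        simp: tens_gen\<close>)

lemma lift_pt:
  assumes "module K M" "module K W" "multilinear K V n M W f"
    "length vs = n" "set vs \<subseteq> carrier V" "m \<in> carrier M"
  shows "lift W f (\<tau> M vs m) = f vs m"
proof -
  have "lift W f (\<tau> M vs m) = (case (vs, m) of (vs, m) \<Rightarrow> f vs m)"
    unfolding pt_cls[OF assms(4)]
    by (rule presentation.lin_ext_gen[OF presentation_T[OF assms(1)] assms(2)])
      (use multilinear_closed[OF assms(3)] lin_comb_tens_rels[OF module_axioms assms(1-3)] assms(4-)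
        in \<open>auto simp: tens_gen\<close>)
  then show ?thesis by simp
qed

lemma lift_eqI:
  assumes "module K M" "module K W" "linear_map K (T n M) W h"
    "\<And>vs m. \<lbrakk>length vs = n; set vs \<subseteq> carrier V; m \<in> carrier M\<rbrakk> \<Longrightarrow> f vs m = h (\<tau> M vs m)"
    "t \<in> carrier (T n M)"
  shows "lift W f t = h t"
proof -
  interpret presentation K "tens_gens V n M" "tens_rels K V n M"
      by (rule presentation_T[OF assms(1)])
  show ?thesis
    by (rule lin_ext_eqI[OF assms(2)])
      (use assms(3-5) in \<open>auto simp: tens_gen pt_cls tens_def\<close>)
qed

text \<open>Pure tensors span, so identities between linear maps are checked on them; most later
  identities are proved in this way.\<close>

lemma tens_eqI:
  assumes "module K M" "module K W" "linear_map K (T n M) W h" "linear_map K (T n M) W h'"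
    "\<And>vs m. \<lbrakk>length vs = n; set vs \<subseteq> carrier V; m \<in> carrier M\<rbrakk> \<Longrightarrow> h (\<tau> M vs m) = h' (\<tau> M vs m)"
    "t \<in> carrier (T n M)"
  shows "h t = h' t"
  using lift_eqI[OF assms(1,2,3) refl assms(6)]
    lift_eqI[OF assms(1,2,4), of "\<lambda>vs m. h (\<tau> M vs m)", OF assms(5,6)] by simp

text \<open>The four families of \<open>tens_rels\<close>, read as identities between classes: a sum
  and a multiple in a slot, a sum and a multiple in the last factor.\<close>

lemma pt_multilinear:
  assumes "module K M" shows "multilinear K V n M (T n M) (\<tau> M)"
proof -
  interpret M: module K M by fact
  interpret presentation K "tens_gens V n M" "tens_rels K V n M" by (rule presentation_T[OF assms])
  show ?thesis
  proof (rule multilinearI; rule linear_mapI)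
    fix us ws m v assume *: "m \<in> carrier M" "set us \<subseteq> carrier V" "set ws \<subseteq> carrier V"
      "Suc (length us + length ws) = n" "v \<in> carrier V"
    have len: "length (us @ x # ws) = n" for x using * by simp
    have g: "(us @ x # ws, m) \<in> tens_gens V n M" if "x \<in> carrier V" for x
      using * that by (simp add: tens_gen)
    show "\<tau> M (us @ v # ws) m \<in> carrier (T n M)" using * assms by simp
    show "\<tau> M (us @ (v \<oplus>\<^bsub>V\<^esub> w) # ws) m = \<tau> M (us @ v # ws) m \<oplus>\<^bsub>T n M\<^esub> \<tau> M (us @ w # ws) m"
      if "w \<in> carrier V" for w
      unfolding tens_def pt_def len
      by (rule cls_rel_add)
        (use g[of v] g[of w] g[of "v \<oplus>\<^bsub>V\<^esub> w"] * that in \<open>simp_all, unfold tens_rels_def Let_def,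
            blast\<close>)
    show "\<tau> M (us @ (a \<odot>\<^bsub>V\<^esub> v) # ws) m = a \<odot>\<^bsub>T n M\<^esub> \<tau> M (us @ v # ws) m" if "a \<in> carrier K" for a
      unfolding tens_def pt_def len
      by (rule cls_rel_smult)
        (use g[of v] g[of "a \<odot>\<^bsub>V\<^esub> v"] * that in
          \<open>simp_all del: free_module_simps, unfold tens_rels_def Let_def, blast\<close>)
  next
    fix vs m assume *: "length vs = n" "set vs \<subseteq> carrier V" "m \<in> carrier M"
    have g: "(vs, m) \<in> tens_gens V n M" if "m \<in> carrier M" for m
      using * that by (simp add: tens_gen)
    show "\<tau> M vs m \<in> carrier (T n M)" using * assms by simp
    show "\<tau> M vs (m \<oplus>\<^bsub>M\<^esub> m') = \<tau> M vs m \<oplus>\<^bsub>T n M\<^esub> \<tau> M vs m'" if "m' \<in> carrier M" for m'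
      unfolding tens_def pt_def *(1)
      by (rule cls_rel_add)
        (use g[of m] g[of m'] g[of "m \<oplus>\<^bsub>M\<^esub> m'"] * that in \<open>simp_all, unfold tens_rels_def Let_def,
            blast\<close>)
    show "\<tau> M vs (a \<odot>\<^bsub>M\<^esub> m) = a \<odot>\<^bsub>T n M\<^esub> \<tau> M vs m" if "a \<in> carrier K" for a
      unfolding tens_def pt_def *(1)
      by (rule cls_rel_smult)
        (use g[of m] g[of "a \<odot>\<^bsub>M\<^esub> m"] * that in
          \<open>simp_all del: free_module_simps, unfold tens_rels_def Let_def, blast\<close>)
  qed
qed

text \<open>The index \<open>k\<close> is the number of factors \<open>V\<close> of the result, not of the argument.\<close>

definition pre where "pre M k vs = lift (T k M) (\<lambda>us. \<tau> M (vs @ us))"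

lemma multilinear_pt_append:
  assumes "module K M" "set vs \<subseteq> carrier V" "k = length vs + n"
  shows "multilinear K V n M (T k M) (\<lambda>us. \<tau> M (vs @ us))"
proof (rule multilinearI)
  fix us ws m assume *: "m \<in> carrier M" "set us \<subseteq> carrier V" "set ws \<subseteq> carrier V"
      "Suc (length us + length ws) = n"
  show "linear_map K V (T k M) (\<lambda>v. \<tau> M (vs @ us @ v # ws) m)"
    using multilinear_slot[OF pt_multilinear[OF assms(1)], of m "vs @ us" ws k] assms * by simp
next
  fix us assume *: "length us = n" "set us \<subseteq> carrier V" 
  show "linear_map K M (T k M) (\<tau> M (vs @ us))"
    using multilinear_last[OF pt_multilinear[OF assms(1)], of "vs @ us" k] assms * by simp
qed

lemma pre_linear:
  "\<lbrakk>module K M; set vs \<subseteq> carrier V; k = length vs + n\<rbrakk> \<Longrightarrow> linear_map K (T n M) (T k M) (pre M k vs)"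
  unfolding pre_def by (rule lift_linear) (simp_all add: multilinear_pt_append)

lemma pre_closed [simp]:
  "\<lbrakk>module K M; set vs \<subseteq> carrier V; k = length vs + n; t \<in> carrier (T n M)\<rbrakk> \<Longrightarrow>
    pre M k vs t \<in> carrier (T k M)"
  using linear_map_closed[OF pre_linear] .

lemma pre_pt:
  "\<lbrakk>module K M; set vs \<subseteq> carrier V; k = length vs + length us; set us \<subseteq> carrier V; m \<in> carrier M\<rbrakk> \<Longrightarrow>
    pre M k vs (\<tau> M us m) = \<tau> M (vs @ us) m"
  unfolding pre_def by (rule lift_pt) (simp_all add: multilinear_pt_append)

lemma pre_pre:
  assumes "module K M" "set vs \<subseteq> carrier V" "set us \<subseteq> carrier V" "l = length us + n"
      "k = length vs + l"
    "t \<in> carrier (T n M)"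
  shows "pre M k vs (pre M l us t) = pre M k (vs @ us) t"
  by (rule tens_eqI[OF assms(1) _ linear_map_comp[OF pre_linear pre_linear] pre_linear _ assms(6)])
    (use assms in \<open>simp_all add: pre_pt\<close>)

lemma pre_Nil: "module K M \<Longrightarrow> t \<in> carrier (T n M) \<Longrightarrow> pre M n [] t = t"
  by (rule tens_eqI[OF _ _ pre_linear linear_map_id]) (simp_all add: pre_pt)

text \<open>For a fixed t the chosen representative is fixed too, and \<open>pre\<close> is one
  linear combination of pure tensors, each linear in the slot.\<close>

lemma pre_slot_linear:
  assumes "module K M" "set us \<subseteq> carrier V" "set ws \<subseteq> carrier V"
    "k = Suc (length us + length ws + n)" "t \<in> carrier (T n M)"
  shows "linear_map K V (T k M) (\<lambda>v. pre M k (us @ v # ws) t)"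
  unfolding pre_def
proof (rule lift_param_linear[OF assms(1) module_axioms _ _ assms(5)])
  fix vs m assume "length vs = n" "set vs \<subseteq> carrier V" "m \<in> carrier M"
  then show "linear_map K V (T k M) (\<lambda>v. \<tau> M ((us @ v # ws) @ vs) m)"
    using multilinear_slot[OF pt_multilinear[OF assms(1)], of m us "ws @ vs" k] assms by simp
qed (simp add: assms)

text \<open>The common form of maps that apply some h to the last factor and leave the preceding
  list alone: the iterated comultiplication and the product with a one-form are both of this
  form.\<close>

lemma pre_multilinear:
  assumes "module K M" "module K N" "linear_map K M (T n N) h" "k = j + n"
  shows "multilinear K V j M (T k N) (\<lambda>vs m. pre N k vs (h m))"
  by (intro multilinearI pre_slot_linear linear_map_comp[OF assms(3) pre_linear])
    (use assms linear_map_closed[OF assms(3)] in auto)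

text \<open>The map id \<otimes> ... \<otimes> id \<otimes> f.\<close>

definition tmap where "tmap N n f = lift (T n N) (\<lambda>vs m. \<tau> N vs (f m))"

lemma multilinear_pt_map:
  assumes "module K M" "module K N" "linear_map K M N f"
  shows "multilinear K V n M (T n N) (\<lambda>vs m. \<tau> N vs (f m))"
  by (intro multilinearI multilinear_slot[OF pt_multilinear] linear_map_comp[OF assms(3)]
      multilinear_last[OF pt_multilinear])
    (use assms linear_map_closed[OF assms(3)] in auto)

lemma tmap_linear:
  "\<lbrakk>module K M; module K N; linear_map K M N f\<rbrakk> \<Longrightarrow> linear_map K (T n M) (T n N) (tmap N n f)"
  unfolding tmap_def by (rule lift_linear) (simp_all add: multilinear_pt_map)

lemma tmap_closed [simp]:
  "\<lbrakk>module K M; module K N; linear_map K M N f; t \<in> carrier (T n M)\<rbrakk> \<Longrightarrow> tmap N n f t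
      \<in> carrier (T n N)"
  using linear_map_closed[OF tmap_linear] .

lemma tmap_pt:
  "\<lbrakk>module K M; module K N; linear_map K M N f; length vs = n; set vs \<subseteq> carrier V; m \<in> carrier M\<rbrakk> \<Longrightarrow>
    tmap N n f (\<tau> M vs m) = \<tau> N vs (f m)"
  unfolding tmap_def by (rule lift_pt) (simp_all add: multilinear_pt_map)

lemma tmap_pre:
  assumes "module K M" "module K N" "linear_map K M N f" "set vs \<subseteq> carrier V" "k = length vs + n"
    "t \<in> carrier (T n M)"
  shows "tmap N k f (pre M k vs t) = pre N k vs (tmap N n f t)"
  by (rule tens_eqI[OF assms(1) _ linear_map_comp[OF pre_linear tmap_linear]
        linear_map_comp[OF tmap_linear pre_linear] _ assms(6)])
    (use assms linear_map_closed[OF assms(3)] in \<open>simp_all add: pre_pt tmap_pt\<close>)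

lemma tmap_tmap:
  assumes "module K L" "module K M" "module K N" "linear_map K L M f" "linear_map K M N g"
    "t \<in> carrier (T n L)"
  shows "tmap N n g (tmap M n f t) = tmap N n (\<lambda>x. g (f x)) t"
  by (rule tens_eqI[OF assms(1) _ linear_map_comp[OF tmap_linear tmap_linear] tmap_linear _
      assms(6)])
    (use assms linear_map_closed[OF assms(4)] in \<open>simp_all add: tmap_pt linear_map_comp[OF
        assms(4)]\<close>)

lemma tmap_cong:
  assumes "module K M" "module K N" "linear_map K M N f" "\<And>x. x \<in> carrier M \<Longrightarrow> f x = g x"
    "t \<in> carrier (T n M)"
  shows "tmap N n f t = tmap N n g t"
  unfolding tmap_def
  by (rule lift_cong[OF assms(1) _ _ _ assms(5)]) (use assms linear_map_closed[OF assms(3)] in auto)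

text \<open>f is the identity on the carrier only, which is what the extensional identity morphisms
  offer.\<close>

lemma tmap_ident:
  assumes "module K M" "t \<in> carrier (T n M)" "\<And>x. x \<in> carrier M \<Longrightarrow> f x = x"
  shows "tmap M n f t = t"
proof -
  have "linear_map K M M f"
    by (rule iffD1[OF linear_map_cong[OF assms(1)] linear_map_id]) (simp add: assms(3))
  then show ?thesis
    by (intro tens_eqI[OF assms(1) _ tmap_linear linear_map_id _ assms(2)])
      (simp_all add: tmap_pt assms)
qed

lemma tmap_param_linear:
  assumes "module K U" "module K M" "module K N" "\<And>m. m \<in> carrier M \<Longrightarrow> linear_map K U N (\<lambda>u. f u m)"
    "t \<in> carrier (T n M)"
  shows "linear_map K U (T n N) (\<lambda>u. tmap N n (f u) t)"
  unfolding tmap_def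
  by (rule lift_param_linear[OF assms(2,1) _ _ assms(5)])
    (use assms in \<open>auto intro: linear_map_comp[OF _ multilinear_last[OF pt_multilinear]]\<close>)

section \<open>Calculation rules for Sweedler sums\<close>

lemma sw2_closed:
  assumes "module K M" "module K W" "\<And>v m. \<lbrakk>v \<in> carrier V; m \<in> carrier M\<rbrakk> \<Longrightarrow> f v m \<in> carrier W"
    "t \<in> carrier (T 1 M)"
  shows "sw2 K W t f \<in> carrier W"
  unfolding sw2_def
  by (rule lift_closed[OF assms(1,2) _ assms(4)]) (auto simp: length_Suc_conv One_nat_def
      intro!: assms(3))

lemma sw2_cong:
  assumes "module K M" "module K W" "\<And>v m. \<lbrakk>v \<in> carrier V; m \<in> carrier M\<rbrakk> \<Longrightarrow> f v m \<in> carrier W"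
    "\<And>v m. \<lbrakk>v \<in> carrier V; m \<in> carrier M\<rbrakk> \<Longrightarrow> f v m = g v m" "t \<in> carrier (T 1 M)"
  shows "sw2 K W t f = sw2 K W t g"
  unfolding sw2_def
  by (rule lift_cong[OF assms(1,2) _ _ assms(5)]) (auto simp: length_Suc_conv One_nat_def
      intro!: assms(3,4))

lemma linear_map_sw2:
  assumes "module K M" "module K U" "module K W" "linear_map K U W h"
    "\<And>v m. \<lbrakk>v \<in> carrier V; m \<in> carrier M\<rbrakk> \<Longrightarrow> f v m \<in> carrier U" "t \<in> carrier (T 1 M)"
  shows "h (sw2 K U t f) = sw2 K W t (\<lambda>v m. h (f v m))"
  unfolding sw2_def
  by (rule linear_map_lift[OF assms(1-4) _ assms(6)]) (auto simp: length_Suc_conv One_nat_def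
      intro!: assms(5))

text \<open>Linearity in a parameter of f with the tensor held fixed; linearity in the tensor itself
  is \<open>sw2_linear\<close> and asks for bilinear f.\<close>

lemma sw2_param_linear:
  assumes "module K M" "module K U" "module K W"
    "\<And>v m. \<lbrakk>v \<in> carrier V; m \<in> carrier M\<rbrakk> \<Longrightarrow> linear_map K U W (\<lambda>u. f u v m)" "t \<in> carrier (T 1 M)"
  shows "linear_map K U W (\<lambda>u. sw2 K W t (f u))"
  unfolding sw2_def
  by (rule lift_param_linear[OF assms(1-3) _ assms(5)]) (auto simp: length_Suc_conv One_nat_def
      intro!: assms(4))

lemma sw2_linear:
  assumes "module K M" "module K W" "\<And>m. m \<in> carrier M \<Longrightarrow> linear_map K V W (\<lambda>v. f v m)"
    "\<And>v. v \<in> carrier V \<Longrightarrow> linear_map K M W (f v)"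
  shows "linear_map K (T 1 M) W (\<lambda>t. sw2 K W t f)"
  unfolding sw2_def by (intro lift_linear multilinear_1I assms)

lemma sw2_pt:
  assumes "module K M" "module K W" "\<And>m. m \<in> carrier M \<Longrightarrow> linear_map K V W (\<lambda>v. f v m)"
    "\<And>v. v \<in> carrier V \<Longrightarrow> linear_map K M W (f v)" "v \<in> carrier V" "m \<in> carrier M"
  shows "sw2 K W (\<tau> M [v] m) f = f v m"
  unfolding sw2_def
  by (subst lift_pt[OF assms(1,2) multilinear_1I[OF assms(3,4)]]) (simp_all add: assms One_nat_def)

lemma sw3_cong:
  assumes "module K M" "module K W"
    "\<And>u v m. \<lbrakk>u \<in> carrier V; v \<in> carrier V; m \<in> carrier M\<rbrakk> \<Longrightarrow> f u v m \<in> carrier W"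
    "\<And>u v m. \<lbrakk>u \<in> carrier V; v \<in> carrier V; m \<in> carrier M\<rbrakk> \<Longrightarrow> f u v m = g u v m"
    "t \<in> carrier (T 2 M)"
  shows "sw3 K W t f = sw3 K W t g"
  unfolding sw3_def
  by (rule lift_cong[OF assms(1,2) _ _ assms(5)])
    (auto simp: length_Suc_conv One_nat_def numeral_2_eq_2 intro!: assms(3,4))

lemma linear_map_sw3:
  assumes "module K M" "module K U" "module K W" "linear_map K U W h"
    "\<And>u v m. \<lbrakk>u \<in> carrier V; v \<in> carrier V; m \<in> carrier M\<rbrakk> \<Longrightarrow> f u v m \<in> carrier U"
    "t \<in> carrier (T 2 M)"
  shows "h (sw3 K U t f) = sw3 K W t (\<lambda>u v m. h (f u v m))"
  unfolding sw3_def
  by (rule linear_map_lift[OF assms(1-4) _ assms(6)])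
    (auto simp: length_Suc_conv One_nat_def numeral_2_eq_2 intro!: assms(5))

lemma sw3_param_linear:
  assumes "module K M" "module K U" "module K W"
    "\<And>u v m. \<lbrakk>u \<in> carrier V; v \<in> carrier V; m \<in> carrier M\<rbrakk> \<Longrightarrow> linear_map K U W (\<lambda>x. f x u v m)"
    "t \<in> carrier (T 2 M)"
  shows "linear_map K U W (\<lambda>x. sw3 K W t (f x))"
  unfolding sw3_def
  by (rule lift_param_linear[OF assms(1-3) _ assms(5)])
    (auto simp: length_Suc_conv One_nat_def numeral_2_eq_2 intro!: assms(4))

lemma sw3_linear:
  assumes "module K M" "module K W"
    "\<And>u m. u \<in> carrier V \<Longrightarrow> m \<in> carrier M \<Longrightarrow> linear_map K V W (\<lambda>v. f v u m)"
    "\<And>u m. u \<in> carrier V \<Longrightarrow> m \<in> carrier M \<Longrightarrow> linear_map K V W (\<lambda>v. f u v m)"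
    "\<And>u v. u \<in> carrier V \<Longrightarrow> v \<in> carrier V \<Longrightarrow> linear_map K M W (f u v)"
  shows "linear_map K (T 2 M) W (\<lambda>t. sw3 K W t f)"
  unfolding sw3_def by (intro lift_linear multilinear_2I assms)

text \<open>A Sweedler sum that merely reassembles the tensor behind a prefix is \<open>pre\<close>,
  whose linearity is already available.\<close>

lemma sw2_eq_pre:
  assumes "module K M" "set vs \<subseteq> carrier V" "k = Suc (length vs)" "t \<in> carrier (T 1 M)"
  shows "sw2 K (T k M) t (\<lambda>v m. \<tau> M (vs @ [v]) m) = pre M k vs t"
  unfolding sw2_def pre_def
  by (rule lift_cong[OF assms(1) _ _ _ assms(4)])
    (use assms in \<open>auto simp: length_Suc_conv One_nat_def\<close>)

lemma pt_last_linear: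
  "\<lbrakk>module K M; length vs = n; set vs \<subseteq> carrier V\<rbrakk> \<Longrightarrow> linear_map K M (T n M) (\<tau> M vs)"
  by (rule multilinear_last[OF pt_multilinear])

lemma pt_slot_linear:
  "\<lbrakk>module K M; m \<in> carrier M; set us \<subseteq> carrier V; set ws \<subseteq> carrier V;
    Suc (length us + length ws) = n\<rbrakk> \<Longrightarrow> linear_map K V (T n M) (\<lambda>v. \<tau> M (us @ v # ws) m)"
  by (rule multilinear_slot[OF pt_multilinear])

end

section \<open>Balanced tensor products\<close>

text \<open>Closure of the two actions is what places the balancing relations inside the free
  module.\<close>

locale balanced_tensor = V: module K V + M: module K M
  for K :: "'k ring" and A :: "('k, 'a, 'u) module_scheme" and V :: "('k, 'v, 'y) module_scheme"
    and ra :: "'v \<Rightarrow> 'a \<Rightarrow> 'v" and M :: "('k, 'm, 'x) module_scheme" and la :: "'a \<Rightarrow> 'm \<Rightarrow> 'm" +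
  assumes ra_closed: "\<lbrakk>v \<in> carrier V; a \<in> carrier A\<rbrakk> \<Longrightarrow> ra v a \<in> carrier V"
    and la_closed: "\<lbrakk>a \<in> carrier A; m \<in> carrier M\<rbrakk> \<Longrightarrow> la a m \<in> carrier M"
begin

abbreviation "BT \<equiv> bal_tens K A V ra M la"
abbreviation "bp \<equiv> bal_pt K A V ra M la"

lemma presentation_BT: "presentation K (carrier V \<times> carrier M) (bal_rels K A V ra M la)"
proof -
  interpret F: module K "free_module K (carrier V \<times> carrier M)"
    by (rule module_free_module) (rule V.R.is_cring)
  note g = free_gen_carrier[OF V.R.is_cring]
  show ?thesis
  proof (intro presentation.intro presentation_axioms.intro V.R.is_cring subsetI)
    fix r assume "r \<in> bal_rels K A V ra M la"
    then show "r \<in> carrier (free_module K (carrier V \<times> carrier M))"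
      unfolding bal_rels_def Let_def
      by (auto simp del: free_module_simps intro!: F.M.minus_closed F.smult_closed g
          simp: ra_closed la_closed)
  qed
qed

interpretation P: presentation K "carrier V \<times> carrier M" "bal_rels K A V ra M la"
  by (rule presentation_BT)

lemma module_BT: "module K BT"
  unfolding bal_tens_def by (rule P.module_P)

lemma bp_closed: "\<lbrakk>v \<in> carrier V; m \<in> carrier M\<rbrakk> \<Longrightarrow> bp v m \<in> carrier BT"
  unfolding bal_tens_def bal_pt_def by (rule P.cls_closed[OF P.gen_closed]) simp

lemma bp_linear1: "m \<in> carrier M \<Longrightarrow> linear_map K V BT (\<lambda>v. bp v m)"
proof (rule linear_mapI)
  fix v w assume *: "m \<in> carrier M" "v \<in> carrier V" "w \<in> carrier V"
  show "bp (v \<oplus>\<^bsub>V\<^esub> w) m = bp v m \<oplus>\<^bsub>BT\<^esub> bp w m"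
    unfolding bal_tens_def bal_pt_def
    by (rule P.cls_rel_add) (use * in \<open>simp_all, unfold bal_rels_def Let_def, blast\<close>)
next
  fix a v assume *: "m \<in> carrier M" "a \<in> carrier K" "v \<in> carrier V"
  show "bp (a \<odot>\<^bsub>V\<^esub> v) m = a \<odot>\<^bsub>BT\<^esub> bp v m"
    unfolding bal_tens_def bal_pt_def
    by (rule P.cls_rel_smult) (use * in \<open>simp_all del: free_module_simps, unfold bal_rels_def
        Let_def, blast\<close>)
qed (rule bp_closed)

lemma bp_linear2: "v \<in> carrier V \<Longrightarrow> linear_map K M BT (bp v)"
proof (rule linear_mapI)
  fix m m' assume *: "v \<in> carrier V" "m \<in> carrier M" "m' \<in> carrier M"
  show "bp v (m \<oplus>\<^bsub>M\<^esub> m') = bp v m \<oplus>\<^bsub>BT\<^esub> bp v m'"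
    unfolding bal_tens_def bal_pt_def
    by (rule P.cls_rel_add) (use * in \<open>simp_all, unfold bal_rels_def Let_def, blast\<close>)
next
  fix a m assume *: "v \<in> carrier V" "a \<in> carrier K" "m \<in> carrier M"
  show "bp v (a \<odot>\<^bsub>M\<^esub> m) = a \<odot>\<^bsub>BT\<^esub> bp v m"
    unfolding bal_tens_def bal_pt_def
    by (rule P.cls_rel_smult) (use * in \<open>simp_all del: free_module_simps, unfold bal_rels_def
        Let_def, blast\<close>)
qed (rule bp_closed)

lemma bp_balanced: "\<lbrakk>v \<in> carrier V; a \<in> carrier A; m \<in> carrier M\<rbrakk> \<Longrightarrow> bp (ra v a) m = bp v (la a m)"
  unfolding bal_pt_def
  by (rule P.cls_rel_eq)
    (simp_all add: ra_closed la_closed del: free_module_simps, unfold bal_rels_def Let_def, blast)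

lemma BT_linear_map_lift:
  assumes "module K U" "module K W" "linear_map K U W h"
    "\<And>v m. \<lbrakk>v \<in> carrier V; m \<in> carrier M\<rbrakk> \<Longrightarrow> f v m \<in> carrier U" "t \<in> carrier BT"
  shows "h (lin_ext K U (\<lambda>(v, m). f v m) t) = lin_ext K W (\<lambda>(v, m). h (f v m)) t"
proof -
  have "h (lin_ext K U (\<lambda>(v, m). f v m) t) = lin_ext K W (\<lambda>g. h (case g of (v, m) \<Rightarrow> f v m)) t"
    by (rule P.linear_map_lin_ext[OF assms(1-3)]) (use assms(4,5) in \<open>auto simp: bal_tens_def\<close>)
  then show ?thesis by (simp add: prod.case_distrib[of h] case_prod_unfold)
qed

lemma BT_lift_closed:
  assumes "module K W" "\<And>v m. \<lbrakk>v \<in> carrier V; m \<in> carrier M\<rbrakk> \<Longrightarrow> f v m \<in> carrier W" "t \<in> carrier BT"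
  shows "lin_ext K W (\<lambda>(v, m). f v m) t \<in> carrier W"
  by (rule presentation.lin_ext_closed[OF presentation_BT assms(1)])
    (use assms in \<open>auto simp: bal_tens_def\<close>)

lemma BT_lift_eqI:
  assumes "module K W" "linear_map K BT W h"
    "\<And>v m. \<lbrakk>v \<in> carrier V; m \<in> carrier M\<rbrakk> \<Longrightarrow> f v m = h (bp v m)" "t \<in> carrier BT"
  shows "lin_ext K W (\<lambda>(v, m). f v m) t = h t"
  by (rule P.lin_ext_eqI[OF assms(1)]) (use assms(2-4) in \<open>auto simp: bal_tens_def bal_pt_def\<close>)

lemma BT_eqI:
  assumes "module K W" "linear_map K BT W h" "linear_map K BT W h'"
    "\<And>v m. \<lbrakk>v \<in> carrier V; m \<in> carrier M\<rbrakk> \<Longrightarrow> h (bp v m) = h' (bp v m)" "t \<in> carrier BT"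
  shows "h t = h' t"
  by (rule P.linear_map_eqI[OF assms(1)]) (use assms(2-5) in \<open>auto simp: bal_tens_def bal_pt_def\<close>)

lemma
  assumes "module K W"
    and 1: "\<And>m. m \<in> carrier M \<Longrightarrow> linear_map K V W (\<lambda>v. f v m)"
    and 2: "\<And>v. v \<in> carrier V \<Longrightarrow> linear_map K M W (f v)"
    and 3: "\<And>v a m. \<lbrakk>v \<in> carrier V; a \<in> carrier A; m \<in> carrier M\<rbrakk> \<Longrightarrow> f (ra v a) m = f v (la a m)"
  shows BT_lift_linear: "linear_map K BT W (lin_ext K W (\<lambda>(v, m). f v m))"
    and BT_lift_bp: "\<lbrakk>v \<in> carrier V; m \<in> carrier M\<rbrakk> \<Longrightarrow> lin_ext K W (\<lambda>(v, m). f v m) (bp v m) = f v m"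
proof -
  interpret W: module K W by fact
  let ?G = "carrier V \<times> carrier M"
  let ?f = "\<lambda>(v, m). f v m"
  note g = P.gen_closed
  have fG: "?f \<in> ?G \<rightarrow> carrier W" using linear_map_closed[OF 2] by auto
  note lin = lin_comb_linear[OF assms(1) fG]
  note ev = linear_map_diff[OF P.F.module_axioms assms(1) lin] linear_map_smult[OF lin]
    lin_comb_gen[OF assms(1) fG]
  have a: "x \<oplus>\<^bsub>W\<^esub> y \<ominus>\<^bsub>W\<^esub> x \<ominus>\<^bsub>W\<^esub> y = \<zero>\<^bsub>W\<^esub>" if "x \<in> carrier W" "y \<in> carrier W" for x y
    using that by (simp add: a_minus_def W.M.a_assoc W.M.a_comm[of x y] W.M.r_neg W.M.r_neg1)
  have b: "x \<ominus>\<^bsub>W\<^esub> x = \<zero>\<^bsub>W\<^esub>" if "x \<in> carrier W" for x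
    using that by (simp add: a_minus_def W.M.r_neg)
  note cl = linear_map_closed[OF 1] linear_map_closed[OF 2]
  \<comment> \<open>The two families of additivity relations vanish by \<open>a\<close>; the
    homogeneity and balancing relations vanish by \<open>b\<close>.\<close>
  have R: "lin_comb K W ?f r = \<zero>\<^bsub>W\<^esub>" if "r \<in> bal_rels K A V ra M la" for r
    using that unfolding bal_rels_def Let_def
    apply (elim UnE CollectE exE conjE)
        apply (simp_all only: ev g P.F.M.minus_closed P.F.smult_closed prod.case cl a b
          linear_map_add[OF 1] linear_map_add[OF 2] linear_map_smult[OF 1] linear_map_smult[OF 2] 3
          mem_Times_iff fst_conv snd_conv V.M.a_closed M.M.a_closed V.smult_closed M.smult_closed
          W.smult_closed ra_closed la_closed simp_thms)
    done
  show "linear_map K BT W (lin_ext K W ?f)"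
    unfolding bal_tens_def by (rule P.lin_ext_linear[OF assms(1) fG R])
  show "lin_ext K W ?f (bp v m) = f v m" if "v \<in> carrier V" "m \<in> carrier M"
    using P.lin_ext_gen[OF assms(1) fG R, of "(v, m)"] that by (simp add: bal_pt_def)
qed

end

lemma nth_Cons_1 [simp]: "(x # xs) ! 1 = xs ! 0"
  by (simp add: One_nat_def)

lemma drop_1_Cons [simp]: "drop 1 (x # xs) = xs"
  by (simp add: One_nat_def)

lemma length_eq_1: "length xs = 1 \<longleftrightarrow> (\<exists>x. xs = [x])"
  by (auto simp: One_nat_def length_Suc_conv)

lemma length_eq_2: "length xs = 2 \<longleftrightarrow> (\<exists>x y. xs = [x, y])"
  by (auto simp: numeral_2_eq_2 length_Suc_conv)

lemma upt_0_1 [simp]: "[0..<1] = [0]"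
  by (simp add: One_nat_def)

text \<open>Fixes the normal form of indices from here on: \<open>1\<close> for \<open>Suc 0\<close>
  and \<open>Suc n\<close> for \<open>n + 1\<close>, so that the indices of the definitions meet
  those of recursive lemmas.\<close>

declare One_nat_def[symmetric, simp] Suc_eq_plus1[symmetric, simp] Suc_eq_plus1_left[symmetric,
    simp]

context tensor
begin

text \<open>Linearity in the first, second and third slot for lists written with \<open>#\<close>,
  where the pattern \<open>us @ v # ws\<close> does not match directly.\<close>

lemma pt_linear1:
  "\<lbrakk>module K M; m \<in> carrier M; set ws \<subseteq> carrier V; n = Suc (length ws)\<rbrakk> \<Longrightarrow>
    linear_map K V (T n M) (\<lambda>v. \<tau> M (v # ws) m)"
  using pt_slot_linear[of M m "[]" ws n] by simp

lemma pt_linear2: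
  "\<lbrakk>module K M; m \<in> carrier M; u \<in> carrier V; set ws \<subseteq> carrier V; n = Suc (Suc (length ws))\<rbrakk> \<Longrightarrow>
    linear_map K V (T n M) (\<lambda>v. \<tau> M (u # v # ws) m)"
  using pt_slot_linear[of M m "[u]" ws n] by simp

lemma pt_linear3:
  "\<lbrakk>module K M; m \<in> carrier M; u \<in> carrier V; u' \<in> carrier V; set ws \<subseteq> carrier V;
    n = Suc (Suc (Suc (length ws)))\<rbrakk> \<Longrightarrow> linear_map K V (T n M) (\<lambda>v. \<tau> M (u # u' # v # ws) m)"
  using pt_slot_linear[of M m "[u, u']" ws n] by simp

lemma lift_add:
  assumes "module K M" "module K W"
    "\<And>vs m. \<lbrakk>length vs = n; set vs \<subseteq> carrier V; m \<in> carrier M\<rbrakk> \<Longrightarrow> f vs m \<in> carrier W"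
    "\<And>vs m. \<lbrakk>length vs = n; set vs \<subseteq> carrier V; m \<in> carrier M\<rbrakk> \<Longrightarrow> g vs m \<in> carrier W"
    "t \<in> carrier (T n M)"
  shows "lift W (\<lambda>vs m. f vs m \<oplus>\<^bsub>W\<^esub> g vs m) t = lift W f t \<oplus>\<^bsub>W\<^esub> lift W g t"
proof -
  interpret presentation K "tens_gens V n M" "tens_rels K V n M"
      by (rule presentation_T[OF assms(1)])
  have "lin_ext K W (\<lambda>z. (case z of (vs, m) \<Rightarrow> f vs m) \<oplus>\<^bsub>W\<^esub> (case z of (vs, m) \<Rightarrow> g vs m)) t =
    lift W f t \<oplus>\<^bsub>W\<^esub> lift W g t"
    by (rule lin_ext_add) (use assms(2-5) in \<open>auto simp: tens_gen tens_def\<close>)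
  then show ?thesis by (simp add: case_prod_unfold)
qed

lemma sw2_add:
  assumes "module K M" "module K W"
    "\<And>v m. \<lbrakk>v \<in> carrier V; m \<in> carrier M\<rbrakk> \<Longrightarrow> f v m \<in> carrier W"
    "\<And>v m. \<lbrakk>v \<in> carrier V; m \<in> carrier M\<rbrakk> \<Longrightarrow> g v m \<in> carrier W"
    "t \<in> carrier (T 1 M)"
  shows "sw2 K W t (\<lambda>v m. f v m \<oplus>\<^bsub>W\<^esub> g v m) = sw2 K W t f \<oplus>\<^bsub>W\<^esub> sw2 K W t g"
  unfolding sw2_def by (rule lift_add) (use assms in \<open>auto simp: length_eq_1\<close>)

lemma sw2_minus:
  assumes "module K M" "module K W"
    "\<And>v m. \<lbrakk>v \<in> carrier V; m \<in> carrier M\<rbrakk> \<Longrightarrow> f v m \<in> carrier W"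
    "\<And>v m. \<lbrakk>v \<in> carrier V; m \<in> carrier M\<rbrakk> \<Longrightarrow> g v m \<in> carrier W"
    "t \<in> carrier (T 1 M)"
  shows "sw2 K W t (\<lambda>v m. f v m \<ominus>\<^bsub>W\<^esub> g v m) = sw2 K W t f \<ominus>\<^bsub>W\<^esub> sw2 K W t g"
proof -
  interpret W: module K W by fact
  have "sw2 K W t (\<lambda>v m. \<ominus>\<^bsub>W\<^esub> g v m) = \<ominus>\<^bsub>W\<^esub> sw2 K W t g"
    by (rule linear_map_sw2[OF assms(1,2,2) linear_map_uminus[OF assms(2,2) linear_map_id]
        assms(4,5), symmetric])
  then show ?thesis unfolding a_minus_def by (subst sw2_add) (use assms in auto)
qed

lemmas pt_linears = pt_linear1 pt_linear2 pt_linear3 pt_last_linear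

end

section \<open>The cobar complex\<close>

locale grouplike_coalgebra = tensor K C for K :: "'k ring" and C :: "('k, 'c) coalg" +
  fixes \<II> :: 'c
  assumes coalg: "coalgebra K C" and grouplike: "grouplike K C \<II>"
begin

lemma comult_linear: "linear_map K C (T 1 C) (comult C)"
  by (rule coalgebra.comult_linear[OF coalg])

lemmas comult_closed [simp] = linear_map_closed[OF comult_linear]

lemma II_closed [simp]: "\<II> \<in> carrier C" and comult_II: "comult C \<II> = \<tau> C [\<II>] \<II>"
  using grouplike by (auto simp: grouplike_def)

lemmas sw2_comult_closed = sw2_closed[OF module_axioms _ _ comult_closed]
lemmas sw2_comult_cong = sw2_cong[OF module_axioms _ _ _ comult_closed]
lemmas linear_map_sw2_comult = linear_map_sw2[OF module_axioms _ _ _ _ comult_closed]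
lemmas sw2_comult_param_linear = sw2_param_linear[OF module_axioms _ _ _ comult_closed]

lemma sw2_comult_linear:
  assumes "module K W" "\<And>y. y \<in> carrier C \<Longrightarrow> linear_map K C W (\<lambda>x. g x y)"
    "\<And>x. x \<in> carrier C \<Longrightarrow> linear_map K C W (g x)"
  shows "linear_map K C W (\<lambda>c. sw2 K W (comult C c) g)"
  by (rule linear_map_comp[OF comult_linear sw2_linear]) (simp_all add: assms module_axioms)

text \<open>The coassociativity axiom is one identity in \<open>T 2 C\<close>. Applying the linear
  map induced by the trilinear g turns it into an identity for g.\<close>

lemma coassoc:
  assumes "module K W" "c \<in> carrier C"
    and 1: "\<And>y z. \<lbrakk>y \<in> carrier C; z \<in> carrier C\<rbrakk> \<Longrightarrow> linear_map K C W (\<lambda>x. g x y z)"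
    and 2: "\<And>x z. \<lbrakk>x \<in> carrier C; z \<in> carrier C\<rbrakk> \<Longrightarrow> linear_map K C W (\<lambda>y. g x y z)"
    and 3: "\<And>x y. \<lbrakk>x \<in> carrier C; y \<in> carrier C\<rbrakk> \<Longrightarrow> linear_map K C W (g x y)"
  shows "sw2 K W (comult C c) (\<lambda>x y. sw2 K W (comult C x) (\<lambda>x1 x2. g x1 x2 y)) =
    sw2 K W (comult C c) (\<lambda>x y. sw2 K W (comult C y) (\<lambda>y1 y2. g x y1 y2))"
proof -
  let ?h = "lift W (\<lambda>vs. g (vs ! 0) (vs ! 1))"
  have m: "multilinear K C 2 C W (\<lambda>vs. g (vs ! 0) (vs ! 1))"
    by (rule multilinear_2I) (simp_all add: 1 2 3)
  note h = lift_linear[OF module_axioms assms(1) m]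
  have h_pt: "?h (\<tau> C [x, y] z) = g x y z" if "x \<in> carrier C" "y \<in> carrier C" "z \<in> carrier C"
      for x y z
    using that by (subst lift_pt[OF module_axioms assms(1) m]) simp_all
  note [simp] = module_axioms
  have g: "g x y z \<in> carrier W" if "x \<in> carrier C" "y \<in> carrier C" "z \<in> carrier C" for x y z
    using linear_map_closed[OF 3[OF that(1,2)] that(3)] .
  have h1: "?h (sw2 K (T 2 C) (comult C x) (\<lambda>x1 x2. \<tau> C [x1, x2] y)) =
      sw2 K W (comult C x) (\<lambda>x1 x2. g x1 x2 y)" if "x \<in> carrier C" "y \<in> carrier C" for x y
    using that assms(1)
    by (subst linear_map_sw2_comult[OF _ assms(1) h]) (auto intro!: sw2_comult_cong simp: h_pt g)
  have h2: "?h (sw2 K (T 2 C) (comult C y) (\<lambda>y1 y2. \<tau> C [x, y1] y2)) =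
      sw2 K W (comult C y) (\<lambda>y1 y2. g x y1 y2)" if "x \<in> carrier C" "y \<in> carrier C" for x y
    using that assms(1)
    by (subst linear_map_sw2_comult[OF _ assms(1) h]) (auto intro!: sw2_comult_cong simp: h_pt g)
  have "sw2 K W (comult C c) (\<lambda>x y. sw2 K W (comult C x) (\<lambda>x1 x2. g x1 x2 y)) =
    sw2 K W (comult C c) (\<lambda>x y. ?h (sw2 K (T 2 C) (comult C x) (\<lambda>x1 x2. \<tau> C [x1, x2] y)))"
    using assms(1,2) by (intro sw2_comult_cong) (auto simp: h1 g intro!: sw2_comult_closed)
  also have "\<dots> = ?h (sw2 K (T 2 C) (comult C c)
      (\<lambda>x y. sw2 K (T 2 C) (comult C x) (\<lambda>x1 x2. \<tau> C [x1, x2] y)))"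
    using assms(1,2) by (intro linear_map_sw2_comult[OF _ assms(1) h, symmetric]) (auto intro!:
        sw2_comult_closed)
  also have "\<dots> = ?h (sw2 K (T 2 C) (comult C c)
      (\<lambda>x y. sw2 K (T 2 C) (comult C y) (\<lambda>y1 y2. \<tau> C [x, y1] y2)))"
    by (simp only: coalgebra.coassoc[OF coalg assms(2)])
  also have "\<dots> = sw2 K W (comult C c)
      (\<lambda>x y. ?h (sw2 K (T 2 C) (comult C y) (\<lambda>y1 y2. \<tau> C [x, y1] y2)))"
    using assms(1,2) by (intro linear_map_sw2_comult[OF _ assms(1) h]) (auto intro!:
        sw2_comult_closed)
  also have "\<dots> = sw2 K W (comult C c) (\<lambda>x y. sw2 K W (comult C y) (\<lambda>y1 y2. g x y1 y2))"
    using assms(1,2) by (intro sw2_comult_cong) (auto simp: h2 g intro!: sw2_comult_closed)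
  finally show ?thesis .
qed

text \<open>
  The recursion \<open>d (c \<otimes> t) = \<Delta> c \<otimes> t - c \<otimes> d t\<close> reduces \<open>d\<^sup>2 = 0\<close> to coassociativity; the
  alternating sum that occurs in the calculus is recovered in \<open>cob_sum\<close>.
\<close>

primrec cob ::
  "('k, 'm, 'y) module_scheme \<Rightarrow> ('m \<Rightarrow> ('c list \<times> 'm \<Rightarrow> 'k) set) \<Rightarrow> 'c list \<Rightarrow> 'm
    \<Rightarrow> ('c list \<times> 'm \<Rightarrow> 'k) set" where
  "cob M \<rho> [] m = \<rho> m"
| "cob M \<rho> (c # cs) m =
    sw2 K (T (Suc (Suc (length cs))) M) (comult C c) (\<lambda>x y. \<tau> M (x # y # cs) m)
      \<ominus>\<^bsub>T (Suc (Suc (length cs))) M\<^esub> pre M (Suc (Suc (length cs))) [c] (cob M \<rho> cs m)"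

definition cobar where "cobar M \<rho> n = lift (T (Suc n) M) (cob M \<rho>)"

text \<open>The differential of the calculus is this map with M = B; across \<open>\<Phi>\<close>
  the extension of a connection is this map as well.\<close>

definition aug_cobar where
  "aug_cobar M \<rho> n t = cobar M \<rho> n t \<ominus>\<^bsub>T (Suc n) M\<^esub> pre M (Suc n) [\<II>] t"

text \<open>The last clause of \<open>left_comodule\<close>, isolated because it is the counterpart
  of flatness.\<close>

definition coassociative where
  "coassociative M \<rho> \<longleftrightarrow>
    (\<forall>x\<in>carrier M.
       sw2 K (T 2 M) (\<rho> x) (\<lambda>c y. sw2 K (T 2 M) (comult C c) (\<lambda>c1 c2. \<tau> M [c1, c2] y)) =
       sw2 K (T 2 M) (\<rho> x) (\<lambda>c y. sw2 K (T 2 M) (\<rho> y) (\<lambda>c' z. \<tau> M [c, c'] z)))"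

text \<open>Only linearity of \<rho> is assumed, so that the results cover \<open>dunit\<close> and
  also a coaction whose coassociativity is yet to be derived.\<close>

context
  fixes M :: "('k, 'm, 'y) module_scheme" and \<rho>
  assumes M [simp]: "module K M" and \<rho>: "linear_map K M (T 1 M) \<rho>"
begin

interpretation TM: module K "T n M" for n by simp

lemmas \<rho>_closed [simp] = linear_map_closed[OF \<rho>]

lemma comult_slot_multilinear:
  assumes "c \<in> carrier C"
  shows "multilinear K C n M (T (Suc (Suc n)) M) (\<lambda>cs m. sw2 K (T (Suc (Suc n)) M) (comult C c)
      (\<lambda>x y. \<tau> M (x # y # cs) m))"
proof (rule multilinearI)
  fix us ws m assume *: "m \<in> carrier M" "set us \<subseteq> carrier C" "set ws \<subseteq> carrier C"
    "Suc (length us + length ws) = n"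
  show "linear_map K C (T (Suc (Suc n)) M) (\<lambda>v. sw2 K (T (Suc (Suc n)) M) (comult C c)
      (\<lambda>x y. \<tau> M (x # y # us @ v # ws) m))"
    by (rule sw2_comult_param_linear)
      (use assms * in \<open>auto simp: module_axioms intro!: pt_slot_linear[of M m
          "_ # _ # us" ws, simplified]\<close>)
next
  fix vs assume *: "length vs = n" "set vs \<subseteq> carrier C"
  show "linear_map K M (T (Suc (Suc n)) M) (\<lambda>m. sw2 K (T (Suc (Suc n)) M) (comult C c)
      (\<lambda>x y. \<tau> M (x # y # vs) m))"
    by (rule sw2_comult_param_linear)
      (use assms * in \<open>auto simp: module_axioms intro!: pt_last_linear\<close>)
qed

lemma cob_closed: 
  "\<lbrakk>length cs = n; set cs \<subseteq> carrier C; m \<in> carrier M\<rbrakk> \<Longrightarrow> cob M \<rho> cs m \<in> carrier (T (Suc n) M)"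
proof (induction cs arbitrary: n)
  case (Cons c cs)
  have "sw2 K (T (Suc (Suc (length cs))) M) (comult C c) (\<lambda>x y. \<tau> M (x # y # cs) m)
      \<in> carrier (T (Suc (Suc (length cs))) M)"
    using Cons.prems by (intro sw2_comult_closed) (auto simp: module_axioms)
  moreover have "pre M (Suc (Suc (length cs))) [c] (cob M \<rho> cs m)
      \<in> carrier (T (Suc (Suc (length cs))) M)"
    using Cons by (intro pre_closed[where n = "Suc (length cs)"]) auto
  ultimately have "cob M \<rho> (c # cs) m \<in> carrier (T (Suc (Suc (length cs))) M)"
    by (simp only: cob.simps TM.M.minus_closed)
  then show ?case using Cons.prems by auto
qed simp

lemma cob_multilinear: "multilinear K C n M (T (Suc n) M) (cob M \<rho>)"
proof (induction n)
  case 0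
  then show ?case using \<rho> by (intro multilinear_0I) simp
next
  case (Suc n)
  show ?case
  proof (rule multilinear_SucI)
    fix cs m assume *: "length cs = n" "set cs \<subseteq> carrier C" "m \<in> carrier M"
    have "linear_map K C (T (Suc (Suc n)) M) (\<lambda>c. sw2 K (T (Suc (Suc n)) M) (comult C c)
        (\<lambda>x y. \<tau> M (x # y # cs) m))"
      using * by (intro sw2_comult_linear)
        (auto intro!: pt_linears)
    moreover have "linear_map K C (T (Suc (Suc n)) M) (\<lambda>c. pre M (Suc (Suc n)) [c] (cob M \<rho> cs m))"
      using * cob_closed[OF *] by (intro pre_slot_linear[of M "[]" "[]", simplified]) auto
    ultimately show "linear_map K C (T (Suc (Suc n)) M) (\<lambda>c. cob M \<rho> (c # cs) m)"
      using * by (auto intro!: linear_map_minus module_axioms)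
  next
    fix c assume c: "c \<in> carrier C"
    have "multilinear K C n M (T (Suc (Suc n)) M) (\<lambda>cs m. pre M (Suc (Suc n)) [c] (cob M \<rho> cs m))"
      by (rule multilinear_comp[OF Suc]) (use c in \<open>auto intro!: pre_linear\<close>)
    from multilinear_minus[OF module_axioms M _ comult_slot_multilinear[OF c] this]
    have "multilinear K C n M (T (Suc (Suc n)) M) (\<lambda>cs m. sw2 K (T (Suc (Suc n)) M) (comult C c)
        (\<lambda>x y. \<tau> M (x # y # cs) m)
      \<ominus>\<^bsub>T (Suc (Suc n)) M\<^esub> pre M (Suc (Suc n)) [c] (cob M \<rho> cs m))" by simp
    then show "multilinear K C n M (T (Suc (Suc n)) M) (\<lambda>cs. cob M \<rho> (c # cs))"
      by (subst multilinear_cong[OF module_axioms M]) auto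
  qed
qed

lemma cobar_linear: "linear_map K (T n M) (T (Suc n) M) (cobar M \<rho> n)"
  unfolding cobar_def by (rule lift_linear[OF M _ cob_multilinear]) simp

lemma cobar_closed: "t \<in> carrier (T n M) \<Longrightarrow> cobar M \<rho> n t \<in> carrier (T (Suc n) M)"
  using linear_map_closed[OF cobar_linear] .

lemma cobar_pt:
  "\<lbrakk>length cs = n; set cs \<subseteq> carrier C; m \<in> carrier M\<rbrakk> \<Longrightarrow> cobar M \<rho> n (\<tau> M cs m) = cob M \<rho> cs m"
  unfolding cobar_def by (rule lift_pt[OF M _ cob_multilinear]) simp_all

text \<open>Carries the recursion of \<open>cob\<close> from pure tensors to an arbitrary t, in
  particular to t = \<open>cob M \<rho> cs m\<close> in the proof that the square vanishes.\<close>

lemma cobar_pre: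
  assumes c: "c \<in> carrier C" and t: "t \<in> carrier (T n M)"
  shows "cobar M \<rho> (Suc n) (pre M (Suc n) [c] t) =
    sw2 K (T (Suc (Suc n)) M) (comult C c) (\<lambda>x y. pre M (Suc (Suc n)) [x, y] t)
      \<ominus>\<^bsub>T (Suc (Suc n)) M\<^esub> pre M (Suc (Suc n)) [c] (cobar M \<rho> n t)"
proof (rule tens_eqI[OF M _ _ _ _ t])
  show "linear_map K (T n M) (T (Suc (Suc n)) M) (\<lambda>t. cobar M \<rho> (Suc n) (pre M (Suc n) [c] t))"
    using cobar_linear[of "Suc n"] c
    by (intro linear_map_comp[OF pre_linear]) auto
  show "linear_map K (T n M) (T (Suc (Suc n)) M) (\<lambda>t. sw2 K (T (Suc (Suc n)) M) (comult C c)
      (\<lambda>x y. pre M (Suc (Suc n)) [x, y] t)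
      \<ominus>\<^bsub>T (Suc (Suc n)) M\<^esub> pre M (Suc (Suc n)) [c] (cobar M \<rho> n t))"
    using c by (intro linear_map_minus sw2_comult_param_linear linear_map_comp[OF cobar_linear]
       pre_linear) (auto simp: module_axioms)
  fix cs m assume *: "length cs = n" "set cs \<subseteq> carrier C" "m \<in> carrier M"
  have "sw2 K (T (Suc (Suc n)) M) (comult C c) (\<lambda>x y. \<tau> M (x # y # cs) m) =
    sw2 K (T (Suc (Suc n)) M) (comult C c) (\<lambda>x y. pre M (Suc (Suc n)) [x, y] (\<tau> M cs m))"
    using c * by (intro sw2_comult_cong) (auto simp: pre_pt module_axioms)
  then show "cobar M \<rho> (Suc n) (pre M (Suc n) [c] (\<tau> M cs m)) =
    sw2 K (T (Suc (Suc n)) M) (comult C c) (\<lambda>x y. pre M (Suc (Suc n)) [x, y] (\<tau> M cs m))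
      \<ominus>\<^bsub>T (Suc (Suc n)) M\<^esub> pre M (Suc (Suc n)) [c] (cobar M \<rho> n (\<tau> M cs m))"
    using c * cobar_pt[of "c # cs"] by (simp add: pre_pt cobar_pt)
qed simp

lemma cobar_1:
  assumes t: "t \<in> carrier (T 1 M)"
  shows "cobar M \<rho> 1 t =
    sw2 K (T 2 M) t (\<lambda>c y. sw2 K (T 2 M) (comult C c) (\<lambda>c1 c2. \<tau> M [c1, c2] y))
      \<ominus>\<^bsub>T 2 M\<^esub> sw2 K (T 2 M) t (\<lambda>c y. sw2 K (T 2 M) (\<rho> y) (\<lambda>c' z. \<tau> M [c, c'] z))"
proof (rule tens_eqI[OF M _ _ _ _ t])
  show "linear_map K (T 1 M) (T 2 M) (cobar M \<rho> 1)" using cobar_linear[of 1] by simp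
  \<comment> \<open>Brings the coaction term into the form in which the recursion of
    \<open>cob\<close> produces it.\<close>
  have e: "sw2 K (T 2 M) (\<rho> y) (\<lambda>c' z. \<tau> M [c, c'] z) = pre M 2 [c] (\<rho> y)"
    if "c \<in> carrier C" "y \<in> carrier M" for c y
    using sw2_eq_pre[OF M, of "[c]" 2 "\<rho> y"] that by simp
  have 1: "linear_map K C (T 2 M) (\<lambda>c. sw2 K (T 2 M) (comult C c) (\<lambda>c1 c2. \<tau> M [c1, c2] y))"
    if "y \<in> carrier M" for y
    using that by (intro sw2_comult_linear)
      (auto intro!: pt_linears)
  have 2: "linear_map K M (T 2 M) (\<lambda>y. sw2 K (T 2 M) (comult C c) (\<lambda>c1 c2. \<tau> M [c1, c2] y))"
    if "c \<in> carrier C" for c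
    using that by (intro sw2_comult_param_linear) (auto simp: module_axioms intro!: pt_last_linear)
  have 3: "linear_map K C (T 2 M) (\<lambda>c. sw2 K (T 2 M) (\<rho> y) (\<lambda>c' z. \<tau> M [c, c'] z))"
    if "y \<in> carrier M" for y
    using that by (intro sw2_param_linear[where M = M])
      (auto simp: module_axioms intro!: pt_linears)
  have 4: "linear_map K M (T 2 M) (\<lambda>y. sw2 K (T 2 M) (\<rho> y) (\<lambda>c' z. \<tau> M [c, c'] z))"
    if "c \<in> carrier C" for c
    using that
    by (intro linear_map_comp[OF \<rho> sw2_linear])
      (auto intro!: pt_linears pt_last_linear)
  show "linear_map K (T 1 M) (T 2 M) (\<lambda>t. 
      sw2 K (T 2 M) t (\<lambda>c y. sw2 K (T 2 M) (comult C c) (\<lambda>c1 c2. \<tau> M [c1, c2] y))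
      \<ominus>\<^bsub>T 2 M\<^esub> sw2 K (T 2 M) t (\<lambda>c y. sw2 K (T 2 M) (\<rho> y) (\<lambda>c' z. \<tau> M [c, c'] z)))"
    by (intro linear_map_minus sw2_linear 1 2 3 4) simp_all
  fix cs m assume *: "length cs = 1" "set cs \<subseteq> carrier C" "m \<in> carrier M"
  then obtain c where c: "cs = [c]" "c \<in> carrier C" by (auto simp: length_eq_1)
  have "cobar M \<rho> 1 (\<tau> M cs m) = cob M \<rho> [c] m" using * c by (simp add: cobar_pt)
  also have "\<dots> = sw2 K (T 2 M) (comult C c) (\<lambda>c1 c2. \<tau> M [c1, c2] m)
      \<ominus>\<^bsub>T 2 M\<^esub> sw2 K (T 2 M) (\<rho> m) (\<lambda>c' z. \<tau> M [c, c'] z)"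
    using c * by (simp add: e)
  also have "\<dots> = sw2 K (T 2 M) (\<tau> M cs m) (\<lambda>c y. sw2 K (T 2 M) (comult C c)
      (\<lambda>c1 c2. \<tau> M [c1, c2] y))
      \<ominus>\<^bsub>T 2 M\<^esub> sw2 K (T 2 M) (\<tau> M cs m) (\<lambda>c y. sw2 K (T 2 M) (\<rho> y) (\<lambda>c' z. \<tau> M [c, c'] z))"
    using c * by (simp add: sw2_pt 1 2 3 4)
  finally show "cobar M \<rho> 1 (\<tau> M cs m) = \<dots>" .
qed simp

text \<open>In degree one the cobar differential is the difference of the two sides of
  coassociativity, and \<rho> is the differential of degree zero. So coassociativity is the
  vanishing of the square in degree zero.\<close>

lemma coassociative_iff:
  "coassociative M \<rho> \<longleftrightarrow> (\<forall>x\<in>carrier M. cobar M \<rho> 1 (\<rho> x) = \<zero>\<^bsub>T 2 M\<^esub>)"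
proof -
  have "sw2 K (T 2 M) (\<rho> x) (\<lambda>c y. sw2 K (T 2 M) (comult C c) (\<lambda>c1 c2. \<tau> M [c1, c2] y))
      \<in> carrier (T 2 M)"
    "sw2 K (T 2 M) (\<rho> x) (\<lambda>c y. sw2 K (T 2 M) (\<rho> y) (\<lambda>c' z. \<tau> M [c, c'] z)) \<in> carrier (T 2 M)"
    if "x \<in> carrier M" for x
    using that by (auto intro!: sw2_closed[OF M] sw2_comult_closed simp: module_axioms)
  then show ?thesis
    by (auto simp: coassociative_def cobar_1 abelian_group_minus_eq_zero_iff[OF
        TM.M.abelian_group_axioms])
qed

text \<open>Induction on the list, with \<open>coassociative_iff\<close> as base. Put t = d(cs
  \<otimes> m), so that d(c \<otimes> cs \<otimes> m) = \<Delta> c \<otimes> cs \<otimes> m - c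
  \<otimes> t. The differential of either term is \<Delta> c \<otimes> t: for the first by
  coassociativity of C, for the second because d t = 0.\<close>

lemma cobar_cobar:
  assumes "coassociative M \<rho>" "t \<in> carrier (T n M)"
  shows "cobar M \<rho> (Suc n) (cobar M \<rho> n t) = \<zero>\<^bsub>T (Suc (Suc n)) M\<^esub>"
proof (rule tens_eqI[OF M _ _ linear_map_const_zero _ assms(2)])
  show "linear_map K (T n M) (T (Suc (Suc n)) M) (\<lambda>t. cobar M \<rho> (Suc n) (cobar M \<rho> n t))"
    using linear_map_comp[OF cobar_linear[of n] cobar_linear[of "Suc n"]]
    by simp
  have "cobar M \<rho> (Suc n) (cob M \<rho> cs m) = \<zero>\<^bsub>T (Suc (Suc n)) M\<^esub>"
    if "length cs = n" "set cs \<subseteq> carrier C" "m \<in> carrier M" for cs m n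
    using that
  proof (induction cs arbitrary: n)
    case Nil
    then show ?case using assms(1) coassociative_iff by simp
  next
    case (Cons c cs)
    define l where "l = length cs"
    have cs: "c \<in> carrier C" "length cs = l" "set cs \<subseteq> carrier C" "m \<in> carrier M"
      using Cons.prems by (auto simp: l_def)
    define t where "t = cob M \<rho> cs m"
    have t: "t \<in> carrier (T (Suc l) M)" unfolding t_def by (rule cob_closed) (use cs in auto)
    let ?W = "T (Suc (Suc (Suc l))) M" and ?V = "T (Suc (Suc l)) M"
    let ?p = "pre M (Suc (Suc (Suc l)))" and ?q = "pre M (Suc (Suc l))"
        and ?d = "cobar M \<rho> (Suc (Suc l))"
    let ?S = "\<lambda>g. sw2 K ?W (comult C c) g"
    note [simp] = module_axioms
    have lin: "linear_map K ?V ?W ?d"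
      using cobar_linear[of "Suc (Suc l)"] by simp
    have trilin: "linear_map K C ?W (\<lambda>x. \<tau> M (x # y # z # cs) m)"
      "linear_map K C ?W (\<lambda>y. \<tau> M (x # y # z # cs) m)"
      "linear_map K C ?W (\<lambda>z. \<tau> M (x # y # z # cs) m)"
      if "x \<in> carrier C" "y \<in> carrier C" "z \<in> carrier C" for x y z
      using that cs pt_slot_linear[of M m "[]" "y # z # cs"] pt_slot_linear[of M m "[x]" "z # cs"]
        pt_slot_linear[of M m "[x, y]" cs] by auto
    have sl: "sw2 K ?W (comult C y) (\<lambda>y1 y2. \<tau> M (x # y1 # y2 # cs) m) \<in> carrier ?W"
      "sw2 K ?W (comult C y) (\<lambda>y1 y2. \<tau> M (y1 # y2 # x # cs) m) \<in> carrier ?W"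
      "sw2 K ?V (comult C y) (\<lambda>y1 y2. \<tau> M (y1 # y2 # cs) m) \<in> carrier ?V"
      if "x \<in> carrier C" "y \<in> carrier C" for x y
      using that cs by (auto intro!: sw2_comult_closed)
    \<comment> \<open>Two steps of the recursion; the sign of the last term is positive because it
      passes two factors.\<close>
    have A: "?d (\<tau> M (x # y # cs) m) =
        sw2 K ?W (comult C x) (\<lambda>x1 x2. \<tau> M (x1 # x2 # y # cs) m)
        \<ominus>\<^bsub>?W\<^esub> sw2 K ?W (comult C y) (\<lambda>y1 y2. \<tau> M (x # y1 # y2 # cs) m)
        \<oplus>\<^bsub>?W\<^esub> ?p [x, y] t"
      if xy: "x \<in> carrier C" "y \<in> carrier C" for x y
    proof -
      have p: "?p [x] (sw2 K ?V (comult C y) (\<lambda>y1 y2. \<tau> M (y1 # y2 # cs) m)) =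
          sw2 K ?W (comult C y) (\<lambda>y1 y2. \<tau> M (x # y1 # y2 # cs) m)"
      proof -
        have "?p [x] (sw2 K ?V (comult C y) (\<lambda>y1 y2. \<tau> M (y1 # y2 # cs) m)) =
          sw2 K ?W (comult C y) (\<lambda>y1 y2. ?p [x] (\<tau> M (y1 # y2 # cs) m))"
          using xy cs by (intro linear_map_sw2_comult[OF _ _ pre_linear]) auto
        also have "\<dots> = sw2 K ?W (comult C y) (\<lambda>y1 y2. \<tau> M (x # y1 # y2 # cs) m)"
          using xy cs by (intro sw2_comult_cong) (simp_all add: pre_pt)
        finally show ?thesis .
      qed
      have q: "?p [x] (?q [y] t) = ?p [x, y] t"
        using xy t by (subst pre_pre[where n = "Suc l"]) auto
      have "?d (\<tau> M (x # y # cs) m) =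
        sw2 K ?W (comult C x) (\<lambda>x1 x2. \<tau> M (x1 # x2 # y # cs) m)
        \<ominus>\<^bsub>?W\<^esub> ?p [x] (sw2 K ?V (comult C y) (\<lambda>y1 y2. \<tau> M (y1 # y2 # cs) m)
          \<ominus>\<^bsub>?V\<^esub> ?q [y] t)"
        using xy cs by (subst cobar_pt) (auto simp: t_def)
      also have "\<dots> = sw2 K ?W (comult C x) (\<lambda>x1 x2. \<tau> M (x1 # x2 # y # cs) m)
        \<ominus>\<^bsub>?W\<^esub> (sw2 K ?W (comult C y) (\<lambda>y1 y2. \<tau> M (x # y1 # y2 # cs) m)
          \<ominus>\<^bsub>?W\<^esub> ?p [x, y] t)"
        using xy sl t
        by (subst linear_map_diff[OF _ _ pre_linear]) (auto simp: p q
            intro!: pre_closed[where n = "Suc l"])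
      also have "\<dots> = sw2 K ?W (comult C x) (\<lambda>x1 x2. \<tau> M (x1 # x2 # y # cs) m)
        \<ominus>\<^bsub>?W\<^esub> sw2 K ?W (comult C y) (\<lambda>y1 y2. \<tau> M (x # y1 # y2 # cs) m)
        \<oplus>\<^bsub>?W\<^esub> ?p [x, y] t"
      proof -
        have "?p [x, y] t \<in> carrier ?W"
          using xy t by (intro pre_closed[where n = "Suc l"]) auto
        then show ?thesis using xy sl
          by (simp add: a_minus_def TM.M.minus_add TM.M.a_assoc)
      qed
      finally show ?thesis .
    qed
    have pt2: "?p [x, y] t \<in> carrier ?W" if "x \<in> carrier C" "y \<in> carrier C" for x y
      using that t by (intro pre_closed[where n = "Suc l"]) auto
    have S1: "?S (\<lambda>x y. sw2 K ?W (comult C x) (\<lambda>x1 x2. \<tau> M (x1 # x2 # y # cs) m)) \<in> carrier ?W"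
      and S2: "?S (\<lambda>x y. ?p [x, y] t) \<in> carrier ?W"
      by (rule sw2_comult_closed; simp add: cs(1) sl(2) pt2)+
    have bil: "?S (\<lambda>x y. f x y \<ominus>\<^bsub>?W\<^esub> g x y \<oplus>\<^bsub>?W\<^esub> h x y) = ?S f \<ominus>\<^bsub>?W\<^esub> ?S g \<oplus>\<^bsub>?W\<^esub> ?S h" if 
      "\<And>x y. \<lbrakk>x \<in> carrier C; y \<in> carrier C\<rbrakk> \<Longrightarrow> f x y \<in> carrier ?W"
      "\<And>x y. \<lbrakk>x \<in> carrier C; y \<in> carrier C\<rbrakk> \<Longrightarrow> g x y \<in> carrier ?W"
      "\<And>x y. \<lbrakk>x \<in> carrier C; y \<in> carrier C\<rbrakk> \<Longrightarrow> h x y \<in> carrier ?W" for f g h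
    proof -
      have "?S (\<lambda>x y. f x y \<ominus>\<^bsub>?W\<^esub> g x y \<oplus>\<^bsub>?W\<^esub> h x y) =
        ?S (\<lambda>x y. f x y \<ominus>\<^bsub>?W\<^esub> g x y) \<oplus>\<^bsub>?W\<^esub> ?S h"
        using that cs(1) by (intro sw2_add[OF module_axioms]) simp_all
      also have "?S (\<lambda>x y. f x y \<ominus>\<^bsub>?W\<^esub> g x y) = ?S f \<ominus>\<^bsub>?W\<^esub> ?S g"
        using that cs(1) by (intro sw2_minus[OF module_axioms]) simp_all
      finally show ?thesis .
    qed
    have "?d (sw2 K ?V (comult C c) (\<lambda>x y. \<tau> M (x # y # cs) m)) =
      ?S (\<lambda>x y. ?d (\<tau> M (x # y # cs) m))"
      using cs by (intro linear_map_sw2_comult[OF _ _ lin]) auto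
    also have "\<dots> = ?S (\<lambda>x y. sw2 K ?W (comult C x) (\<lambda>x1 x2. \<tau> M (x1 # x2 # y # cs) m)
        \<ominus>\<^bsub>?W\<^esub> sw2 K ?W (comult C y) (\<lambda>y1 y2. \<tau> M (x # y1 # y2 # cs) m)
        \<oplus>\<^bsub>?W\<^esub> ?p [x, y] t)"
      using cs by (intro sw2_comult_cong A linear_map_closed[OF lin]) auto
    also have "\<dots> = ?S (\<lambda>x y. sw2 K ?W (comult C x) (\<lambda>x1 x2. \<tau> M (x1 # x2 # y # cs) m))
        \<ominus>\<^bsub>?W\<^esub> ?S (\<lambda>x y. sw2 K ?W (comult C y) (\<lambda>y1 y2. \<tau> M (x # y1 # y2 # cs) m))
        \<oplus>\<^bsub>?W\<^esub> ?S (\<lambda>x y. ?p [x, y] t)"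
      by (rule bil) (simp_all add: sl pt2)
    \<comment> \<open>Coassociativity of C identifies the two sums in which a factor of \<Delta> c
      is split again, so they cancel.\<close>
    also have "?S (\<lambda>x y. sw2 K ?W (comult C y) (\<lambda>y1 y2. \<tau> M (x # y1 # y2 # cs) m)) =
        ?S (\<lambda>x y. sw2 K ?W (comult C x) (\<lambda>x1 x2. \<tau> M (x1 # x2 # y # cs) m))"
      by (rule coassoc[symmetric, where g = "\<lambda>x y z. \<tau> M (x # y # z # cs) m"]) (auto
          simp: cs trilin)
    finally have 1: "?d (sw2 K ?V (comult C c) (\<lambda>x y. \<tau> M (x # y # cs) m)) =
      ?S (\<lambda>x y. ?p [x, y] t)"
      using S1 S2 by (simp add: a_minus_def TM.M.r_neg)
    have "cobar M \<rho> (Suc l) t = \<zero>\<^bsub>?V\<^esub>"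
      unfolding t_def by (rule Cons.IH) (use cs in auto)
    moreover have "?p [c] \<zero>\<^bsub>?V\<^esub> = \<zero>\<^bsub>?W\<^esub>"
      by (rule linear_map_zero[OF _ _ pre_linear[of M "[c]" _ "Suc (Suc l)"]]) (simp_all add: cs(1))
    \<comment> \<open>The other term of \<open>cobar_pre\<close> contains d t, which is zero by the
      induction hypothesis.\<close>
    ultimately have 2: "?d (?q [c] t) = ?S (\<lambda>x y. ?p [x, y] t)"
      using S2 by (simp add: cobar_pre[OF cs(1) t] a_minus_def)
    have "?d (cob M \<rho> (c # cs) m) = ?S (\<lambda>x y. ?p [x, y] t) \<ominus>\<^bsub>?W\<^esub>
        ?S (\<lambda>x y. ?p [x, y] t)"
      unfolding cob.simps cs(2) t_def[symmetric] using cs sl t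
      by (subst linear_map_diff[OF _ _ lin]) (auto simp: 1 2 intro!: pre_closed[where n = "Suc l"])
    also have "\<dots> = \<zero>\<^bsub>?W\<^esub>" using S2 by (simp add: a_minus_def TM.M.r_neg)
    moreover have "n = Suc l" using Cons.prems l_def by simp
    ultimately show ?case by simp
  qed
  then show "cobar M \<rho> (Suc n) (cobar M \<rho> n (\<tau> M cs m)) = \<zero>\<^bsub>T (Suc (Suc n)) M\<^esub>"
    if "length cs = n" "set cs \<subseteq> carrier C" "m \<in> carrier M" for cs m
    using that by (simp add: cobar_pt)
qed simp_all

section \<open>The cobar differential twisted by \<II>\<close>

lemma aug_cobar_linear: "linear_map K (T n M) (T (Suc n) M) (aug_cobar M \<rho> n)"
  unfolding aug_cobar_def using cobar_linear[of n]
  by (auto intro!: linear_map_minus[of K "T n M"] pre_linear)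

lemma aug_cobar_closed: "t \<in> carrier (T n M) \<Longrightarrow> aug_cobar M \<rho> n t \<in> carrier (T (Suc n) M)"
  using linear_map_closed[OF aug_cobar_linear] .

text \<open>As \<Delta> \<II> = \<II> \<otimes> \<II>, the recursion gives d(\<II> \<otimes> t) =
  \<II> \<otimes> \<II> \<otimes> t - \<II> \<otimes> d t. Both terms return with the opposite sign
  from the outer multiplication by \<II>, which leaves d(d t).\<close>

lemma aug_cobar_aug_cobar:
  assumes t: "t \<in> carrier (T n M)"
  shows "aug_cobar M \<rho> (Suc n) (aug_cobar M \<rho> n t) = cobar M \<rho> (Suc n) (cobar M \<rho> n t)"
proof -
  let ?W = "T (Suc (Suc n)) M"
  define X where "X = cobar M \<rho> n t"
  define Y where "Y = pre M (Suc n) [\<II>] t"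
  define Q where "Q = pre M (Suc (Suc n)) [\<II>, \<II>] t"
  have c: "X \<in> carrier (T (Suc n) M)" "Y \<in> carrier (T (Suc n) M)" "Q \<in> carrier ?W"
    using t by (auto simp: X_def Y_def Q_def cobar_closed intro!: pre_closed[where n = n])
  have Y: "pre M (Suc (Suc n)) [\<II>] Y = Q"
    using t by (simp add: Y_def Q_def pre_pre[where n = n])
  have "sw2 K ?W (comult C \<II>) (\<lambda>x y. pre M (Suc (Suc n)) [x, y] t) = Q"
    unfolding comult_II Q_def
    by (rule sw2_pt)
      (use t pre_slot_linear[OF M, of "[]" "[_]"] pre_slot_linear[OF M, of "[_]" "[]"]
        in \<open>auto simp: module_axioms\<close>)
  then have cY: "cobar M \<rho> (Suc n) Y = Q \<ominus>\<^bsub>?W\<^esub> pre M (Suc (Suc n)) [\<II>] X"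
    using cobar_pre[OF II_closed t] by (simp add: X_def Y_def)
  have d: "X \<ominus>\<^bsub>T (Suc n) M\<^esub> Y \<in> carrier (T (Suc n) M)" using c by simp
  have ab: "x \<ominus>\<^bsub>?W\<^esub> (q \<ominus>\<^bsub>?W\<^esub> y) \<ominus>\<^bsub>?W\<^esub> (y \<ominus>\<^bsub>?W\<^esub> q) = x"
    if "x \<in> carrier ?W" "y \<in> carrier ?W" "q \<in> carrier ?W" for x y q
  proof -
    have "y \<ominus>\<^bsub>?W\<^esub> q = \<ominus>\<^bsub>?W\<^esub> (q \<ominus>\<^bsub>?W\<^esub> y)"
      using that by (simp add: a_minus_def TM.M.minus_add TM.M.a_comm)
    then show ?thesis using that
      by (simp add: a_minus_def TM.M.a_assoc TM.M.l_neg)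
  qed
  have "aug_cobar M \<rho> (Suc n) (aug_cobar M \<rho> n t) =
    cobar M \<rho> (Suc n) (X \<ominus>\<^bsub>T (Suc n) M\<^esub> Y) \<ominus>\<^bsub>?W\<^esub> pre M (Suc (Suc n)) [\<II>] (X \<ominus>\<^bsub>T (Suc n) M\<^esub> Y)"
    by (simp add: aug_cobar_def X_def Y_def)
  also have "\<dots> = cobar M \<rho> (Suc n) X \<ominus>\<^bsub>?W\<^esub> cobar M \<rho> (Suc n) Y
      \<ominus>\<^bsub>?W\<^esub> (pre M (Suc (Suc n)) [\<II>] X \<ominus>\<^bsub>?W\<^esub> pre M (Suc (Suc n)) [\<II>] Y)"
    using c by (simp add: linear_map_diff[OF _ _ cobar_linear] linear_map_diff[OF _ _ pre_linear])
  also have "\<dots> = cobar M \<rho> (Suc n) X"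
    unfolding cY Y using c cobar_closed[OF c(1)] by (intro ab) (auto intro!: pre_closed)
  finally show ?thesis by (simp add: X_def)
qed

text \<open>Unrolls the recursion: prefixing c moves the term at j to j + 1, the minus sign of the
  recursion turns \<open>sg j\<close> into \<open>sg (Suc j)\<close>, and \<Delta> c supplies the
  new term at 0.\<close>

lemma cob_sum:
  assumes "set cs \<subseteq> carrier C" "m \<in> carrier M" "length cs = n"
  shows "cob M \<rho> cs m =
    (\<Oplus>\<^bsub>T (Suc n) M\<^esub>j\<in>{..<n}. sg j \<odot>\<^bsub>T (Suc n) M\<^esub>
       sw2 K (T (Suc n) M) (comult C (cs ! j)) (\<lambda>x y. \<tau> M (take j cs @ [x, y] @ drop (Suc j) cs) m))
    \<oplus>\<^bsub>T (Suc n) M\<^esub> sg n \<odot>\<^bsub>T (Suc n) M\<^esub> pre M (Suc n) cs (\<rho> m)"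
  using assms
proof (induction cs arbitrary: n)
  case Nil
  then show ?case by (simp add: pre_Nil)
next
  case (Cons c cs)
  define l where "l = length cs"
  have n: "n = Suc l" using Cons.prems by (simp add: l_def)
  have cs: "c \<in> carrier C" "set cs \<subseteq> carrier C" "m \<in> carrier M" "length cs = l"
    using Cons.prems by (auto simp: l_def)
  let ?W = "T (Suc l) M" and ?W' = "T (Suc (Suc l)) M"
  let ?pre = "pre M (Suc (Suc l)) [c]"
  define g where "g j = sw2 K ?W (comult C (cs ! j))
      (\<lambda>x y. \<tau> M (take j cs @ [x, y] @ drop (Suc j) cs) m)" for j
  define g' where "g' j = sw2 K ?W' (comult C ((c # cs) ! j))
    (\<lambda>x y. \<tau> M (take j (c # cs) @ [x, y] @ drop (Suc j) (c # cs)) m)" for j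
  have s: "sg j \<in> carrier K" "sg (Suc j) = \<ominus>\<^bsub>K\<^esub> sg j" for j
    by (simp_all add: R.r_minus)
  have pt_ins: "\<tau> M (take j cs @ [x, y] @ drop (Suc j) cs) m \<in> carrier ?W"
    if "x \<in> carrier C" "y \<in> carrier C" "j < l" for x y j
    using that cs by (intro pt_closed) (auto dest: in_set_takeD in_set_dropD)
  have nth: "cs ! j \<in> carrier C" if "j < l" for j using that cs by auto
  have g: "g j \<in> carrier ?W" if "j < l" for j
    unfolding g_def by (rule sw2_comult_closed) (use that pt_ins nth in auto)
  have prelin: "linear_map K ?W ?W' ?pre" using cs by (intro pre_linear) auto
  \<comment> \<open>Splitting entry j of \<open>cs\<close> and then prefixing c is splitting entry j
    + 1 of \<open>c # cs\<close>.\<close>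
  have pg: "?pre (g j) = g' (Suc j)" if j: "j < l" for j
  proof -
    have "?pre (g j) = sw2 K ?W' (comult C (cs ! j))
        (\<lambda>x y. ?pre (\<tau> M (take j cs @ [x, y] @ drop (Suc j) cs) m))"
      unfolding g_def by (rule linear_map_sw2_comult[OF _ _ prelin pt_ins]) (use j nth in auto)
    also have "\<dots> = sw2 K ?W' (comult C (cs ! j))
        (\<lambda>x y. \<tau> M (c # take j cs @ [x, y] @ drop (Suc j) cs) m)"
    proof (rule sw2_comult_cong)
      fix x y assume xy: "x \<in> carrier C" "y \<in> carrier C"
      show "?pre (\<tau> M (take j cs @ [x, y] @ drop (Suc j) cs) m)
          = \<tau> M (c # take j cs @ [x, y] @ drop (Suc j) cs) m"
        using xy cs j by (subst pre_pt) (auto dest: in_set_takeD in_set_dropD)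
      show "?pre (\<tau> M (take j cs @ [x, y] @ drop (Suc j) cs) m) \<in> carrier ?W'"
        by (rule linear_map_closed[OF prelin pt_ins[OF xy j]])
    qed (use nth j in simp_all)
    finally show ?thesis by (simp add: g'_def)
  qed
  have g': "g' (Suc j) \<in> carrier ?W'" if "j < l" for j
    using linear_map_closed[OF prelin g[OF that]] pg[OF that] by simp
  have g0: "g' 0 \<in> carrier ?W'" unfolding g'_def by (rule sw2_comult_closed) (use cs in auto)
  have S: "(\<Oplus>\<^bsub>?W\<^esub>j\<in>{..<l}. sg j \<odot>\<^bsub>?W\<^esub> g j) \<in> carrier ?W" using g s by (intro TM.M.finsum_closed) auto
  have L: "pre M (Suc l) cs (\<rho> m) \<in> carrier ?W" using cs by (intro pre_closed[where n = 1]) auto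
  have L': "?pre (pre M (Suc l) cs (\<rho> m)) = pre M (Suc (Suc l)) (c # cs) (\<rho> m)"
    using cs by (subst pre_pre[where n = 1]) auto
  have L2: "pre M (Suc (Suc l)) (c # cs) (\<rho> m) \<in> carrier ?W'" using cs
      by (intro pre_closed[where n = 1]) auto
  have "?pre (\<Oplus>\<^bsub>?W\<^esub>j\<in>{..<l}. sg j \<odot>\<^bsub>?W\<^esub> g j) = (\<Oplus>\<^bsub>?W'\<^esub>j\<in>{..<l}. ?pre (sg j \<odot>\<^bsub>?W\<^esub> g j))"
    by (rule linear_map_finsum[OF _ _ prelin]) (use g s in auto)
  also have "\<ominus>\<^bsub>?W'\<^esub> \<dots> = (\<Oplus>\<^bsub>?W'\<^esub>j\<in>{..<l}. \<ominus>\<^bsub>?W'\<^esub> ?pre (sg j \<odot>\<^bsub>?W\<^esub> g j))"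
    by (rule linear_map_finsum[where K = K, OF _ _ linear_map_uminus[OF _ _ linear_map_id]])
      (use g s linear_map_closed[OF prelin] in auto)
  also have "\<dots> = (\<Oplus>\<^bsub>?W'\<^esub>j\<in>{..<l}. sg (Suc j) \<odot>\<^bsub>?W'\<^esub> g' (Suc j))"
    by (rule TM.M.finsum_cong')
      (use g g' s in \<open>auto simp del: R.nat_pow_Suc
          simp: linear_map_smult[OF prelin] pg TM.smult_l_minus\<close>)
  finally have sum: "\<ominus>\<^bsub>?W'\<^esub> ?pre (\<Oplus>\<^bsub>?W\<^esub>j\<in>{..<l}. sg j \<odot>\<^bsub>?W\<^esub> g j) =
    (\<Oplus>\<^bsub>?W'\<^esub>j\<in>{..<l}. sg (Suc j) \<odot>\<^bsub>?W'\<^esub> g' (Suc j))" .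
  \<comment> \<open>The index 0 is split off and the others are renumbered by \<open>Suc\<close>, to
    match the shifted sum.\<close>
  have "(\<Oplus>\<^bsub>?W'\<^esub>j\<in>{..<Suc l}. sg j \<odot>\<^bsub>?W'\<^esub> g' j) =
      sg 0 \<odot>\<^bsub>?W'\<^esub> g' 0 \<oplus>\<^bsub>?W'\<^esub> (\<Oplus>\<^bsub>?W'\<^esub>j\<in>Suc ` {..<l}. sg j \<odot>\<^bsub>?W'\<^esub> g' j)"
    unfolding lessThan_Suc_eq_insert_0
    by (rule TM.M.finsum_insert) (use g0 g' s in \<open>auto simp del: R.nat_pow_Suc\<close>)
  also have "(\<Oplus>\<^bsub>?W'\<^esub>j\<in>Suc ` {..<l}. sg j \<odot>\<^bsub>?W'\<^esub> g' j) = (\<Oplus>\<^bsub>?W'\<^esub>j\<in>{..<l}. sg (Suc j) \<odot>\<^bsub>?W'\<^esub> g' (Suc j))"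
    by (rule TM.M.finsum_reindex) (use g' s in \<open>auto simp del: R.nat_pow_Suc\<close>)
  finally have sum': "(\<Oplus>\<^bsub>?W'\<^esub>j\<in>{..<Suc l}. sg j \<odot>\<^bsub>?W'\<^esub> g' j) =
      g' 0 \<oplus>\<^bsub>?W'\<^esub> \<ominus>\<^bsub>?W'\<^esub> ?pre (\<Oplus>\<^bsub>?W\<^esub>j\<in>{..<l}. sg j \<odot>\<^bsub>?W\<^esub> g j)"
    using g0 by (simp add: sum del: R.nat_pow_Suc)
  have "cob M \<rho> (c # cs) m = g' 0 \<ominus>\<^bsub>?W'\<^esub> ?pre (cob M \<rho> cs m)"
    by (simp add: g'_def cs)
  also have "cob M \<rho> cs m = (\<Oplus>\<^bsub>?W\<^esub>j\<in>{..<l}. sg j \<odot>\<^bsub>?W\<^esub> g j) \<oplus>\<^bsub>?W\<^esub> sg l \<odot>\<^bsub>?W\<^esub> pre M (Suc l) cs (\<rho> m)"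
    unfolding g_def by (rule Cons.IH[OF cs(2,3,4)])
  also have "g' 0 \<ominus>\<^bsub>?W'\<^esub> ?pre \<dots> = g' 0 \<oplus>\<^bsub>?W'\<^esub> \<ominus>\<^bsub>?W'\<^esub> ?pre (\<Oplus>\<^bsub>?W\<^esub>j\<in>{..<l}. sg j \<odot>\<^bsub>?W\<^esub> g j)
      \<oplus>\<^bsub>?W'\<^esub> sg (Suc l) \<odot>\<^bsub>?W'\<^esub> pre M (Suc (Suc l)) (c # cs) (\<rho> m)"
    using S L L' L2 g0 s linear_map_closed[OF prelin]
    by (simp del: R.nat_pow_Suc add: a_minus_def linear_map_add[OF prelin] linear_map_smult[OF
        prelin]
        TM.M.minus_add TM.M.a_assoc TM.smult_l_minus)
  finally show ?case unfolding n sum'[symmetric] unfolding g'_def .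
qed

end

end

section \<open>The calculus\<close>

locale equivariant_setting = grouplike_coalgebra K C \<II>
  for K :: "'k ring" and C :: "('k, 'c) coalg" and \<II> :: 'c +
  fixes B :: "('k, 'b) coalg" and la :: "'b \<Rightarrow> 'c \<Rightarrow> 'c" and ra :: "'c \<Rightarrow> 'b \<Rightarrow> 'c"
    and \<alpha> \<beta> :: "'b \<Rightarrow> 'b"
  assumes bialg: "bialgebra K B"
    and \<alpha>_hom: "bialgebra_hom K B B \<alpha>"
    and \<beta>_hom: "bialgebra_hom K B (op_cop K B) \<beta>"
    and bimod: "bimodule_coalgebra K B C la ra"
begin

lemma coalg_B: "coalgebra K B"
  by (rule bialgebra.axioms(1)[OF bialg])

lemma module_B [simp]: "module K B"
  by (rule coalgebra.space[OF coalg_B])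

text \<open>A second instance for tensors all of whose factors lie in B, the values of
  \<open>iter_comult\<close>; unqualified names keep referring to C.\<close>

sublocale B: tensor K B
  by (rule tensor.intro) (rule module_B)

sublocale RB: ring B
  by (rule bialgebra.ring[OF bialg])

lemma mult_linear1: "y \<in> carrier B \<Longrightarrow> linear_map K B B (\<lambda>x. x \<otimes>\<^bsub>B\<^esub> y)"
  by (rule linear_mapI) (simp_all add: RB.l_distr bialgebra.smult_mult_left[OF bialg])

lemma mult_linear2: "x \<in> carrier B \<Longrightarrow> linear_map K B B (\<lambda>y. x \<otimes>\<^bsub>B\<^esub> y)"
  by (rule linear_mapI) (simp_all add: RB.r_distr bialgebra.smult_mult_right[OF bialg])

lemma \<alpha>_linear: "linear_map K B B \<alpha>"
  using \<alpha>_hom by (simp add: bialgebra_hom_def)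

text \<open>\<open>op_cop\<close> alters the product and the comultiplication but not the underlying
  module, so linearity into it is linearity into B.\<close>

lemma \<beta>_linear: "linear_map K B B \<beta>"
  using \<beta>_hom by (simp add: bialgebra_hom_def op_cop_def linear_map_def)

lemma comult_B_linear: "linear_map K B (B.T 1 B) (comult B)"
  by (rule coalgebra.comult_linear[OF coalg_B])

lemma iter_comult_linear: "linear_map K B (B.T n B) (iter_comult K B n)"
proof (induction n)
  case 0
  have "linear_map K B (B.T 0 B) (\<lambda>b. pt K B B [] b)" by (rule B.pt_last_linear) simp_all
  then show ?case by simp
next
  case (Suc n)
  \<comment> \<open>The Sweedler sum in the recursion of \<open>iter_comult\<close> is
    \<open>pre\<close> applied to the comultiplication of the last factor; its multilinearity is
    shown in that form.\<close>
  have "multilinear K B n B (B.T (Suc n) B) (\<lambda>bs b'. B.pre B (Suc n) bs (comult B b'))"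
    by (rule B.pre_multilinear[OF _ _ comult_B_linear]) simp_all
  then have "multilinear K B n B (B.T (Suc n) B)
      (\<lambda>bs b'. sw2 K (B.T (Suc n) B) (comult B b') (\<lambda>x y. pt K B B (bs @ [x]) y))"
    by (rule iffD1[OF multilinear_cong[OF module_B module_B], rotated])
      (simp add: B.sw2_eq_pre linear_map_closed[OF comult_B_linear])
  from linear_map_comp[OF Suc B.lift_linear[OF module_B _ this]] show ?case by simp
qed

lemmas iter_comult_closed = linear_map_closed[OF iter_comult_linear]

abbreviation "cnj b1 c b3 \<equiv> ra (la (\<alpha> b1) c) (\<beta> b3)"

lemmas \<alpha>_closed [simp] = linear_map_closed[OF \<alpha>_linear]
lemmas \<beta>_closed [simp] = linear_map_closed[OF \<beta>_linear]

lemma la_closed [simp]: "\<lbrakk>b \<in> carrier B; c \<in> carrier C\<rbrakk> \<Longrightarrow> la b c \<in> carrier C"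
  using linear_map_closed[OF bimodule_coalgebra.la_linear2[OF bimod]] .

lemma ra_closed [simp]: "\<lbrakk>c \<in> carrier C; b \<in> carrier B\<rbrakk> \<Longrightarrow> ra c b \<in> carrier C"
  using linear_map_closed[OF bimodule_coalgebra.ra_linear2[OF bimod]] .

lemma cnj_linear1: "\<lbrakk>c \<in> carrier C; b3 \<in> carrier B\<rbrakk> \<Longrightarrow> linear_map K B C (\<lambda>b1. cnj b1 c b3)"
  by (rule linear_map_comp[OF linear_map_comp[OF \<alpha>_linear bimodule_coalgebra.la_linear1[OF bimod]]
      bimodule_coalgebra.ra_linear1[OF bimod]]) simp_all

lemma cnj_linear2: "\<lbrakk>b1 \<in> carrier B; b3 \<in> carrier B\<rbrakk> \<Longrightarrow> linear_map K C C (\<lambda>c. cnj b1 c b3)"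
  by (rule linear_map_comp[OF bimodule_coalgebra.la_linear2[OF bimod]
      bimodule_coalgebra.ra_linear1[OF bimod]]) simp_all

lemma cnj_linear3: "\<lbrakk>b1 \<in> carrier B; c \<in> carrier C\<rbrakk> \<Longrightarrow> linear_map K B C (\<lambda>b3. cnj b1 c b3)"
  by (rule linear_map_comp[OF \<beta>_linear bimodule_coalgebra.ra_linear2[OF bimod]]) simp_all

text \<open>The action of b on C \<otimes> N through its three Sweedler components. For N = M it
  expresses equivariance; for N = B it gives the product with a one-form and, at \<II> \<otimes> 1,
  the last term of the differential.\<close>

definition diag_act ::
  "('k, 'm, 'y) module_scheme \<Rightarrow> ('b \<Rightarrow> 'm \<Rightarrow> 'm) \<Rightarrow> 'b \<Rightarrow> ('c list \<times> 'm \<Rightarrow> 'k) set \<Rightarrow> ('c list \<times> 'm \<Rightarrow>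
      'k) set"
  where "diag_act N a b t =
    sw3 K (T 1 N) (iter_comult K B 2 b) (\<lambda>b1 b2 b3.
      sw2 K (T 1 N) t (\<lambda>c y. \<tau> N [cnj b1 c b3] (a b2 y)))"

text \<open>Treats left multiplication on B and the action on a B-module together.\<close>

definition bilinear_action :: "('k, 'm, 'y) module_scheme \<Rightarrow> ('b \<Rightarrow> 'm \<Rightarrow> 'm) \<Rightarrow> bool" where
  "bilinear_action N a \<longleftrightarrow> module K N \<and> (\<forall>y\<in>carrier N. linear_map K B N (\<lambda>b. a b y)) \<and>
    (\<forall>b\<in>carrier B. linear_map K N N (a b))"

lemma bilinear_action_mult: "bilinear_action B (\<lambda>x y. x \<otimes>\<^bsub>B\<^esub> y)"
  by (simp add: bilinear_action_def mult_linear1 mult_linear2)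

context
  fixes N :: "('k, 'm, 'y) module_scheme" and a
  assumes a: "bilinear_action N a"
begin

lemma action_module: "module K N"
  and action_linear1: "y \<in> carrier N \<Longrightarrow> linear_map K B N (\<lambda>b. a b y)"
  and action_linear2: "b \<in> carrier B \<Longrightarrow> linear_map K N N (a b)"
  using a by (auto simp: bilinear_action_def)

lemma action_closed: "\<lbrakk>b \<in> carrier B; y \<in> carrier N\<rbrakk> \<Longrightarrow> a b y \<in> carrier N"
  using linear_map_closed[OF action_linear2] .

lemmas action_simps = action_module action_closed

lemma diag_pt_linear1:
  "\<lbrakk>b2 \<in> carrier B; b3 \<in> carrier B; c \<in> carrier C; y \<in> carrier N\<rbrakk> \<Longrightarrow>
    linear_map K B (T 1 N) (\<lambda>b1. \<tau> N [cnj b1 c b3] (a b2 y))"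
  and diag_pt_linear2:
  "\<lbrakk>b1 \<in> carrier B; b3 \<in> carrier B; c \<in> carrier C; y \<in> carrier N\<rbrakk> \<Longrightarrow>
    linear_map K B (T 1 N) (\<lambda>b2. \<tau> N [cnj b1 c b3] (a b2 y))"
  and diag_pt_linear3:
  "\<lbrakk>b1 \<in> carrier B; b2 \<in> carrier B; c \<in> carrier C; y \<in> carrier N\<rbrakk> \<Longrightarrow>
    linear_map K B (T 1 N) (\<lambda>b3. \<tau> N [cnj b1 c b3] (a b2 y))"
  and diag_pt_linear4:
  "\<lbrakk>b1 \<in> carrier B; b2 \<in> carrier B; b3 \<in> carrier B; y \<in> carrier N\<rbrakk> \<Longrightarrow>
    linear_map K C (T 1 N) (\<lambda>c. \<tau> N [cnj b1 c b3] (a b2 y))"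
  and diag_pt_linear5:
  "\<lbrakk>b1 \<in> carrier B; b2 \<in> carrier B; b3 \<in> carrier B; c \<in> carrier C\<rbrakk> \<Longrightarrow>
    linear_map K N (T 1 N) (\<lambda>y. \<tau> N [cnj b1 c b3] (a b2 y))"
  by (rule linear_map_comp[OF cnj_linear1 pt_linear1] linear_map_comp[OF cnj_linear2 pt_linear1]
      linear_map_comp[OF cnj_linear3 pt_linear1] linear_map_comp[OF action_linear1 pt_last_linear]
      linear_map_comp[OF action_linear2 pt_last_linear]; simp add: action_simps)+

lemmas diag_pt_linear = diag_pt_linear1 diag_pt_linear2 diag_pt_linear3 diag_pt_linear4
    diag_pt_linear5

lemma diag_sw3_linear:
  assumes "t \<in> carrier (T 1 N)"
  shows "linear_map K (B.T 2 B) (T 1 N) (\<lambda>u. sw3 K (T 1 N) u (\<lambda>b1 b2 b3.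
      sw2 K (T 1 N) t (\<lambda>c y. \<tau> N [cnj b1 c b3] (a b2 y))))"
  by (intro B.sw3_linear sw2_param_linear[OF action_module] diag_pt_linear)
    (simp_all add: assms action_simps)

lemma diag_act_linear1:
  "t \<in> carrier (T 1 N) \<Longrightarrow> linear_map K B (T 1 N) (\<lambda>b. diag_act N a b t)"
  unfolding diag_act_def by (rule linear_map_comp[OF iter_comult_linear diag_sw3_linear])

lemma diag_act_linear2:
  "b \<in> carrier B \<Longrightarrow> linear_map K (T 1 N) (T 1 N) (diag_act N a b)"
  unfolding diag_act_def
  by (intro B.sw3_param_linear[OF module_B] sw2_linear diag_pt_linear iter_comult_closed)
    (simp_all add: action_simps)

lemma diag_act_closed: "\<lbrakk>b \<in> carrier B; t \<in> carrier (T 1 N)\<rbrakk> \<Longrightarrow> diag_act N a b t \<in> carrier (T 1 N)"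
  using linear_map_closed[OF diag_act_linear2] .

lemma diag_act_pt:
  assumes "b \<in> carrier B" "c \<in> carrier C" "y \<in> carrier N"
  shows "diag_act N a b (\<tau> N [c] y) =
    sw3 K (T 1 N) (iter_comult K B 2 b) (\<lambda>b1 b2 b3. \<tau> N [cnj b1 c b3] (a b2 y))"
proof -
  have "sw2 K (T 1 N) (\<tau> N [c] y) (\<lambda>c y. \<tau> N [cnj b1 c b3] (a b2 y)) = \<tau> N [cnj b1 c b3] (a b2 y)"
    if "b1 \<in> carrier B" "b2 \<in> carrier B" "b3 \<in> carrier B" for b1 b2 b3
    by (rule sw2_pt[OF action_module]) (use that assms in \<open>simp_all add: action_simps
        diag_pt_linear\<close>)
  then show ?thesis
    unfolding diag_act_def
    by (intro B.sw3_cong[OF module_B]) (use assms in \<open>simp_all add: action_simps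
        iter_comult_closed\<close>)
qed

text \<open>Recognises the threefold Sweedler sums in the product and the differential of the
  calculus as diagonal actions.\<close>

lemma pre_diag_act_pt:
  assumes "b \<in> carrier B" "c \<in> carrier C" "y \<in> carrier N" "set cs \<subseteq> carrier C" "k = Suc (length cs)"
  shows "pre N k cs (diag_act N a b (\<tau> N [c] y)) =
    sw3 K (T k N) (iter_comult K B 2 b) (\<lambda>b1 b2 b3. \<tau> N (cs @ [cnj b1 c b3]) (a b2 y))"
proof -
  have "pre N k cs (diag_act N a b (\<tau> N [c] y)) =
    sw3 K (T k N) (iter_comult K B 2 b) (\<lambda>b1 b2 b3. pre N k cs (\<tau> N [cnj b1 c b3] (a b2 y)))"
    unfolding diag_act_pt[OF assms(1-3)]
    by (rule B.linear_map_sw3[OF module_B _ _ pre_linear])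
      (use assms in \<open>simp_all add: action_simps iter_comult_closed\<close>)
  also have "\<dots> = sw3 K (T k N) (iter_comult K B 2 b) (\<lambda>b1 b2 b3. \<tau> N (cs @ [cnj b1 c b3]) (a b2 y))"
    by (rule B.sw3_cong[OF module_B])
      (use assms in \<open>simp_all add: action_simps iter_comult_closed pre_pt\<close>)
  finally show ?thesis .
qed

end

text \<open>Naturality of the diagonal action in N. It will be applied to the map b \<mapsto> b x
  from B to M, which commutes with the left actions of B.\<close>

lemma diag_act_tmap:
  assumes a: "bilinear_action N a" and a': "bilinear_action N' a'" and f: "linear_map K N N' f"
    and fa: "\<And>b y. \<lbrakk>b \<in> carrier B; y \<in> carrier N\<rbrakk> \<Longrightarrow> f (a b y) = a' b (f y)"
    and b: "b \<in> carrier B" and t: "t \<in> carrier (T 1 N)"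
  shows "tmap N' 1 f (diag_act N a b t) = diag_act N' a' b (tmap N' 1 f t)"
proof (rule tens_eqI[OF action_module[OF a] _ _ _ _ t])
  note m [simp] = action_module[OF a] action_module[OF a']
  show "linear_map K (T 1 N) (T 1 N') (\<lambda>t. tmap N' 1 f (diag_act N a b t))"
    by (rule linear_map_comp[OF diag_act_linear2[OF a b] tmap_linear[OF m f]])
  show "linear_map K (T 1 N) (T 1 N') (\<lambda>t. diag_act N' a' b (tmap N' 1 f t))"
    by (rule linear_map_comp[OF tmap_linear[OF m f] diag_act_linear2[OF a' b]])
  fix cs y assume "length cs = 1" "set cs \<subseteq> carrier C" and y: "y \<in> carrier N"
  then obtain c where c: "cs = [c]" "c \<in> carrier C" by (auto simp: length_eq_1)
  note ac = action_closed[OF a] action_closed[OF a'] linear_map_closed[OF f]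
  have "tmap N' 1 f (diag_act N a b (\<tau> N [c] y)) =
    sw3 K (T 1 N') (iter_comult K B 2 b) (\<lambda>b1 b2 b3. tmap N' 1 f (\<tau> N [cnj b1 c b3] (a b2 y)))"
    unfolding diag_act_pt[OF a b c(2) y]
    by (rule B.linear_map_sw3[OF module_B _ _ tmap_linear[OF m f]])
      (use b c y in \<open>simp_all add: ac iter_comult_closed\<close>)
  also have "\<dots> = sw3 K (T 1 N') (iter_comult K B 2 b) (\<lambda>b1 b2 b3. \<tau> N' [cnj b1 c b3] (a' b2 (f y)))"
    by (rule B.sw3_cong[OF module_B])
      (use b c y in \<open>simp_all add: ac iter_comult_closed tmap_pt[OF m f] fa\<close>)
  also have "\<dots> = diag_act N' a' b (tmap N' 1 f (\<tau> N [c] y))"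
    using b c y by (simp add: tmap_pt[OF m f] diag_act_pt[OF a'] ac)
  finally show "tmap N' 1 f (diag_act N a b (\<tau> N cs y)) = diag_act N' a' b (tmap N' 1 f (\<tau> N cs y))"
    by (simp only: c)
qed (simp add: action_module[OF a'])

section \<open>Products with forms of degree 0 and 1, and the differential of the calculus\<close>

abbreviation "gm \<equiv> calculus_mult K B C la ra \<alpha> \<beta>"
abbreviation "\<mu> x y \<equiv> x \<otimes>\<^bsub>B\<^esub> y"

text \<open>With m = 0 the list of Sweedler components is b alone. This product is the right action
  of B over which \<open>form_tens\<close> is balanced.\<close>

lemma calculus_mult_0:
  assumes "\<omega> \<in> carrier (T n B)" "b \<in> carrier B"
  shows "gm n 0 \<omega> (\<tau> B [] b) = tmap B n (\<lambda>x. x \<otimes>\<^bsub>B\<^esub> b) \<omega>"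
proof -
  let ?W = "T n B"
  have 1: "B.lift ?W (\<lambda>bs' bl. \<tau> B cs ((bs' @ [bl]) ! 0 \<otimes>\<^bsub>B\<^esub> b')) (pt K B B [] x) = \<tau> B cs (x \<otimes>\<^bsub>B\<^esub> b')"
    if "b' \<in> carrier B" "x \<in> carrier B" "length cs = n" "set cs \<subseteq> carrier C" for b' x cs
    using that
    by (subst B.lift_pt[where n = 0])
      (auto intro!: multilinear_0I linear_map_comp[OF mult_linear1 pt_last_linear])
  have 2: "lift ?W (\<lambda>cs' b'. B.lift ?W (\<lambda>bs' bl. \<tau> B cs ((bs' @ [bl]) ! 0 \<otimes>\<^bsub>B\<^esub> b')) (pt K B B [] x))
      (\<tau> B [] b)
     = \<tau> B cs (x \<otimes>\<^bsub>B\<^esub> b)"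
    if "x \<in> carrier B" "length cs = n" "set cs \<subseteq> carrier C" for x cs
  proof -
    \<comment> \<open>By 1 the inner sum has this closed form; its linearity in b' is proved for the
      closed form and then transferred.\<close>
    have "multilinear K C 0 B ?W (\<lambda>cs' b'. \<tau> B cs (x \<otimes>\<^bsub>B\<^esub> b'))"
      using that by (auto intro!: multilinear_0I linear_map_comp[OF mult_linear2 pt_last_linear])
    then have "multilinear K C 0 B ?W (\<lambda>cs' b'. B.lift ?W
        (\<lambda>bs' bl. \<tau> B cs ((bs' @ [bl]) ! 0 \<otimes>\<^bsub>B\<^esub> b')) (pt K B B [] x))"
      by (rule iffD1[OF multilinear_cong[OF module_axioms module_B], rotated]) (simp add: 1 that)
    from lift_pt[OF module_B _ this] show ?thesis using that assms by (simp add: 1)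
  qed
  have "tmap B n (\<lambda>x. x \<otimes>\<^bsub>B\<^esub> b) \<omega> = lift ?W (\<lambda>cs x. lift ?W
      (\<lambda>cs' b'. B.lift ?W (\<lambda>bs' bl. \<tau> B cs ((bs' @ [bl]) ! 0 \<otimes>\<^bsub>B\<^esub> b')) (pt K B B [] x)) (\<tau> B [] b)) \<omega>"
    unfolding tmap_def
    by (rule lift_cong[OF module_B _ _ _ assms(1)]) (use assms in \<open>simp_all add: 2\<close>)
  then show ?thesis by (simp add: calculus_mult_def Let_def)
qed

lemma calculus_mult_0_closed:
  "\<lbrakk>\<omega> \<in> carrier (T n B); b \<in> carrier B\<rbrakk> \<Longrightarrow> gm n 0 \<omega> (\<tau> B [] b) \<in> carrier (T n B)"
  by (simp add: calculus_mult_0 tmap_closed[OF _ _ mult_linear1])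

text \<open>With m = 1 three Sweedler components remain: the outer two act on the vector of \<eta>,
  the middle one multiplies its last factor, which is the diagonal action.\<close>

lemma calculus_mult_1:
  assumes \<omega>: "\<omega> \<in> carrier (T n B)" and \<eta>: "\<eta> \<in> carrier (T 1 B)"
  shows "gm n 1 \<omega> \<eta> = lift (T (Suc n) B) (\<lambda>cs b. pre B (Suc n) cs (diag_act B \<mu> b \<eta>)) \<omega>"
proof -
  let ?W = "T (Suc n) B"
  let ?g = "\<lambda>cs cs' b' bs' bl. \<tau> B
     (cs @ [cnj ((bs' @ [bl]) ! 0) (cs' ! 0) ((bs' @ [bl]) ! 2)]) ((bs' @ [bl]) ! 1 \<otimes>\<^bsub>B\<^esub> b')"
  have 1: "B.lift ?W (?g cs [c] b') (iter_comult K B 2 b)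
      = pre B (Suc n) cs (diag_act B \<mu> b (\<tau> B [c] b'))"
    if "c \<in> carrier C" "b' \<in> carrier B" "b \<in> carrier B" "length cs = n" "set cs \<subseteq> carrier C"
        for c b' b cs
  proof -
    have "B.lift ?W (?g cs [c] b') (iter_comult K B 2 b) =
      sw3 K ?W (iter_comult K B 2 b) (\<lambda>b1 b2 b3. \<tau> B (cs @ [cnj b1 c b3]) (b2 \<otimes>\<^bsub>B\<^esub> b'))"
      unfolding sw3_def
      by (rule B.lift_cong[OF module_B, where n = 2])
        (use that iter_comult_closed in \<open>auto simp: length_eq_2 Let_def\<close>)
    then show ?thesis
      by (subst pre_diag_act_pt[OF bilinear_action_mult]) (use that in simp_all)
  qed
  \<comment> \<open>The right-hand side is already linear in \<eta>, so agreement on pure \<eta>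
    suffices and the nested sum needs no separate proof of multilinearity.\<close>
  have 2: "lift ?W (\<lambda>cs' b'. B.lift ?W (?g cs cs' b') (iter_comult K B 2 b)) \<eta> =
      pre B (Suc n) cs (diag_act B \<mu> b \<eta>)"
    if "b \<in> carrier B" "length cs = n" "set cs \<subseteq> carrier C" for b cs
  proof (rule lift_eqI[OF module_B _ _ _ \<eta>])
    show "linear_map K (T 1 B) ?W (\<lambda>\<eta>. pre B (Suc n) cs (diag_act B \<mu> b \<eta>))"
      by (rule linear_map_comp[OF diag_act_linear2[OF bilinear_action_mult] pre_linear])
          (use that in auto)
    fix cs' b' assume "length cs' = 1" "set cs' \<subseteq> carrier C" "b' \<in> carrier B"
    then show "B.lift ?W (?g cs cs' b') (iter_comult K B 2 b) =
      pre B (Suc n) cs (diag_act B \<mu> b (\<tau> B cs' b'))"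
      using that 1 by (auto simp: length_eq_1)
  qed simp
  have "gm n 1 \<omega> \<eta> = lift ?W (\<lambda>cs b. lift ?W
      (\<lambda>cs' b'. B.lift ?W (?g cs cs' b') (iter_comult K B 2 b)) \<eta>) \<omega>"
    unfolding calculus_mult_def by (simp add: Let_def)
  also have "\<dots> = lift ?W (\<lambda>cs b. pre B (Suc n) cs (diag_act B \<mu> b \<eta>)) \<omega>"
    by (rule lift_cong[OF module_B _ _ _ \<omega>])
      (simp_all add: 2 diag_act_closed[OF bilinear_action_mult] \<eta> pre_closed[where n = 1])
  finally show ?thesis .
qed

lemma prol_multilinear:
  assumes "bilinear_action N a" "t \<in> carrier (T 1 N)"
  shows "multilinear K C n B (T (Suc n) N) (\<lambda>cs b. pre N (Suc n) cs (diag_act N a b t))"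
  by (rule pre_multilinear[OF module_B action_module diag_act_linear1]) (use assms in simp_all)

lemma calculus_mult_1_closed:
  "\<lbrakk>\<omega> \<in> carrier (T n B); \<eta> \<in> carrier (T 1 B)\<rbrakk> \<Longrightarrow> gm n 1 \<omega> \<eta> \<in> carrier (T (Suc n) B)"
  unfolding calculus_mult_1
  using linear_map_closed[OF lift_linear[OF module_B _ prol_multilinear[OF bilinear_action_mult]]]
      by simp

text \<open>
  \<open>dunit b = \<alpha>(b\<^sub>(\<^sub>1\<^sub>)) \<II> \<beta>(b\<^sub>(\<^sub>3\<^sub>)) \<otimes> b\<^sub>(\<^sub>2\<^sub>)\<close>. With \<open>dunit\<close> in the role of a coaction on \<open>B\<close>, the
  differential of the calculus is itself an instance of \<open>aug_cobar\<close>.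
\<close>

definition "dunit b = diag_act B \<mu> b (\<tau> B [\<II>] \<one>\<^bsub>B\<^esub>)"

lemma dunit_linear: "linear_map K B (T 1 B) dunit"
  unfolding dunit_def by (rule diag_act_linear1[OF bilinear_action_mult]) simp

lemma calculus_diff:
  assumes "\<omega> \<in> carrier (T n B)"
  shows "calculus_diff K B C la ra \<alpha> \<beta> \<II> n \<omega> = aug_cobar B dunit n \<omega>"
  unfolding calculus_diff_def Let_def
proof (rule lift_eqI[OF module_B _ _ _ assms])
  show "linear_map K (T n B) (T (n + 1) B) (aug_cobar B dunit n)"
    using aug_cobar_linear[OF module_B dunit_linear] by simp
  fix cs b assume *: "length cs = n" "set cs \<subseteq> carrier C" "b \<in> carrier B"
  let ?W = "T (n + 1) B"
  interpret W: module K ?W by simp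
  \<comment> \<open>The diagonal action on \<II> \<otimes> 1 leaves a factor 1 behind the middle
    component, which the next step removes.\<close>
  have "pre B (Suc n) cs (dunit b) =
      sw3 K ?W (iter_comult K B 2 b) (\<lambda>b1 b2 b3. \<tau> B (cs @ [cnj b1 \<II> b3]) (b2 \<otimes>\<^bsub>B\<^esub> \<one>\<^bsub>B\<^esub>))"
    unfolding dunit_def by (subst pre_diag_act_pt[OF bilinear_action_mult]) (use * in simp_all)
  also have "\<dots> = sw3 K ?W (iter_comult K B 2 b) (\<lambda>b1 b2 b3. \<tau> B (cs @ [cnj b1 \<II> b3]) b2)"
    by (rule B.sw3_cong[OF module_B]) (use * in \<open>simp_all add: iter_comult_closed\<close>)
  finally have e: "sw3 K ?W (iter_comult K B 2 b) (\<lambda>b1 b2 b3. \<tau> B (cs @ [cnj b1 \<II> b3]) b2) =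
    pre B (Suc n) cs (dunit b)" by simp
  let ?S = "\<Oplus>\<^bsub>?W\<^esub>j\<in>{..<n}. sg j \<odot>\<^bsub>?W\<^esub>
      sw2 K ?W (comult C (cs ! j)) (\<lambda>x y. \<tau> B (take j cs @ [x, y] @ drop (j + 1) cs) b)"
  let ?L = "sg n \<odot>\<^bsub>?W\<^esub> pre B (Suc n) cs (dunit b)"
  have pt_ins: "\<tau> B (take j cs @ [x, y] @ drop (j + 1) cs) b \<in> carrier ?W"
    if "x \<in> carrier C" "y \<in> carrier C" "j < n" for x y j
    using that * by (intro pt_closed) (auto dest: in_set_takeD in_set_dropD)
  have S: "?S \<in> carrier ?W"
    by (intro W.M.finsum_closed funcsetI W.smult_closed sw2_comult_closed pt_ins) (use * in auto)
  have L: "?L \<in> carrier ?W" using * linear_map_closed[OF dunit_linear]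
    by (intro W.smult_closed) (auto intro!: pre_closed[where n = 1])
  have I: "\<tau> B (\<II> # cs) b \<in> carrier ?W" using * by auto
  have "aug_cobar B dunit n (\<tau> B cs b) = (?S \<oplus>\<^bsub>?W\<^esub> ?L) \<ominus>\<^bsub>?W\<^esub> \<tau> B (\<II> # cs) b"
    using * cob_sum[OF module_B dunit_linear, of cs b n]
    by (simp add: aug_cobar_def cobar_pt[OF module_B dunit_linear] pre_pt)
  also have "\<dots> = \<ominus>\<^bsub>?W\<^esub> \<tau> B (\<II> # cs) b \<oplus>\<^bsub>?W\<^esub> ?S \<oplus>\<^bsub>?W\<^esub> ?L"
    using S L I W.M.a_comm[of "?S \<oplus>\<^bsub>?W\<^esub> ?L" "\<ominus>\<^bsub>?W\<^esub> \<tau> B (\<II> # cs) b"]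
    by (simp only: a_minus_def W.M.a_assoc W.M.a_closed W.M.a_inv_closed)
  finally show "\<ominus>\<^bsub>?W\<^esub> \<tau> B (\<II> # cs) b \<oplus>\<^bsub>?W\<^esub> ?S \<oplus>\<^bsub>?W\<^esub> sg n \<odot>\<^bsub>?W\<^esub>
      sw3 K ?W (iter_comult K B 2 b) (\<lambda>b1 b2 b3. \<tau> B (cs @ [cnj b1 \<II> b3]) b2) =
    aug_cobar B dunit n (\<tau> B cs b)" unfolding e by simp
qed simp

section \<open>The identification of forms with values in M and tensors in C and M\<close>

abbreviation "\<Omega> \<equiv> calculus K B C la ra \<alpha> \<beta> \<II>"
abbreviation "FT M n \<equiv> form_tens K B \<Omega> n M"
abbreviation "fp M n \<equiv> form_pt K B \<Omega> n M"
abbreviation "fmult M n \<equiv> form_mult K B \<Omega> n 1 M"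
abbreviation "cext M \<equiv> conn_ext K B \<Omega> M"
abbreviation "dact M \<equiv> diag_act M (act M)"
abbreviation "ev M n x \<equiv> tmap M n (\<lambda>b. act M b x)"
abbreviation "equivariant \<equiv> equivariant_comodule K B C la ra \<alpha> \<beta>"

definition \<Phi> :: "('k, 'b, 'x) left_mod \<Rightarrow> nat \<Rightarrow> (('c list \<times> 'b \<Rightarrow> 'k) set \<times> 'x \<Rightarrow> 'k) set \<Rightarrow> ('c list
    \<times> 'x \<Rightarrow> 'k) set"
  where "\<Phi> M n = lin_ext K (T n M) (\<lambda>(\<omega>, x). ev M n x \<omega>)"

definition \<Psi> :: "('k, 'b, 'x) left_mod \<Rightarrow> nat \<Rightarrow> ('c list \<times> 'x \<Rightarrow> 'k) set \<Rightarrow> (('c list \<times> 'b \<Rightarrow> 'k) set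
    \<times> 'x \<Rightarrow> 'k) set"
  where "\<Psi> M n = lift (FT M n) (\<lambda>cs x. fp M n (\<tau> B cs \<one>\<^bsub>B\<^esub>) x)"

lemma form_tens_eq: "FT M n = bal_tens K B (T n B) (\<lambda>\<omega> a. gm n 0 \<omega> (\<tau> B [] a)) M (act M)"
  and form_pt_eq: "fp M n = bal_pt K B (T n B) (\<lambda>\<omega> a. gm n 0 \<omega> (\<tau> B [] a)) M (act M)"
  by (simp_all add: form_tens_def form_pt_def calculus_def)

context
  fixes M :: "('k, 'b, 'x) left_mod"
  assumes LM: "left_module K B M"
begin

lemma module_M: "module K M"
  and act_linear1: "x \<in> carrier M \<Longrightarrow> linear_map K B M (\<lambda>b. act M b x)"
  and act_linear2: "b \<in> carrier B \<Longrightarrow> linear_map K M M (act M b)"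
  and act_one: "x \<in> carrier M \<Longrightarrow> act M \<one>\<^bsub>B\<^esub> x = x"
  and act_mult: "\<lbrakk>b \<in> carrier B; b' \<in> carrier B; x \<in> carrier M\<rbrakk> \<Longrightarrow>
    act M (b \<otimes>\<^bsub>B\<^esub> b') x = act M b (act M b' x)"
  using LM by (auto simp: left_module_def)

lemma bilinear_action_act: "bilinear_action M (act M)"
  using LM by (simp add: left_module_def bilinear_action_def)

lemma act_closed: "\<lbrakk>b \<in> carrier B; x \<in> carrier M\<rbrakk> \<Longrightarrow> act M b x \<in> carrier M"
  using linear_map_closed[OF act_linear2] .

lemma balanced: "balanced_tensor K B (T n B) (\<lambda>\<omega> a. gm n 0 \<omega> (\<tau> B [] a)) M (act M)"
  by (intro balanced_tensor.intro balanced_tensor_axioms.intro)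
    (simp_all add: module_M calculus_mult_0_closed act_closed)

lemmas module_FT = balanced_tensor.module_BT[OF balanced, folded form_tens_eq]
lemmas fp_closed = balanced_tensor.bp_closed[OF balanced, folded form_tens_eq form_pt_eq]
lemmas fp_linear1 = balanced_tensor.bp_linear1[OF balanced, folded form_tens_eq form_pt_eq]
lemmas fp_linear2 = balanced_tensor.bp_linear2[OF balanced, folded form_tens_eq form_pt_eq]
lemmas fp_balanced = balanced_tensor.bp_balanced[OF balanced, folded form_tens_eq form_pt_eq]
lemmas FT_linear_map_lift = balanced_tensor.BT_linear_map_lift[OF balanced, folded form_tens_eq
    form_pt_eq]
lemmas FT_lift_eqI = balanced_tensor.BT_lift_eqI[OF balanced, folded form_tens_eq form_pt_eq]
lemmas FT_eqI = balanced_tensor.BT_eqI[OF balanced, folded form_tens_eq form_pt_eq]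
lemmas FT_lift_linear = balanced_tensor.BT_lift_linear[OF balanced, folded form_tens_eq form_pt_eq]
lemmas FT_lift_fp = balanced_tensor.BT_lift_bp[OF balanced, folded form_tens_eq form_pt_eq]
lemmas FT_lift_closed = balanced_tensor.BT_lift_closed[OF balanced, folded form_tens_eq form_pt_eq]

lemma fp_move:
  "\<lbrakk>\<omega> \<in> carrier (T n B); b \<in> carrier B; x \<in> carrier M\<rbrakk> \<Longrightarrow>
    fp M n (tmap B n (\<lambda>y. y \<otimes>\<^bsub>B\<^esub> b) \<omega>) x = fp M n \<omega> (act M b x)"
  using fp_balanced[of \<omega> n b x] by (simp add: calculus_mult_0)

lemma
  shows \<Phi>_linear: "linear_map K (FT M n) (T n M) (\<Phi> M n)"
    and \<Phi>_fp: "\<lbrakk>\<omega> \<in> carrier (T n B); x \<in> carrier M\<rbrakk> \<Longrightarrow>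
      \<Phi> M n (fp M n \<omega> x) = ev M n x \<omega>"
proof -
  have 1: "linear_map K (T n B) (T n M) (\<lambda>\<omega>. ev M n x \<omega>)" if "x \<in> carrier M" for x
    by (rule tmap_linear[OF module_B module_M act_linear1[OF that]])
  have 2: "linear_map K M (T n M) (\<lambda>x. ev M n x \<omega>)" if "\<omega> \<in> carrier (T n B)" for \<omega>
    by (rule tmap_param_linear[OF module_M module_B module_M act_linear2 that])
  \<comment> \<open>Compatibility with the balancing relation is the associativity of the module
    action.\<close>
  have 3: "ev M n x (gm n 0 \<omega> (\<tau> B [] a)) = tmap M n (\<lambda>b. act M b (act M a x)) \<omega>"
    if "\<omega> \<in> carrier (T n B)" "a \<in> carrier B" "x \<in> carrier M" for \<omega> a x
  proof -
    have "ev M n x (gm n 0 \<omega> (\<tau> B [] a)) = tmap M n (\<lambda>b. act M (b \<otimes>\<^bsub>B\<^esub> a) x) \<omega>"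
      using that
      by (simp add: calculus_mult_0 tmap_tmap[OF module_B module_B module_M mult_linear1
          act_linear1])
    also have "\<dots> = tmap M n (\<lambda>b. act M b (act M a x)) \<omega>"
      by (rule tmap_cong[OF module_B module_M linear_map_comp[OF mult_linear1 act_linear1]])
        (use that in \<open>simp_all add: act_mult\<close>)
    finally show ?thesis .
  qed
  show "linear_map K (FT M n) (T n M) (\<Phi> M n)"
    unfolding \<Phi>_def by (rule FT_lift_linear) (simp_all add: 1 2 3 module_M)
  show "\<Phi> M n (fp M n \<omega> x) = ev M n x \<omega>" if "\<omega> \<in> carrier (T n B)" "x \<in> carrier M"
    unfolding \<Phi>_def by (rule FT_lift_fp) (simp_all add: 1 2 3 that module_M)
qed

lemmas \<Phi>_closed = linear_map_closed[OF \<Phi>_linear]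

lemma \<Psi>_multilinear: "multilinear K C n M (FT M n) (\<lambda>cs x. fp M n (\<tau> B cs \<one>\<^bsub>B\<^esub>) x)"
  by (intro multilinearI linear_map_comp[OF pt_slot_linear fp_linear1] fp_linear2 pt_closed) auto

lemma \<Psi>_linear: "linear_map K (T n M) (FT M n) (\<Psi> M n)"
  unfolding \<Psi>_def by (rule lift_linear[OF module_M module_FT \<Psi>_multilinear])

lemmas \<Psi>_closed = linear_map_closed[OF \<Psi>_linear]

lemma \<Psi>_pt:
  "\<lbrakk>length cs = n; set cs \<subseteq> carrier C; x \<in> carrier M\<rbrakk> \<Longrightarrow> \<Psi> M n (\<tau> M cs x) = fp M n (\<tau> B cs \<one>\<^bsub>B\<^esub>) x"
  unfolding \<Psi>_def by (rule lift_pt[OF module_M module_FT \<Psi>_multilinear])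

lemma \<Phi>_\<Psi>: "t \<in> carrier (T n M) \<Longrightarrow> \<Phi> M n (\<Psi> M n t) = t"
  by (rule tens_eqI[OF module_M _ linear_map_comp[OF \<Psi>_linear \<Phi>_linear] linear_map_id])
    (simp_all add: module_M \<Psi>_pt \<Phi>_fp tmap_pt[OF module_B module_M act_linear1] act_one)

text \<open>On (cs \<otimes> b) \<otimes> x the composite gives (cs \<otimes> 1) \<otimes> b x, and
  balancing moves b back across the tensor sign.\<close>

lemma \<Psi>_\<Phi>: "u \<in> carrier (FT M n) \<Longrightarrow> \<Psi> M n (\<Phi> M n u) = u"
proof (rule FT_eqI[OF module_FT linear_map_comp[OF \<Phi>_linear \<Psi>_linear] linear_map_id])
  fix \<omega> x assume \<omega>: "\<omega> \<in> carrier (T n B)" and x: "x \<in> carrier M"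
  have "\<Psi> M n (ev M n x \<omega>) = fp M n \<omega> x"
  proof (rule tens_eqI[OF module_B module_FT _ _ _ \<omega>])
    show "linear_map K (T n B) (FT M n) (\<lambda>\<omega>. \<Psi> M n (ev M n x \<omega>))"
      by (rule linear_map_comp[OF tmap_linear[OF module_B module_M act_linear1[OF x]] \<Psi>_linear])
    show "linear_map K (T n B) (FT M n) (\<lambda>\<omega>. fp M n \<omega> x)" by (rule fp_linear1[OF x])
    fix cs b assume *: "length cs = n" "set cs \<subseteq> carrier C" "b \<in> carrier B"
    have "\<Psi> M n (ev M n x (\<tau> B cs b)) = fp M n (\<tau> B cs \<one>\<^bsub>B\<^esub>) (act M b x)"
      using * x by (simp add: tmap_pt[OF module_B module_M act_linear1[OF x]] \<Psi>_pt act_closed)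
    also have "\<dots> = fp M n (\<tau> B cs b) x"
      using fp_move[of "\<tau> B cs \<one>\<^bsub>B\<^esub>" n b x] * x
      by (simp add: tmap_pt[OF module_B module_B mult_linear1])
    finally show "\<Psi> M n (ev M n x (\<tau> B cs b)) = fp M n (\<tau> B cs b) x" .
  qed
  then show "\<Psi> M n (\<Phi> M n (fp M n \<omega> x)) = fp M n \<omega> x" using \<omega> x by (simp add: \<Phi>_fp)
qed

text \<open>Lets identities between forms with values in M be tested after \<open>\<Phi>\<close>,
  where they become identities between tensors over K.\<close>

lemma \<Phi>_eq_iff: "\<lbrakk>u \<in> carrier (FT M n); v \<in> carrier (FT M n)\<rbrakk> \<Longrightarrow> \<Phi> M n u = \<Phi> M n v \<longleftrightarrow> u = v"
  using \<Psi>_\<Phi> by metis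

lemma tmap_diag_act:
  "\<lbrakk>x \<in> carrier M; b \<in> carrier B; \<eta> \<in> carrier (T 1 B)\<rbrakk> \<Longrightarrow>
    ev M 1 x (diag_act B \<mu> b \<eta>) = dact M b (ev M 1 x \<eta>)"
  by (rule diag_act_tmap[OF bilinear_action_mult bilinear_action_act act_linear1])
      (simp_all add: act_mult)

section \<open>Products and the Leibniz rule across the identification\<close>

lemma form_mult_eq: "form_mult K B \<Omega> n m M \<omega> u =
    lin_ext K (FT M (n + m)) (\<lambda>(\<eta>, x). fp M (n + m) (gm n m \<omega> \<eta>) x) u"
  by (simp add: form_mult_def calculus_def)

lemma form_mult_closed:
  assumes "\<omega> \<in> carrier (T n B)" "u \<in> carrier (FT M 1)"
  shows "fmult M n \<omega> u \<in> carrier (FT M (Suc n))"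
  unfolding form_mult_eq Suc_eq_plus1
  by (rule FT_lift_closed[OF module_FT _ assms(2)])
    (simp_all add: fp_closed calculus_mult_1_closed assms(1))

text \<open>The right-hand side is linear in u, so u = \<eta> \<otimes> x suffices. There
  \<open>calculus_mult_1\<close> gives the diagonal action on \<eta>, and naturality along b
  \<mapsto> b x turns it into the diagonal action on C \<otimes> M.\<close>

lemma \<Phi>_form_mult:
  assumes \<omega>: "\<omega> \<in> carrier (T n B)" and u: "u \<in> carrier (FT M 1)"
  shows "\<Phi> M (Suc n) (fmult M n \<omega> u) =
    lift (T (Suc n) M) (\<lambda>cs b. pre M (Suc n) cs (dact M b (\<Phi> M 1 u))) \<omega>"
proof -
  let ?W = "T (Suc n) M"
  have "\<Phi> M (Suc n) (fmult M n \<omega> u) =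
    lin_ext K ?W (\<lambda>(\<eta>, x). \<Phi> M (Suc n) (fp M (Suc n) (gm n 1 \<omega> \<eta>) x)) u"
    unfolding form_mult_eq Suc_eq_plus1[symmetric]
    by (rule FT_linear_map_lift[OF module_FT _ \<Phi>_linear _ u])
      (simp_all add: fp_closed calculus_mult_1_closed \<omega> module_M)
  also have "\<dots> = lift ?W (\<lambda>cs b. pre M (Suc n) cs (dact M b (\<Phi> M 1 u))) \<omega>"
  proof (rule FT_lift_eqI[OF _ _ _ u])
    show "linear_map K (FT M 1) ?W
      (\<lambda>u. lift ?W (\<lambda>cs b. pre M (Suc n) cs (dact M b (\<Phi> M 1 u))) \<omega>)"
      by (intro lift_param_linear[OF module_B module_FT _ _ \<omega>]
          linear_map_comp[OF \<Phi>_linear linear_map_comp[OF diag_act_linear2[OF bilinear_action_act]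
              pre_linear]])
        (auto simp: module_M)
    fix \<eta> x assume \<eta>: "\<eta> \<in> carrier (T 1 B)" and x: "x \<in> carrier M"
    note al = act_linear1[OF x]
    have "\<Phi> M (Suc n) (fp M (Suc n) (gm n 1 \<omega> \<eta>) x) = ev M (Suc n) x (gm n 1 \<omega> \<eta>)"
      by (rule \<Phi>_fp) (simp_all add: \<omega> \<eta> x calculus_mult_1_closed)
    also have "\<dots> = lift ?W (\<lambda>cs b. ev M (Suc n) x (pre B (Suc n) cs (diag_act B \<mu> b \<eta>))) \<omega>"
      unfolding calculus_mult_1[OF \<omega> \<eta>]
      by (rule linear_map_lift[OF module_B _ _ tmap_linear[OF module_B module_M al] _ \<omega>])
        (simp_all add: module_M pre_closed[where n = 1] diag_act_closed[OF bilinear_action_mult] \<eta>)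
    also have "\<dots> = lift ?W (\<lambda>cs b. pre M (Suc n) cs (dact M b (\<Phi> M 1 (fp M 1 \<eta> x)))) \<omega>"
    proof (rule lift_cong[OF module_B _ _ _ \<omega>])
      fix cs b assume *: "length cs = n" "set cs \<subseteq> carrier C" "b \<in> carrier B"
      have d: "diag_act B \<mu> b \<eta> \<in> carrier (T 1 B)"
        using * \<eta> by (simp add: diag_act_closed[OF bilinear_action_mult])
      then have "pre B (Suc n) cs (diag_act B \<mu> b \<eta>) \<in> carrier (T (Suc n) B)"
        using * by (intro pre_closed[where n = 1]) auto
      then show "ev M (Suc n) x (pre B (Suc n) cs (diag_act B \<mu> b \<eta>)) \<in> carrier ?W"
        by (rule linear_map_closed[OF tmap_linear[OF module_B module_M al]])
      have "ev M (Suc n) x (pre B (Suc n) cs (diag_act B \<mu> b \<eta>)) =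
        pre M (Suc n) cs (ev M 1 x (diag_act B \<mu> b \<eta>))"
        by (rule tmap_pre[OF module_B module_M al]) (use * d in auto)
      then show "ev M (Suc n) x (pre B (Suc n) cs (diag_act B \<mu> b \<eta>)) =
        pre M (Suc n) cs (dact M b (\<Phi> M 1 (fp M 1 \<eta> x)))"
        using * x \<eta> by (simp add: tmap_diag_act \<Phi>_fp)
    qed (simp add: module_M)
    finally show "\<Phi> M (Suc n) (fp M (Suc n) (gm n 1 \<omega> \<eta>) x) =
      lift ?W (\<lambda>cs b. pre M (Suc n) cs (dact M b (\<Phi> M 1 (fp M 1 \<eta> x)))) \<omega>" .
  qed (simp add: module_M)
  finally show ?thesis .
qed

text \<open>Naturality of the diagonal action along b \<mapsto> b x, a map that sends 1 to
  x.\<close>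

lemma tmap_dunit:
  assumes "b \<in> carrier B" "x \<in> carrier M"
  shows "ev M 1 x (dunit b) = dact M b (\<tau> M [\<II>] x)"
  using assms
  by (simp add: dunit_def tmap_diag_act tmap_pt[OF module_B module_M act_linear1] act_one)

lemma gdiff_eq: "\<omega> \<in> carrier (T n B) \<Longrightarrow> gdiff \<Omega> n \<omega> = aug_cobar B dunit n \<omega>"
  by (simp add: calculus_def calculus_diff)

lemma gdiff_closed: "\<omega> \<in> carrier (T n B) \<Longrightarrow> gdiff \<Omega> n \<omega> \<in> carrier (T (Suc n) B)"
  by (simp add: gdiff_eq aug_cobar_closed[OF module_B dunit_linear])

lemma incl_eq: "incl \<Omega> b = \<tau> B [] b"
  by (simp add: calculus_def)

text \<open>Since d b = \<open>dunit b\<close> - \<II> \<otimes> b, the first part of d b joins the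
  product term under one diagonal action. For \<Phi>(u) = \<rho> x - \<II> \<otimes> x the
  right-hand side is b \<cdot> \<rho> x - \<II> \<otimes> b x.\<close>

lemma \<Phi>_leibniz:
  assumes b: "b \<in> carrier B" and x: "x \<in> carrier M" and u: "u \<in> carrier (FT M 1)"
  shows "\<Phi> M 1 (fmult M 0 (incl \<Omega> b) u \<oplus>\<^bsub>FT M 1\<^esub> fp M 1 (gdiff \<Omega> 0 (incl \<Omega> b)) x) =
    dact M b (\<Phi> M 1 u \<oplus>\<^bsub>T 1 M\<^esub> \<tau> M [\<II>] x) \<ominus>\<^bsub>T 1 M\<^esub> \<tau> M [\<II>] (act M b x)"
proof -
  interpret W: module K "T 1 M" by (simp add: module_M)
  note E = diag_act_linear2[OF bilinear_action_act b]
  note al = act_linear1[OF x]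
  have p: "\<tau> B [] b \<in> carrier (T 0 B)" using b by simp
  note fm = form_mult_closed[OF p u]
  have 1: "\<Phi> M 1 (fmult M 0 (\<tau> B [] b) u) = dact M b (\<Phi> M 1 u)"
  proof -
    have "\<Phi> M 1 (fmult M 0 (\<tau> B [] b) u) =
      lift (T 1 M) (\<lambda>cs b. pre M 1 cs (dact M b (\<Phi> M 1 u))) (\<tau> B [] b)"
      using \<Phi>_form_mult[OF p u] by simp
    also have "\<dots> = pre M 1 [] (dact M b (\<Phi> M 1 u))"
      using b prol_multilinear[OF bilinear_action_act \<Phi>_closed[OF u], of 0]
      by (intro lift_pt[where n = 0]) (simp_all add: module_M)
    also have "\<dots> = dact M b (\<Phi> M 1 u)"
      by (rule pre_Nil[OF module_M linear_map_closed[OF E \<Phi>_closed[OF u]]])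
    finally show ?thesis .
  qed
  have d: "gdiff \<Omega> 0 (\<tau> B [] b) = dunit b \<ominus>\<^bsub>T 1 B\<^esub> \<tau> B [\<II>] b"
    using b by (simp add: gdiff_eq[OF p] aug_cobar_def cobar_pt[OF module_B dunit_linear] pre_pt)
  have dc: "gdiff \<Omega> 0 (\<tau> B [] b) \<in> carrier (T 1 B)" using gdiff_closed[OF p] by simp
  have 2: "\<Phi> M 1 (fp M 1 (gdiff \<Omega> 0 (\<tau> B [] b)) x) =
      dact M b (\<tau> M [\<II>] x) \<ominus>\<^bsub>T 1 M\<^esub> \<tau> M [\<II>] (act M b x)"
    unfolding \<Phi>_fp[OF dc x] unfolding d
    by (subst linear_map_diff[OF _ _ tmap_linear[OF module_B module_M al]])
      (use b x in \<open>simp_all add: module_M linear_map_closed[OF dunit_linear] tmap_dunit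
        tmap_pt[OF module_B module_M al]\<close>)
  have c: "dact M b (\<tau> M [\<II>] x) \<in> carrier (T 1 M)" "\<tau> M [\<II>] (act M b x) \<in> carrier (T 1 M)"
    "dact M b (\<Phi> M 1 u) \<in> carrier (T 1 M)" "\<tau> M [\<II>] x \<in> carrier (T 1 M)"
    using b x u by (simp_all add: linear_map_closed[OF E] module_M act_closed \<Phi>_closed)
  have "\<Phi> M 1 (fmult M 0 (\<tau> B [] b) u \<oplus>\<^bsub>FT M 1\<^esub> fp M 1 (gdiff \<Omega> 0 (\<tau> B [] b)) x) =
    dact M b (\<Phi> M 1 u) \<oplus>\<^bsub>T 1 M\<^esub>
      (dact M b (\<tau> M [\<II>] x) \<ominus>\<^bsub>T 1 M\<^esub> \<tau> M [\<II>] (act M b x))"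
    using fm fp_closed[OF dc x] by (simp add: linear_map_add[OF \<Phi>_linear] 1 2)
  then show ?thesis
    using c by (simp add: incl_eq linear_map_add[OF E] \<Phi>_closed[OF u] a_minus_def W.M.a_assoc)
qed

text \<open>The recursions for B with \<open>dunit\<close> and for M with \<rho> differ only at the
  end of the list, where by \<open>e\<close> the image of \<open>dunit b\<close> falls short of
  \<rho>(b x) by v. Each prefixed factor reverses the sign of this defect, hence
  \<open>sg n\<close>.\<close>

lemma tmap_cob:
  assumes x: "x \<in> carrier M" and \<rho>: "linear_map K M (T 1 M) \<rho>" and v: "v \<in> carrier (T 1 M)"
    and b: "b \<in> carrier B" and e: "ev M 1 x (dunit b) \<oplus>\<^bsub>T 1 M\<^esub> v = \<rho> (act M b x)"
    and "length cs = n" "set cs \<subseteq> carrier C"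
  shows "ev M (Suc n) x (cob B dunit cs b) \<oplus>\<^bsub>T (Suc n) M\<^esub>
    (sg n) \<odot>\<^bsub>T (Suc n) M\<^esub> pre M (Suc n) cs v = cob M \<rho> cs (act M b x)"
  using assms(6-)
proof (induction cs arbitrary: n)
  case Nil
  interpret W: module K "T 1 M" by (simp add: module_M)
  show ?case using Nil v by (simp add: pre_Nil[OF module_M] e)
next
  case (Cons c cs)
  define l where "l = length cs"
  have cs: "n = Suc l" "length cs = l" "c \<in> carrier C" "set cs \<subseteq> carrier C"
    using Cons.prems by (auto simp: l_def)
  let ?W = "T (Suc l) M" and ?W' = "T (Suc (Suc l)) M"
  interpret W: module K ?W by (simp add: module_M)
  interpret W': module K ?W' by (simp add: module_M)
  interpret V': module K "T (Suc (Suc l)) B" by simp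
  let ?s = "sg l"
  let ?f = "\<lambda>b. act M b x"
  let ?t = "tmap M (Suc (Suc l)) ?f" and ?pre = "pre M (Suc (Suc l)) [c]"
  note al = act_linear1[OF x]
  note tl = tmap_linear[OF module_B module_M al]
  have prelin: "linear_map K ?W ?W' ?pre" by (rule pre_linear) (use cs in \<open>auto simp: module_M\<close>)
  have s: "?s \<in> carrier K" by simp
  have pv: "pre M (Suc l) cs v \<in> carrier ?W"
    using cs v by (intro pre_closed[where n = 1]) (auto simp: module_M)
  have cb: "cob B dunit cs b \<in> carrier (T (Suc l) B)"
    by (rule cob_closed[OF module_B dunit_linear cs(2,4) b])
  have sw: "sw2 K (T (Suc (Suc l)) B) (comult C c) (\<lambda>y z. \<tau> B (y # z # cs) b)
      \<in> carrier (T (Suc (Suc l)) B)"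
    by (rule sw2_comult_closed) (use cs b in simp_all)
  have prb: "pre B (Suc (Suc l)) [c] (cob B dunit cs b) \<in> carrier (T (Suc (Suc l)) B)"
    using cb cs by (intro pre_closed[where n = "Suc l"]) auto
  have tsw: "?t (sw2 K (T (Suc (Suc l)) B) (comult C c) (\<lambda>y z. \<tau> B (y # z # cs) b)) =
    sw2 K ?W' (comult C c) (\<lambda>y z. \<tau> M (y # z # cs) (act M b x))"
  proof -
    have "?t (sw2 K (T (Suc (Suc l)) B) (comult C c) (\<lambda>y z. \<tau> B (y # z # cs) b)) =
      sw2 K ?W' (comult C c) (\<lambda>y z. ?t (\<tau> B (y # z # cs) b))"
      by (rule linear_map_sw2_comult[OF _ _ tl]) (use cs b in \<open>simp_all add: module_M\<close>)
    also have "\<dots> = sw2 K ?W' (comult C c) (\<lambda>y z. \<tau> M (y # z # cs) (act M b x))"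
      by (rule sw2_comult_cong) (use cs b x in \<open>simp_all add: module_M tmap_pt[OF module_B
          module_M al] act_closed\<close>)
    finally show ?thesis .
  qed
  have swM: "sw2 K ?W' (comult C c) (\<lambda>y z. \<tau> M (y # z # cs) (act M b x)) \<in> carrier ?W'"
    by (rule sw2_comult_closed) (use cs b x in \<open>simp_all add: module_M act_closed\<close>)
  have tpre: "?t (pre B (Suc (Suc l)) [c] (cob B dunit cs b))
      = ?pre (tmap M (Suc l) ?f (cob B dunit cs b))"
    by (rule tmap_pre[OF module_B module_M al _ _ cb]) (use cs in auto)
  have tc: "tmap M (Suc l) ?f (cob B dunit cs b) \<in> carrier ?W"
    by (rule linear_map_closed[OF tl cb])
  have pp: "pre M (Suc (Suc l)) (c # cs) v = ?pre (pre M (Suc l) cs v)"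
    using cs v by (subst pre_pre[where n = 1]) (auto simp: module_M)
  note pc = linear_map_closed[OF prelin]
  have "cob M \<rho> (c # cs) (act M b x) =
    sw2 K ?W' (comult C c) (\<lambda>y z. \<tau> M (y # z # cs) (act M b x)) \<ominus>\<^bsub>?W'\<^esub>
      ?pre (tmap M (Suc l) ?f (cob B dunit cs b) \<oplus>\<^bsub>?W\<^esub> ?s \<odot>\<^bsub>?W\<^esub> pre M (Suc l) cs v)"
    using Cons.IH[OF cs(2,4)] cs by simp
  also have "\<dots> = sw2 K ?W' (comult C c) (\<lambda>y z. \<tau> M (y # z # cs) (act M b x)) \<ominus>\<^bsub>?W'\<^esub>
      ?pre (tmap M (Suc l) ?f (cob B dunit cs b)) \<oplus>\<^bsub>?W'\<^esub> (\<ominus>\<^bsub>K\<^esub> ?s) \<odot>\<^bsub>?W'\<^esub> ?pre (pre M (Suc l) cs v)"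
    using swM pc[OF tc] pc[OF pv] tc pv s
    by (simp add: linear_map_add[OF prelin] linear_map_smult[OF prelin] a_minus_def W'.M.minus_add
        W'.M.a_assoc W'.smult_l_minus)
  also have "\<dots> = ?t (cob B dunit (c # cs) b) \<oplus>\<^bsub>?W'\<^esub> (sg (Suc l)) \<odot>\<^bsub>?W'\<^esub>
      pre M (Suc (Suc l)) (c # cs) v"
    using cs sw prb
    by (simp add: linear_map_diff[OF _ _ tl] module_M tsw tpre pp R.r_minus)
  finally show ?case using cs(1) by simp
qed

end

section \<open>Connections and coactions\<close>

text \<open>The pair D, \<rho> is linked by \<open>D_\<rho>\<close> alone and neither map is assumed
  linear, so that the equivalences below serve both directions of the correspondence.\<close>

context
  fixes M :: "('k, 'b, 'x) left_mod" and D and \<rho>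
  assumes LM: "left_module K B M"
    and D: "\<And>x. x \<in> carrier M \<Longrightarrow> D x \<in> carrier (FT M 1)"
    and \<rho>: "\<And>x. x \<in> carrier M \<Longrightarrow> \<rho> x \<in> carrier (T 1 M)"
    and D_\<rho>: "\<And>x. x \<in> carrier M \<Longrightarrow> \<Phi> M 1 (D x) = \<rho> x \<ominus>\<^bsub>T 1 M\<^esub> \<tau> M [\<II>] x"
begin

lemmas M [simp] = module_M[OF LM]

interpretation TM: module K "T n M" for n by simp
interpretation FM: module K "FT M n" for n by (rule module_FT[OF LM])

lemma \<rho>_eq: "x \<in> carrier M \<Longrightarrow> \<rho> x = \<Phi> M 1 (D x) \<oplus>\<^bsub>T 1 M\<^esub> \<tau> M [\<II>] x"
  using \<rho> by (simp add: D_\<rho> a_minus_def TM.M.a_assoc TM.M.l_neg)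

lemma D_eq: "x \<in> carrier M \<Longrightarrow> D x = \<Psi> M 1 (\<rho> x \<ominus>\<^bsub>T 1 M\<^esub> \<tau> M [\<II>] x)"
  using \<Psi>_\<Phi>[OF LM D] by (simp add: D_\<rho>)

lemma pt_II_linear: "linear_map K M (T 1 M) (\<lambda>x. \<tau> M [\<II>] x)"
  by (rule pt_last_linear) simp_all

lemma linear_iff: "linear_map K M (FT M 1) D \<longleftrightarrow> linear_map K M (T 1 M) \<rho>"
proof
  assume "linear_map K M (FT M 1) D"
  then have "linear_map K M (T 1 M) (\<lambda>x. \<Phi> M 1 (D x) \<oplus>\<^bsub>T 1 M\<^esub> \<tau> M [\<II>] x)"
    by (intro linear_map_plus pt_II_linear linear_map_comp[OF _ \<Phi>_linear[OF LM]]) simp_all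
  then show "linear_map K M (T 1 M) \<rho>" by (subst linear_map_cong[OF M \<rho>_eq])
next
  assume "linear_map K M (T 1 M) \<rho>"
  then have "linear_map K M (FT M 1) (\<lambda>x. \<Psi> M 1 (\<rho> x \<ominus>\<^bsub>T 1 M\<^esub> \<tau> M [\<II>] x))"
    by (intro linear_map_minus pt_II_linear linear_map_comp[OF _ \<Psi>_linear[OF LM]]) simp_all
  then show "linear_map K M (FT M 1) D" by (subst linear_map_cong[OF M D_eq])
qed

text \<open>After \<open>\<Phi>\<close> both sides of the Leibniz rule contain - \<II> \<otimes> b
  x; cancelling it leaves equivariance.\<close>

lemma leibniz_iff:
  assumes b: "b \<in> carrier B" and x: "x \<in> carrier M"
  shows "D (act M b x) = fmult M 0 (incl \<Omega> b) (D x) \<oplus>\<^bsub>FT M 1\<^esub> fp M 1 (gdiff \<Omega> 0 (incl \<Omega> b)) x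
    \<longleftrightarrow> \<rho> (act M b x) = dact M b (\<rho> x)"
proof -
  have bx: "act M b x \<in> carrier M" by (rule act_closed[OF LM b x])
  have p: "\<tau> B [] b \<in> carrier (T 0 B)" using b by simp
  have rhs: "fmult M 0 (incl \<Omega> b) (D x) \<oplus>\<^bsub>FT M 1\<^esub> fp M 1 (gdiff \<Omega> 0 (incl \<Omega> b)) x \<in> carrier (FT M 1)"
    using form_mult_closed[OF LM p D[OF x]] fp_closed[OF LM _ x] gdiff_closed[OF LM p]
    by (simp add: incl_eq[OF LM])
  have d: "dact M b (\<rho> x) \<in> carrier (T 1 M)"
    by (rule diag_act_closed[OF bilinear_action_act[OF LM] b \<rho>[OF x]])
  have I: "\<tau> M [\<II>] (act M b x) \<in> carrier (T 1 M)" using bx by simp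
  show ?thesis
    unfolding \<Phi>_eq_iff[OF LM D[OF bx] rhs, symmetric] \<Phi>_leibniz[OF LM b x D[OF x]]
      \<rho>_eq[OF x, symmetric] D_\<rho>[OF bx]
    using d I \<rho>[OF bx] by (simp add: a_minus_def)
qed

context
  assumes lin: "linear_map K M (T 1 M) \<rho>"
    and equiv: "\<And>b x. \<lbrakk>b \<in> carrier B; x \<in> carrier M\<rbrakk> \<Longrightarrow> \<rho> (act M b x) = dact M b (\<rho> x)"
begin

lemma conn_gen_closed:
  assumes \<omega>: "\<omega> \<in> carrier (T n B)" and x: "x \<in> carrier M"
  shows "fp M (Suc n) (gdiff \<Omega> n \<omega>) x \<in> carrier (FT M (Suc n))"
    "fmult M n \<omega> (D x) \<in> carrier (FT M (Suc n))"
  by (rule fp_closed[OF LM gdiff_closed[OF LM \<omega>] x]) (rule form_mult_closed[OF LM \<omega> D[OF x]])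

lemma conn_ext_eq: "cext M D n t = lin_ext K (FT M (Suc n))
    (\<lambda>(\<omega>, x). fp M (Suc n) (gdiff \<Omega> n \<omega>) x \<oplus>\<^bsub>FT M (Suc n)\<^esub>
      sg n \<odot>\<^bsub>FT M (Suc n)\<^esub> fmult M n \<omega> (D x)) t"
  by (simp add: conn_ext_def Let_def)

lemma conn_ext_closed: "t \<in> carrier (FT M n) \<Longrightarrow> cext M D n t \<in> carrier (FT M (Suc n))"
  unfolding conn_ext_eq
  by (rule FT_lift_closed[OF LM module_FT[OF LM]]) (simp_all add: conn_gen_closed)

text \<open>Checked on \<omega> = cs \<otimes> b by \<open>tmap_cob\<close> with v = b \<cdot>
  \<Phi>(D x): the differential of the calculus gives the \<II>-term and all of the cobar
  differential except the contribution of v, which comes from the product \<omega> D x.\<close>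

lemma \<Phi>_conn_gen:
  assumes \<omega>: "\<omega> \<in> carrier (T n B)" and x: "x \<in> carrier M"
  shows "\<Phi> M (Suc n) (fp M (Suc n) (gdiff \<Omega> n \<omega>) x \<oplus>\<^bsub>FT M (Suc n)\<^esub>
      sg n \<odot>\<^bsub>FT M (Suc n)\<^esub> fmult M n \<omega> (D x)) =
    aug_cobar M \<rho> n (ev M n x \<omega>)"
proof -
  let ?W = "T (Suc n) M"
  let ?f = "\<lambda>b. act M b x"
  define u where "u = \<Phi> M 1 (D x)"
  have u: "u \<in> carrier (T 1 M)" unfolding u_def by (rule \<Phi>_closed[OF LM D[OF x]])
  note al = act_linear1[OF LM x]
  note tl = tmap_linear[OF module_B M al]
  note ba = bilinear_action_act[OF LM]
  let ?P = "lift ?W (\<lambda>cs b. pre M (Suc n) cs (dact M b u))"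
  have m: "multilinear K C n B ?W (\<lambda>cs b. pre M (Suc n) cs (dact M b u))"
    by (rule prol_multilinear[OF ba u])
  have "\<Phi> M (Suc n) (fp M (Suc n) (gdiff \<Omega> n \<omega>) x \<oplus>\<^bsub>FT M (Suc n)\<^esub>
      sg n \<odot>\<^bsub>FT M (Suc n)\<^esub> fmult M n \<omega> (D x)) =
    tmap M (Suc n) ?f (aug_cobar B dunit n \<omega>) \<oplus>\<^bsub>?W\<^esub> sg n \<odot>\<^bsub>?W\<^esub> ?P \<omega>"
    using conn_gen_closed[OF \<omega> x] gdiff_closed[OF LM \<omega>] x
    by (simp add: linear_map_add[OF \<Phi>_linear[OF LM]] linear_map_smult[OF \<Phi>_linear[OF LM]] \<Phi>_fp[OF
        LM]
        \<Phi>_form_mult[OF LM \<omega> D[OF x]] u_def gdiff_eq[OF LM \<omega>])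
  also have "\<dots> = aug_cobar M \<rho> n (tmap M n ?f \<omega>)"
  proof (rule tens_eqI[OF module_B _ _ _ _ \<omega>])
    show "linear_map K (T n B) ?W (\<lambda>\<omega>. tmap M (Suc n) ?f (aug_cobar B dunit n \<omega>) \<oplus>\<^bsub>?W\<^esub> sg n \<odot>\<^bsub>?W\<^esub> ?P \<omega>)"
      by (intro linear_map_plus linear_map_scale lift_linear m
          linear_map_comp[OF aug_cobar_linear[OF module_B dunit_linear] tl]) simp_all
    show "linear_map K (T n B) ?W (\<lambda>\<omega>. aug_cobar M \<rho> n (tmap M n ?f \<omega>))"
      by (rule linear_map_comp[OF tl aug_cobar_linear[OF M lin]])
    fix cs b assume *: "length cs = n" "set cs \<subseteq> carrier C" "b \<in> carrier B"
    have bx: "act M b x \<in> carrier M" by (rule act_closed[OF LM *(3) x])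
    let ?v = "dact M b u"
    have v: "?v \<in> carrier (T 1 M)" by (rule diag_act_closed[OF ba *(3) u])
    \<comment> \<open>By equivariance \<rho>(b x) = b \<cdot> (u + \<II> \<otimes> x), and b \<cdot>
      (\<II> \<otimes> x) is the image of \<open>dunit b\<close>.\<close>
    have e: "tmap M 1 ?f (dunit b) \<oplus>\<^bsub>T 1 M\<^esub> ?v = \<rho> (act M b x)"
    proof -
      have I: "\<tau> M [\<II>] x \<in> carrier (T 1 M)" using x by simp
      have "\<rho> (act M b x) = dact M b (u \<oplus>\<^bsub>T 1 M\<^esub> \<tau> M [\<II>] x)"
        by (simp only: equiv[OF *(3) x] \<rho>_eq[OF x] u_def)
      also have "\<dots> = ?v \<oplus>\<^bsub>T 1 M\<^esub> dact M b (\<tau> M [\<II>] x)"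
        by (rule linear_map_add[OF diag_act_linear2[OF ba *(3)] u I])
      also have "\<dots> = dact M b (\<tau> M [\<II>] x) \<oplus>\<^bsub>T 1 M\<^esub> ?v"
        by (rule TM.M.a_comm[OF v diag_act_closed[OF ba *(3) I]])
      finally show ?thesis by (simp add: tmap_dunit[OF LM *(3) x])
    qed
    have c1: "cob B dunit cs b \<in> carrier (T (Suc n) B)"
      by (rule cob_closed[OF module_B dunit_linear *])
    have c2: "\<tau> B (\<II> # cs) b \<in> carrier (T (Suc n) B)" using * by simp
    have c3: "pre M (Suc n) cs ?v \<in> carrier ?W" using * v by (intro pre_closed[where n = 1]) auto
    have c4: "\<tau> M (\<II> # cs) (act M b x) \<in> carrier ?W" using * bx by simp
    have c5: "tmap M (Suc n) ?f (cob B dunit cs b) \<in> carrier ?W"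
        by (rule linear_map_closed[OF tl c1])
    have s: "sg n \<in> carrier K" by simp
    have "tmap M (Suc n) ?f (aug_cobar B dunit n (\<tau> B cs b)) =
        tmap M (Suc n) ?f (cob B dunit cs b) \<ominus>\<^bsub>?W\<^esub> \<tau> M (\<II> # cs) (act M b x)"
      using * c1 c2
      by (simp add: aug_cobar_def cobar_pt[OF module_B dunit_linear] pre_pt linear_map_diff[OF _ _
          tl]
          tmap_pt[OF module_B M al])
    moreover have "?P (\<tau> B cs b) = pre M (Suc n) cs ?v"
      using * by (intro lift_pt[OF module_B _ m]) simp_all
    ultimately have "tmap M (Suc n) ?f (aug_cobar B dunit n (\<tau> B cs b)) \<oplus>\<^bsub>?W\<^esub> sg n \<odot>\<^bsub>?W\<^esub> ?P (\<tau> B cs b) =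
      tmap M (Suc n) ?f (cob B dunit cs b) \<oplus>\<^bsub>?W\<^esub> sg n \<odot>\<^bsub>?W\<^esub> pre M (Suc n) cs ?v
        \<ominus>\<^bsub>?W\<^esub> \<tau> M (\<II> # cs) (act M b x)"
      using c3 c4 c5 s TM.smult_closed[OF s c3]
      by (simp add: a_minus_def TM.M.a_assoc TM.M.a_comm[of "\<ominus>\<^bsub>?W\<^esub> \<tau> M (\<II> # cs) (act M b x)"])
    also have "\<dots> = cob M \<rho> cs (act M b x) \<ominus>\<^bsub>?W\<^esub> \<tau> M (\<II> # cs) (act M b x)"
      by (simp only: tmap_cob[OF LM x lin v *(3) e *(1,2)])
    also have "\<dots> = aug_cobar M \<rho> n (tmap M n ?f (\<tau> B cs b))"
      using * bx by (simp add: tmap_pt[OF module_B M al] aug_cobar_def cobar_pt[OF M lin] pre_pt)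
    finally show "tmap M (Suc n) ?f (aug_cobar B dunit n (\<tau> B cs b)) \<oplus>\<^bsub>?W\<^esub> sg n \<odot>\<^bsub>?W\<^esub> ?P (\<tau> B cs b)
        = \<dots>" .
  qed simp
  finally show ?thesis .
qed

text \<open>The formula of \<open>conn_ext\<close> on generators becomes, after
  \<open>\<Phi>\<close>, the restriction of a map already linear on the balanced tensor product; its
  compatibility with balancing comes from there.\<close>

lemma \<Phi>_conn_ext:
  assumes t: "t \<in> carrier (FT M n)"
  shows "\<Phi> M (Suc n) (cext M D n t) = aug_cobar M \<rho> n (\<Phi> M n t)"
proof -
  have "\<Phi> M (Suc n) (cext M D n t) = lin_ext K (T (Suc n) M)
      (\<lambda>(\<omega>, x). \<Phi> M (Suc n) (fp M (Suc n) (gdiff \<Omega> n \<omega>) x \<oplus>\<^bsub>FT M (Suc n)\<^esub>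
        sg n \<odot>\<^bsub>FT M (Suc n)\<^esub> fmult M n \<omega> (D x))) t"
    unfolding conn_ext_eq
    by (rule FT_linear_map_lift[OF LM module_FT[OF LM] _ \<Phi>_linear[OF LM] _ t])
      (simp_all add: conn_gen_closed)
  also have "\<dots> = aug_cobar M \<rho> n (\<Phi> M n t)"
    by (rule FT_lift_eqI[OF LM _ linear_map_comp[OF \<Phi>_linear[OF LM] aug_cobar_linear[OF M lin]] _
        t])
      (simp_all add: \<Phi>_conn_gen \<Phi>_fp[OF LM])
  finally show ?thesis .
qed

lemma \<Phi>_zero: "\<Phi> M n \<zero>\<^bsub>FT M n\<^esub> = \<zero>\<^bsub>T n M\<^esub>"
  by (rule linear_map_zero[OF module_FT[OF LM] _ \<Phi>_linear[OF LM]]) simp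

text \<open>Injectivity of \<open>\<Phi>\<close> turns a vanishing cobar square into flatness.
  Conversely, flatness in degree zero already gives coassociativity.\<close>

lemma flat_iff: "flat K B \<Omega> M D \<longleftrightarrow> coassociative M \<rho>"
proof -
  have sq: "\<Phi> M (Suc (Suc n)) (cext M D (Suc n) (cext M D n t)) =
      cobar M \<rho> (Suc n) (cobar M \<rho> n (\<Phi> M n t))" if "t \<in> carrier (FT M n)" for n t
    using that
    by (simp add: \<Phi>_conn_ext conn_ext_closed aug_cobar_aug_cobar[OF M lin] \<Phi>_closed[OF LM])
  show ?thesis
  proof
    assume flat: "flat K B \<Omega> M D"
    have "cobar M \<rho> 1 (\<rho> x) = \<zero>\<^bsub>T 2 M\<^esub>" if x: "x \<in> carrier M" for x
    proof -
      \<comment> \<open>The form 1 \<otimes> x of degree zero, whose image is x; the degree-zero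
        cobar differential sends x to \<rho> x.\<close>
      let ?t = "\<Psi> M 0 (\<tau> M [] x)"
      have p: "\<tau> M [] x \<in> carrier (T 0 M)" using x by simp
      note t = \<Psi>_closed[OF LM p]
      have "cext M D (0 + 1) (cext M D 0 ?t) = \<zero>\<^bsub>FT M (0 + 2)\<^esub>"
        using flat t unfolding flat_def by blast
      then have "\<zero>\<^bsub>T 2 M\<^esub> = cobar M \<rho> 1 (cobar M \<rho> 0 (\<Phi> M 0 ?t))"
        using sq[OF t] by (simp add: \<Phi>_zero)
      then show ?thesis using x by (simp add: \<Phi>_\<Psi>[OF LM p] cobar_pt[OF M lin])
    qed
    then show "coassociative M \<rho>" by (simp add: coassociative_iff[OF M lin])
  next
    assume co: "coassociative M \<rho>"
    show "flat K B \<Omega> M D"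
      unfolding flat_def
    proof (intro allI ballI)
      fix n t assume t: "t \<in> carrier (FT M n)"
      have "\<Phi> M (Suc (Suc n)) (cext M D (Suc n) (cext M D n t)) =
        \<Phi> M (Suc (Suc n)) \<zero>\<^bsub>FT M (Suc (Suc n))\<^esub>"
        unfolding sq[OF t] \<Phi>_zero using cobar_cobar[OF M lin co \<Phi>_closed[OF LM t]] by simp
      then have "cext M D (Suc n) (cext M D n t) = \<zero>\<^bsub>FT M (Suc (Suc n))\<^esub>"
        by (subst (asm) \<Phi>_eq_iff[OF LM conn_ext_closed[OF conn_ext_closed[OF t]] FM.M.zero_closed])
      then show "cext M D (n + 1) (cext M D n t) = \<zero>\<^bsub>FT M (n + 2)\<^esub>" by simp
    qed
  qed
qed

end

text \<open>\<open>flat_iff\<close> presupposes that \<rho> is linear and commutes with B. Being a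
  connection supplies this on one side, equivariance on the other.\<close>

lemma flat_connection_iff:
  "connection K B \<Omega> M D \<and> flat K B \<Omega> M D \<longleftrightarrow> equivariant M \<rho>"
proof -
  have "equivariant M \<rho> \<longleftrightarrow> linear_map K M (T 1 M) \<rho> \<and> coassociative M \<rho> \<and>
    (\<forall>b\<in>carrier B. \<forall>x\<in>carrier M. \<rho> (act M b x) = dact M b (\<rho> x))"
    using LM M by (auto simp: equivariant_comodule_def left_comodule_def coassociative_def
        diag_act_def)
  moreover have "connection K B \<Omega> M D \<longleftrightarrow> linear_map K M (T 1 M) \<rho> \<and>
    (\<forall>b\<in>carrier B. \<forall>x\<in>carrier M. \<rho> (act M b x) = dact M b (\<rho> x))"
    by (auto simp: connection_def linear_iff leibniz_iff)
  ultimately show ?thesis using flat_iff by auto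
qed

end

end

section \<open>The equivalence\<close>

text \<open>Both functors are the identity on morphisms. G (F X) may differ from X, as long as
  composition does not notice the difference and the identity of X is a morphism in both directions;
  it then serves as the component of the natural isomorphism.\<close>

lemma equivalent_categoriesI:
  fixes \<C> :: "('o, 'm) category_data" and \<D> :: "('p, 'm) category_data"
  assumes cat: "category \<C>"
    and F: "\<And>X. X \<in> Obj \<C> \<Longrightarrow> F X \<in> Obj \<D>" and G: "\<And>Y. Y \<in> Obj \<D> \<Longrightarrow> G Y \<in> Obj \<C>"
    and Hom_F: "\<And>X Y. \<lbrakk>X \<in> Obj \<C>; Y \<in> Obj \<C>\<rbrakk> \<Longrightarrow> Hom \<D> (F X) (F Y) = Hom \<C> X Y"
    and Hom_G: "\<And>X Y. \<lbrakk>X \<in> Obj \<D>; Y \<in> Obj \<D>\<rbrakk> \<Longrightarrow> Hom \<C> (G X) (G Y) = Hom \<D> X Y"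
    and Ident_F: "\<And>X. X \<in> Obj \<C> \<Longrightarrow> Ident \<D> (F X) = Ident \<C> X"
    and Ident_G: "\<And>X. X \<in> Obj \<D> \<Longrightarrow> Ident \<C> (G X) = Ident \<D> X"
    and Comp_F: "\<And>X Y Z. \<lbrakk>X \<in> Obj \<C>; Y \<in> Obj \<C>; Z \<in> Obj \<C>\<rbrakk> \<Longrightarrow> Comp \<D> (F X) (F Y) (F Z)
        = Comp \<C> X Y Z"
    and Comp_G: "\<And>X Y Z. \<lbrakk>X \<in> Obj \<D>; Y \<in> Obj \<D>; Z \<in> Obj \<D>\<rbrakk> \<Longrightarrow> Comp \<C> (G X) (G Y) (G Z)
        = Comp \<D> X Y Z"
    and Comp_GF: "\<And>X Y Z. \<lbrakk>X \<in> Obj \<C>; Y \<in> Obj \<C>; Z \<in> Obj \<C>\<rbrakk> \<Longrightarrow>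
      Comp \<C> (G (F X)) Y Z = Comp \<C> X Y Z \<and> Comp \<C> X (G (F Y)) Z = Comp \<C> X Y Z \<and>
      Comp \<C> X Y (G (F Z)) = Comp \<C> X Y Z"
    and unit: "\<And>X. X \<in> Obj \<C> \<Longrightarrow> Ident \<C> X \<in> Hom \<C> X (G (F X)) \<and> Ident \<C> X \<in> Hom \<C> (G (F X)) X"
  shows "equivalent_categories \<C> \<D>"
proof -
  interpret C: category \<C> by (rule cat)
  note G_simps = G Hom_G[symmetric] Ident_G[symmetric] Comp_G[symmetric]
  \<comment> \<open>The category laws of \<D> are those of \<C>, read through G.\<close>
  interpret D: category \<D>
    by unfold_locales (auto simp: G_simps
        intro: C.ident_hom C.comp_hom C.ident_left C.ident_right C.comp_assoc)
  have "cat_functor \<C> \<D> F (\<lambda>X Y f. f)"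
    by unfold_locales (simp_all add: F Hom_F Ident_F Comp_F)
  moreover have "cat_functor \<D> \<C> G (\<lambda>X Y f. f)"
    by unfold_locales (simp_all add: G Hom_G Ident_G Comp_G)
  moreover have "natural_iso \<C> \<C> (\<lambda>X. X) (\<lambda>X Y f. f) (\<lambda>X. G (F X)) (\<lambda>X Y f. f) (Ident \<C>)"
    unfolding natural_iso_def
  proof (intro conjI ballI)
    fix X assume X: "X \<in> Obj \<C>"
    have "Comp \<C> X X X (Ident \<C> X) (Ident \<C> X) = Ident \<C> X"
      by (rule C.ident_left[OF X X C.ident_hom[OF X]])
    moreover have "Ident \<C> (G (F X)) = Ident \<C> X" by (simp add: Ident_G F X Ident_F)
    ultimately show "cat_iso \<C> X (G (F X)) (Ident \<C> X)"
      using X unit[OF X] F G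
      by (auto simp: cat_iso_def Comp_GF intro!: bexI[of _ "Ident \<C> X"])
    fix Y f assume "Y \<in> Obj \<C>" "f \<in> Hom \<C> X Y"
    with X show "Comp \<C> X Y (G (F Y)) (Ident \<C> Y) f = Comp \<C> X (G (F X)) (G (F Y)) f (Ident \<C> X)"
      by (simp add: Comp_GF F G C.ident_left C.ident_right)
  qed
  moreover have "natural_iso \<D> \<D> (\<lambda>Y. F (G Y)) (\<lambda>X Y f. f) (\<lambda>Y. Y) (\<lambda>X Y f. f) (Ident \<D>)"
    unfolding natural_iso_def
  proof (intro conjI ballI)
    fix X assume X: "X \<in> Obj \<D>"
    \<comment> \<open>The unit at G X goes between G X and G (F (G X)); by \<open>Hom_G\<close> such
      morphisms are the morphisms between X and F (G X).\<close>
    have u: "Ident \<D> X \<in> Hom \<D> (F (G X)) X" "Ident \<D> X \<in> Hom \<D> X (F (G X))"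
      using unit[OF G[OF X]] X F G by (simp_all add: Hom_G[symmetric] Ident_G)
    have "Comp \<D> X X X (Ident \<D> X) (Ident \<D> X) = Ident \<D> X"
      by (rule D.ident_left[OF X X D.ident_hom[OF X]])
    moreover have "Ident \<D> (F (G X)) = Ident \<D> X" by (simp add: Ident_G G X Ident_F)
    ultimately show "cat_iso \<D> (F (G X)) X (Ident \<D> X)"
      using X u F G
      by (auto simp: cat_iso_def Comp_GF Comp_G[symmetric] intro!: bexI[of _ "Ident \<D> X"])
    fix Y f assume "Y \<in> Obj \<D>" "f \<in> Hom \<D> X Y"
    with X show "Comp \<D> (F (G X)) (F (G Y)) Y (Ident \<D> Y) f = Comp \<D> (F (G X)) X Y f (Ident \<D> X)"
      using D.ident_left D.ident_right F G
      by (simp add: Comp_GF Comp_G[symmetric])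
  qed
  ultimately show ?thesis unfolding equivalent_categories_def by blast
qed

section \<open>The functors between comodules and connections\<close>

context equivariant_setting
begin

definition conn_of where
  "conn_of M \<rho> x = \<Psi> M 1 (\<rho> x \<ominus>\<^bsub>T 1 M\<^esub> \<tau> M [\<II>] x)"

definition coact_of where
  "coact_of M D x = \<Phi> M 1 (D x) \<oplus>\<^bsub>T 1 M\<^esub> \<tau> M [\<II>] x"

lemma
  assumes LM: "left_module K B M" and x: "x \<in> carrier M"
  shows conn_of_closed: "\<rho> x \<in> carrier (T 1 M) \<Longrightarrow> conn_of M \<rho> x \<in> carrier (FT M 1)"
    and \<Phi>_conn_of: "\<rho> x \<in> carrier (T 1 M) \<Longrightarrow> \<Phi> M 1 (conn_of M \<rho> x) = \<rho> x \<ominus>\<^bsub>T 1 M\<^esub> \<tau> M [\<II>] x"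
    and coact_of_closed: "D x \<in> carrier (FT M 1) \<Longrightarrow> coact_of M D x \<in> carrier (T 1 M)"
    and \<Phi>_coact_of: "D x \<in> carrier (FT M 1) \<Longrightarrow> \<Phi> M 1 (D x) = coact_of M D x \<ominus>\<^bsub>T 1 M\<^esub> \<tau> M [\<II>] x"
    and coact_conn: "\<rho> x \<in> carrier (T 1 M) \<Longrightarrow> coact_of M (conn_of M \<rho>) x = \<rho> x"
proof -
  note M [simp] = module_M[OF LM]
  interpret W: module K "T 1 M" by simp
  have I: "\<tau> M [\<II>] x \<in> carrier (T 1 M)" using x by simp
  show "conn_of M \<rho> x \<in> carrier (FT M 1)" "\<Phi> M 1 (conn_of M \<rho> x) = \<rho> x \<ominus>\<^bsub>T 1 M\<^esub> \<tau> M [\<II>] x"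
    "coact_of M (conn_of M \<rho>) x = \<rho> x" if "\<rho> x \<in> carrier (T 1 M)"
    using that I
    by (simp_all add: conn_of_def coact_of_def \<Psi>_closed[OF LM] \<Phi>_\<Psi>[OF LM] a_minus_def W.M.a_assoc
        W.M.l_neg)
  show "coact_of M D x \<in> carrier (T 1 M)" "\<Phi> M 1 (D x) = coact_of M D x \<ominus>\<^bsub>T 1 M\<^esub> \<tau> M [\<II>] x"
    if "D x \<in> carrier (FT M 1)"
    using I \<Phi>_closed[OF LM that] by (simp_all add: coact_of_def a_minus_def W.M.a_assoc W.M.r_neg)
qed

lemma sw2_eq_tmap:
  assumes "module K X" "module K Y" "linear_map K X Y f" "t \<in> carrier (T 1 X)"
  shows "sw2 K (T 1 Y) t (\<lambda>c y. \<tau> Y [c] (f y)) = tmap Y 1 f t"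
  unfolding sw2_def tmap_def
  by (rule lift_cong[OF assms(1) _ _ _ assms(4)])
    (use assms linear_map_closed[OF assms(3)] in \<open>auto simp: length_eq_1\<close>)

text \<open>Naturality of \<open>\<Phi>\<close> in the module: on \<omega> \<otimes> y it is the
  B-linearity of f.\<close>

lemma \<Phi>_natural:
  assumes LX: "left_module K B X" and LY: "left_module K B Y" and f: "linear_map K X Y f"
    and fa: "\<And>b x. \<lbrakk>b \<in> carrier B; x \<in> carrier X\<rbrakk> \<Longrightarrow> f (act X b x) = act Y b (f x)"
    and u: "u \<in> carrier (FT X 1)"
  shows "\<Phi> Y 1 (lin_ext K (FT Y 1) (\<lambda>(\<omega>, y). fp Y 1 \<omega> (f y)) u) = tmap Y 1 f (\<Phi> X 1 u)"
    and "lin_ext K (FT Y 1) (\<lambda>(\<omega>, y). fp Y 1 \<omega> (f y)) u \<in> carrier (FT Y 1)"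
proof -
  note X = module_M[OF LX] and Y = module_M[OF LY]
  note fc = linear_map_closed[OF f]
  show "lin_ext K (FT Y 1) (\<lambda>(\<omega>, y). fp Y 1 \<omega> (f y)) u \<in> carrier (FT Y 1)"
    by (rule FT_lift_closed[OF LX module_FT[OF LY] _ u]) (simp add: fp_closed[OF LY] fc)
  have "\<Phi> Y 1 (lin_ext K (FT Y 1) (\<lambda>(\<omega>, y). fp Y 1 \<omega> (f y)) u) =
    lin_ext K (T 1 Y) (\<lambda>(\<omega>, y). \<Phi> Y 1 (fp Y 1 \<omega> (f y))) u"
    by (rule FT_linear_map_lift[OF LX module_FT[OF LY] _ \<Phi>_linear[OF LY] _ u])
      (simp_all add: fp_closed[OF LY] fc Y)
  also have "\<dots> = tmap Y 1 f (\<Phi> X 1 u)"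
  proof (rule FT_lift_eqI[OF LX _ linear_map_comp[OF \<Phi>_linear[OF LX] tmap_linear[OF X Y f]] _ u])
    fix \<omega> y assume \<omega>: "\<omega> \<in> carrier (T 1 B)" and y: "y \<in> carrier X"
    have "tmap Y 1 f (ev X 1 y \<omega>) = tmap Y 1 (\<lambda>b. f (act X b y)) \<omega>"
      by (rule tmap_tmap[OF module_B X Y act_linear1[OF LX y] f \<omega>])
    also have "\<dots> = tmap Y 1 (\<lambda>b. act Y b (f y)) \<omega>"
      by (rule tmap_cong[OF module_B Y linear_map_comp[OF act_linear1[OF LX y] f] _ \<omega>])
          (simp add: fa y)
    finally show "\<Phi> Y 1 (fp Y 1 \<omega> (f y)) = tmap Y 1 f (\<Phi> X 1 (fp X 1 \<omega> y))"
      using \<omega> y by (simp add: \<Phi>_fp[OF LX] \<Phi>_fp[OF LY] fc)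
  qed (simp add: Y)
  finally show "\<Phi> Y 1 (lin_ext K (FT Y 1) (\<lambda>(\<omega>, y). fp Y 1 \<omega> (f y)) u) = tmap Y 1 f (\<Phi> X 1 u)" .
qed

text \<open>id \<otimes> f sends \<II> \<otimes> x to \<II> \<otimes> f x, so the correction terms
  agree on both sides and cancel.\<close>

lemma intertwines_iff:
  assumes LX: "left_module K B X" and LY: "left_module K B Y" and f: "linear_map K X Y f"
    and fa: "\<And>b x. \<lbrakk>b \<in> carrier B; x \<in> carrier X\<rbrakk> \<Longrightarrow> f (act X b x) = act Y b (f x)"
    and x: "x \<in> carrier X"
    and Dx: "D x \<in> carrier (FT X 1)" and Ex: "E (f x) \<in> carrier (FT Y 1)"
    and \<rho>x: "\<rho> x \<in> carrier (T 1 X)" and \<sigma>x: "\<sigma> (f x) \<in> carrier (T 1 Y)"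
    and D: "\<Phi> X 1 (D x) = \<rho> x \<ominus>\<^bsub>T 1 X\<^esub> \<tau> X [\<II>] x"
    and E: "\<Phi> Y 1 (E (f x)) = \<sigma> (f x) \<ominus>\<^bsub>T 1 Y\<^esub> \<tau> Y [\<II>] (f x)"
  shows "E (f x) = lin_ext K (FT Y 1) (\<lambda>(\<omega>, y). fp Y 1 \<omega> (f y)) (D x) \<longleftrightarrow>
    \<sigma> (f x) = sw2 K (T 1 Y) (\<rho> x) (\<lambda>c y. \<tau> Y [c] (f y))"
proof -
  note X [simp] = module_M[OF LX] and Y [simp] = module_M[OF LY]
  interpret W: module K "T 1 Y" by simp
  have fx: "f x \<in> carrier Y" by (rule linear_map_closed[OF f x])
  have t: "tmap Y 1 f (\<rho> x \<ominus>\<^bsub>T 1 X\<^esub> \<tau> X [\<II>] x) = tmap Y 1 f (\<rho> x) \<ominus>\<^bsub>T 1 Y\<^esub> \<tau> Y [\<II>] (f x)"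
    using x \<rho>x by (simp add: linear_map_diff[OF _ _ tmap_linear[OF X Y f]] tmap_pt[OF X Y f])
  have tc: "tmap Y 1 f (\<rho> x) \<in> carrier (T 1 Y)"
      by (rule linear_map_closed[OF tmap_linear[OF X Y f] \<rho>x])
  have "E (f x) = lin_ext K (FT Y 1) (\<lambda>(\<omega>, y). fp Y 1 \<omega> (f y)) (D x) \<longleftrightarrow>
      \<Phi> Y 1 (E (f x)) = \<Phi> Y 1 (lin_ext K (FT Y 1) (\<lambda>(\<omega>, y). fp Y 1 \<omega> (f y)) (D x))"
    by (rule \<Phi>_eq_iff[OF LY Ex \<Phi>_natural(2)[OF LX LY f fa Dx], symmetric])
  also have "\<dots> \<longleftrightarrow> \<sigma> (f x) \<ominus>\<^bsub>T 1 Y\<^esub> \<tau> Y [\<II>] (f x) = tmap Y 1 f (\<rho> x) \<ominus>\<^bsub>T 1 Y\<^esub> \<tau> Y [\<II>] (f x)"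
    by (simp only: \<Phi>_natural(1)[OF LX LY f fa Dx] D E t)
  also have "\<dots> \<longleftrightarrow> \<sigma> (f x) = sw2 K (T 1 Y) (\<rho> x) (\<lambda>c y. \<tau> Y [c] (f y))"
    unfolding sw2_eq_tmap[OF X Y f \<rho>x] using fx tc \<sigma>x by (simp add: a_minus_def)
  finally show ?thesis .
qed

abbreviation "Comod \<equiv> equivariant_comodule_cat K B C la ra \<alpha> \<beta>"
abbreviation "Conn \<equiv> flat_connection_cat K B \<Omega>"

lemma Obj_Comod:
  "(X, \<rho>) \<in> Obj Comod \<longleftrightarrow> equivariant X \<rho>"
  by (simp add: equivariant_comodule_cat_def)

lemma comoduleD:
  assumes "equivariant X \<rho>"
  shows "left_module K B X" "linear_map K X (T 1 X) \<rho>" "x \<in> carrier X \<Longrightarrow> \<rho> x \<in> carrier (T 1 X)"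
  using assms linear_map_closed[of K X "T 1 X" \<rho> x]
  by (auto simp: equivariant_comodule_def left_comodule_def)

lemma connD:
  assumes "(M, D) \<in> Obj Conn"
  shows "left_module K B M" "connection K B \<Omega> M D" "flat K B \<Omega> M D"
    "x \<in> carrier M \<Longrightarrow> D x \<in> carrier (FT M 1)"
  using assms linear_map_closed[of K M "FT M 1" D x]
  by (auto simp: flat_connection_cat_def connection_def)

text \<open>Restates compatibility with the coactions by \<open>tmap\<close>, whose functoriality
  then yields closure under composition.\<close>

lemma Hom_Comod:
  assumes "equivariant X \<rho>" "equivariant Y \<sigma>"
  shows "f \<in> Hom Comod (X, \<rho>) (Y, \<sigma>) \<longleftrightarrow> f \<in> extensional (carrier X) \<and> linear_map K X Y f \<and>
    (\<forall>b\<in>carrier B. \<forall>x\<in>carrier X. f (act X b x) = act Y b (f x)) \<and>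
    (\<forall>x\<in>carrier X. \<sigma> (f x) = tmap Y 1 f (\<rho> x))"
proof -
  note X = comoduleD[OF assms(1)] and Y = comoduleD[OF assms(2)]
  show ?thesis
    using sw2_eq_tmap[OF module_M[OF X(1)] module_M[OF Y(1)] _ X(3)]
    by (auto simp: equivariant_comodule_cat_def)
qed

text \<open>Formulated for two coactions that agree on the carrier, because going to connections and
  back may change values outside it.\<close>

lemma Ident_in_Hom:
  assumes "equivariant X \<rho>" "equivariant X \<sigma>"
    "\<And>x. x \<in> carrier X \<Longrightarrow> \<rho> x = \<sigma> x"
  shows "Ident Comod (X, \<rho>) \<in> Hom Comod (X, \<rho>) (X, \<sigma>)"
proof -
  note X = comoduleD[OF assms(1)]
  have l: "linear_map K X X (\<lambda>x\<in>carrier X. x)"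
    by (rule iffD1[OF linear_map_cong[OF module_M[OF X(1)]] linear_map_id]) simp
  have "\<sigma> x = tmap X 1 (\<lambda>x\<in>carrier X. x) (\<rho> x)" if "x \<in> carrier X" for x
    using tmap_ident[OF module_M[OF X(1)] X(3)[OF that], of "\<lambda>x\<in>carrier X. x"] assms(3) that by simp
  then have "(\<lambda>x\<in>carrier X. x) \<in> Hom Comod (X, \<rho>) (X, \<sigma>)"
    unfolding Hom_Comod[OF assms(1,2)] using l X(1) by (auto simp: act_closed)
  then show ?thesis by (simp add: equivariant_comodule_cat_def)
qed

lemma category_Comod: "category Comod"
proof
  fix X assume "X \<in> Obj Comod"
  then show "Ident Comod X \<in> Hom Comod X X" by (cases X) (simp add: Ident_in_Hom Obj_Comod)
next
  fix X Y Z f g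
  assume *: "X \<in> Obj Comod" "Y \<in> Obj Comod" "Z \<in> Obj Comod" "f \<in> Hom Comod X Y" "g \<in> Hom Comod Y Z"
  obtain X' \<rho> Y' \<sigma> Z' \<kappa> where e: "X = (X', \<rho>)" "Y = (Y', \<sigma>)" "Z = (Z', \<kappa>)"
    by (metis surj_pair)
  note o = *(1-3)[unfolded e Obj_Comod]
  note X = comoduleD[OF o(1)] and Y = comoduleD[OF o(2)] and Z = comoduleD[OF o(3)]
  note mX = module_M[OF X(1)] and mY = module_M[OF Y(1)] and mZ = module_M[OF Z(1)]
  note f = *(4)[unfolded e Hom_Comod[OF o(1,2)]] and g = *(5)[unfolded e Hom_Comod[OF o(2,3)]]
  have fl: "linear_map K X' Y' f" and gl: "linear_map K Y' Z' g" using f g by auto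
  note fc = linear_map_closed[OF fl]
  let ?h = "compose (carrier X') g f"
  have h: "?h x = g (f x)" if "x \<in> carrier X'" for x using that by (simp add: compose_def)
  have hl: "linear_map K X' Z' ?h"
    by (rule iffD1[OF linear_map_cong[OF mX] linear_map_comp[OF fl gl]]) (simp add: h)
  have "\<kappa> (?h x) = tmap Z' 1 ?h (\<rho> x)" if x: "x \<in> carrier X'" for x
  proof -
    have "\<kappa> (?h x) = tmap Z' 1 g (tmap Y' 1 f (\<rho> x))" using f g fc x by (simp add: h)
    also have "\<dots> = tmap Z' 1 (\<lambda>x. g (f x)) (\<rho> x)" by (rule tmap_tmap[OF mX mY mZ fl gl X(3)[OF x]])
    also have "\<dots> = tmap Z' 1 ?h (\<rho> x)"
      by (rule tmap_cong[OF mX mZ linear_map_comp[OF fl gl] _ X(3)[OF x]]) (simp add: h)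
    finally show ?thesis .
  qed
  then have "?h \<in> Hom Comod X Z"
    unfolding e Hom_Comod[OF o(1,3)] using hl f g fc X(1) by (auto simp: h act_closed)
  then show "Comp Comod X Y Z g f \<in> Hom Comod X Z"
    by (simp add: equivariant_comodule_cat_def e)
next
  fix X Y f assume *: "X \<in> Obj Comod" "Y \<in> Obj Comod" "f \<in> Hom Comod X Y"
  obtain X' \<rho> Y' \<sigma> where e: "X = (X', \<rho>)" "Y = (Y', \<sigma>)" by (metis surj_pair)
  note o = *(1,2)[unfolded e Obj_Comod]
  note f = *(3)[unfolded e Hom_Comod[OF o(1,2)]]
  have "f \<in> carrier X' \<rightarrow> carrier Y'" using f by (auto simp: linear_map_def)
  then show "Comp Comod X Y Y (Ident Comod Y) f = f" "Comp Comod X X Y f (Ident Comod X) = f"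
    using f by (simp_all add: equivariant_comodule_cat_def e Id_compose compose_Id)
next
  fix X Y Z W f g h
  assume *: "X \<in> Obj Comod" "Y \<in> Obj Comod" "f \<in> Hom Comod X Y"
    and "Z \<in> Obj Comod" "W \<in> Obj Comod" "g \<in> Hom Comod Y Z" "h \<in> Hom Comod Z W"
  obtain X' \<rho> Y' \<sigma> Z' \<kappa> where e: "X = (X', \<rho>)" "Y = (Y', \<sigma>)" "Z = (Z', \<kappa>)" by (metis surj_pair)
  note o = *(1,2)[unfolded e Obj_Comod]
  have "f x \<in> carrier Y'" if "x \<in> carrier X'" for x
    using *(3)[unfolded e Hom_Comod[OF o(1,2)]] that by (auto simp: linear_map_def)
  then show "Comp Comod X Z W h (Comp Comod X Y Z g f) = Comp Comod X Y W (Comp Comod Y Z W h g) f"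
    by (auto simp: equivariant_comodule_cat_def e compose_def fun_eq_iff)
qed

lemma Obj_conn_of:
  assumes "(X, \<rho>) \<in> Obj Comod" shows "(X, conn_of X \<rho>) \<in> Obj Conn"
proof -
  note X = comoduleD[OF assms[unfolded Obj_Comod]]
  have "connection K B \<Omega> X (conn_of X \<rho>) \<and> flat K B \<Omega> X (conn_of X \<rho>)"
    by (rule iffD2[OF flat_connection_iff[OF X(1) _ X(3)]])
      (use assms X in \<open>simp_all add: Obj_Comod conn_of_closed \<Phi>_conn_of\<close>)
  then show ?thesis using X(1) by (simp add: flat_connection_cat_def)
qed

lemma Obj_coact_of:
  assumes "(M, D) \<in> Obj Conn" shows "(M, coact_of M D) \<in> Obj Comod"
proof -
  note M = connD[OF assms]
  show ?thesis
    unfolding Obj_Comod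
    by (rule iffD1[OF flat_connection_iff[OF M(1) M(4)]])
      (use M in \<open>simp_all add: coact_of_closed \<Phi>_coact_of\<close>)
qed

text \<open>Stated for any pair of connections related to a pair of coactions, so that it applies to
  both functors.\<close>

lemma Hom_eq:
  assumes LX: "left_module K B X" and LY: "left_module K B Y"
    and "\<And>x. x \<in> carrier X \<Longrightarrow> D x \<in> carrier (FT X 1)" "\<And>x. x \<in> carrier Y \<Longrightarrow> E x \<in> carrier (FT Y 1)"
    and "\<And>x. x \<in> carrier X \<Longrightarrow> \<rho> x \<in> carrier (T 1 X)" "\<And>x. x \<in> carrier Y \<Longrightarrow> \<sigma> x \<in> carrier (T 1 Y)"
    and "\<And>x. x \<in> carrier X \<Longrightarrow> \<Phi> X 1 (D x) = \<rho> x \<ominus>\<^bsub>T 1 X\<^esub> \<tau> X [\<II>] x"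
    and "\<And>x. x \<in> carrier Y \<Longrightarrow> \<Phi> Y 1 (E x) = \<sigma> x \<ominus>\<^bsub>T 1 Y\<^esub> \<tau> Y [\<II>] x"
  shows "Hom Conn (X, D) (Y, E) = Hom Comod (X, \<rho>) (Y, \<sigma>)"
proof -
  have "E (f x) = lin_ext K (FT Y 1) (\<lambda>(\<omega>, y). fp Y 1 \<omega> (f y)) (D x) \<longleftrightarrow>
    \<sigma> (f x) = sw2 K (T 1 Y) (\<rho> x) (\<lambda>c y. \<tau> Y [c] (f y))"
    if "linear_map K X Y f" "\<forall>b\<in>carrier B. \<forall>x\<in>carrier X. f (act X b x) = act Y b (f x)" "x
        \<in> carrier X" for f x
    by (rule intertwines_iff[OF LX LY]) (use that assms linear_map_closed[OF that(1)] in auto)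
  then show ?thesis
    by (simp add: flat_connection_cat_def equivariant_comodule_cat_def cong: conj_cong ball_cong)
qed

lemma equivalent:
  "equivalent_categories
    (Comod :: (('k, 'b, 'x) left_mod \<times> ('x \<Rightarrow> ('c list \<times> 'x \<Rightarrow> 'k) set), 'x \<Rightarrow> 'x) category_data)
    (Conn :: (('k, 'b, 'x) left_mod \<times> ('x \<Rightarrow> (('c list \<times> 'b \<Rightarrow> 'k) set \<times> 'x \<Rightarrow> 'k) set), 'x \<Rightarrow> 'x)
      category_data)"
  (is "equivalent_categories ?C ?D")
proof -
  let ?F = "\<lambda>(X, \<rho>). (X, conn_of X \<rho>)" and ?G = "\<lambda>(M, D). (M, coact_of M D)"
  show ?thesis
  proof (rule equivalent_categoriesI[where F = ?F and G = ?G])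
    show "category ?C" by (rule category_Comod)
    fix X assume "X \<in> Obj ?C"
    then show "(?F X) \<in> Obj ?D"
      by (cases X) (simp add: Obj_conn_of)
  next
    fix Y assume "Y \<in> Obj ?D"
    then show "(?G Y) \<in> Obj ?C"
      by (cases Y) (simp add: Obj_coact_of)
  next
    fix X Y assume *: "X \<in> Obj ?C" "Y \<in> Obj ?C"
    obtain X' \<rho> Y' \<sigma> where e: "X = (X', \<rho>)" "Y = (Y', \<sigma>)" by (metis surj_pair)
    note X = comoduleD[OF *(1)[unfolded e Obj_Comod]]
        and Y = comoduleD[OF *(2)[unfolded e Obj_Comod]]
    show "Hom ?D (?F X) (?F Y) = Hom ?C X Y"
      unfolding e prod.case
      by (rule Hom_eq[OF X(1) Y(1)]) (use X Y in \<open>simp_all add: conn_of_closed \<Phi>_conn_of\<close>)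
  next
    fix X Y assume *: "X \<in> Obj ?D" "Y \<in> Obj ?D"
    obtain X' D Y' E where e: "X = (X', D)" "Y = (Y', E)" by (metis surj_pair)
    note X = connD[OF *(1)[unfolded e]] and Y = connD[OF *(2)[unfolded e]]
    show "Hom ?C (?G X) (?G Y) = Hom ?D X Y"
      unfolding e prod.case
      by (rule Hom_eq[OF X(1) Y(1), symmetric])
          (use X Y in \<open>simp_all add: coact_of_closed \<Phi>_coact_of\<close>)
  next
    fix X assume X: "X \<in> Obj ?C"
    obtain X' \<rho> where e: "X = (X', \<rho>)" by (metis surj_pair)
    note o = X[unfolded e]
    note o' = Obj_coact_of[OF Obj_conn_of[OF o]]
    note X' = comoduleD[OF o[unfolded Obj_Comod]]
    have eq: "coact_of X' (conn_of X' \<rho>) x = \<rho> x" if "x \<in> carrier X'" for x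
      by (rule coact_conn[of X' x \<rho>, OF X'(1) that X'(3)[OF that]])
    \<comment> \<open>The identity depends on the carrier only, so both objects share it.\<close>
    have "Ident ?C X = Ident ?C (X', coact_of X' (conn_of X' \<rho>))"
      by (simp add: e equivariant_comodule_cat_def)
    then show "Ident ?C X \<in> Hom ?C X (?G (?F X)) \<and>
      Ident ?C X \<in> Hom ?C (?G (?F X)) X"
      using Ident_in_Hom[OF o[unfolded Obj_Comod] o'[unfolded Obj_Comod]]
        Ident_in_Hom[OF o'[unfolded Obj_Comod] o[unfolded Obj_Comod]] eq
      by (simp add: e)
  qed (auto simp: equivariant_comodule_cat_def flat_connection_cat_def)
qed

end

theorem theorem4p6:
  fixes K :: "'k ring" and B :: "('k, 'b) coalg" and C :: "('k, 'c) coalg"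
    and la :: "'b \<Rightarrow> 'c \<Rightarrow> 'c" and ra :: "'c \<Rightarrow> 'b \<Rightarrow> 'c"
    and \<alpha> \<beta> :: "'b \<Rightarrow> 'b" and \<II> :: 'c
  assumes "field K"
    and "bialgebra K B"
    and "bialgebra_hom K B B \<alpha>"
    and "bialgebra_hom K B (op_cop K B) \<beta>"
    and "bimodule_coalgebra K B C la ra"
    and "grouplike K C \<II>"
  shows "equivalent_categories
    (equivariant_comodule_cat K B C la ra \<alpha> \<beta> ::
      (('k, 'b, 'x) left_mod \<times> ('x \<Rightarrow> ('c list \<times> 'x \<Rightarrow> 'k) set), 'x \<Rightarrow> 'x) category_data)
    (flat_connection_cat K B (calculus K B C la ra \<alpha> \<beta> \<II>) ::
      (('k, 'b, 'x) left_mod \<times> ('x \<Rightarrow> (('c list \<times> 'b \<Rightarrow> 'k) set \<times> 'x \<Rightarrow> 'k) set), 'x \<Rightarrow> 'x)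
        category_data)"
proof -
  have "coalgebra K C" by (rule bimodule_coalgebra.axioms(2)[OF assms(5)])
  then interpret equivariant_setting K C \<II> B la ra \<alpha> \<beta>
    by (intro equivariant_setting.intro grouplike_coalgebra.intro tensor.intro coalgebra.space
        equivariant_setting_axioms.intro grouplike_coalgebra_axioms.intro assms)
  show ?thesis by (rule equivalent)
qed

end
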